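(* Let $M\ge 1$, let $d_1,\dots,d_M\ge 2$ be integers, and for each $m\in\{1,\dots,M\}$ let $\alpha^{(m)}_{(r,d_m-r)}=\alpha^{(m)}_{(d_m-r,r)}>0$, $0\le r\le d_m$, be real numbers, all independent of $N$. For each even $N$, let $(\sigma,A)=(\sigma^{(N)},A^{(N)})$ be sampled from the symmetric model $\mathrm{HSBM}(N,M,(d_m),(\alpha^{(m)}_{\mathbf t}))$ and let $W=W^{(N)}$ be the aggregate similarity matrix of $A$. Let $$\xi=\sum_{m=1}^M 2^{-(d_m-1)}\sum_{r=0}^{d_m-1}\binom{d_m-1}{r}(d_m-1-2r)\,\alpha^{(m)}_{(r,d_m-r)},$$ $$I=\sup_{\lambda\in\mathbb R}\ \sum_{m=1}^M\sum_{r=0}^{d_m-1}2^{-(d_m-1)}\binom{d_m-1}{r}\alpha^{(m)}_{(r,d_m-r)}\left(1-e^{-\lambda(d_m-1-2r)}\right).$$ If $I>1$, then the output $\hat\sigma^{(N)}$ of the semidefinite programming algorithm (described in the context) with inputs $W$ and $s=\operatorname{sgn}(\xi)$ achieves exact recovery, i.e. $$\lim_{N\to\infty}\mathbb P\left(\hat\sigma^{(N)}\in\{\sigma^{(N)},-\sigma^{(N)}\}\right)=1,$$ where the limit is along even $N$.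
   Context: Model $\mathrm{HSBM}(N,M,(d_m),(\alpha^{(m)}_{\mathbf t}))$: $N$ is even, the node set is $[N]=\{1,\dots,N\}$. The community vector $\sigma=(\sigma_1,\dots,\sigma_N)$ is uniformly distributed on the set of vectors in $\{-1,+1\}^N$ with exactly $N/2$ entries equal to $+1$ and $N/2$ entries equal to $-1$. For $e\subset[N]$, the community profile is $\tau(e)=(\tau_{-1}(e),\tau_{+1}(e))$, where $\tau_k(e)$ is the number of $i\in e$ with $\sigma_i=k$. Conditionally on $\sigma$, the entries $A^{(m)}_e\in\{0,1\}$, indexed by $m\in\{1,\dots,M\}$ and $e\subset[N]$ with $|e|=d_m$, are independent Bernoulli variables, and $\mathbb P(A_e^{(m)}=1\mid\sigma)=p^{(m)}_{\mathbf t}$ when $\tau(e)=\mathbf t$, where $$p^{(m)}_{\mathbf t}=\min\left\{\frac{\alpha^{(m)}_{\mathbf t}\log N}{\binom{N-1}{d_m-1}},\,1\right\}.$$ The model is symmetric: $\alpha^{(m)}_{(r,d_m-r)}=\alpha^{(m)}_{(d_m-r,r)}$ for all $m$ and $0\le r\le d_m$. Aggregate similarity matrix: $W$ is the symmetric $N\times N$ matrix with zero diagonal and, for $i\ne j$, $W_{ij}=\sum_{m=1}^M\sum_{e:\,|e|=d_m,\ e\ni i,j}A^{(m)}_e$. Semidefinite programming algorithm with inputs an $N\times N$ similarity matrix $W$ and $s\in\{\pm1\}$: let $X^*\in\mathbb R^{N\times N}$ be an optimal solution of the problem of maximizing $\sum_{1\le i<j\le N}sW_{ij}X_{ij}$ over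 real symmetric matrices $X$ subject to $\sum_{i,j=1}^N X_{ij}=0$, $X_{ii}=1$ for all $i\in[N]$, and $X\succeq0$ (positive semidefinite). Let $X^*=\sum_{i=1}^N\lambda_i v_iv_i^T$ be an eigendecomposition with orthonormal $v_i$ and $\lambda_1\ge\dots\ge\lambda_N$. The output is $\hat\sigma=\operatorname{sgn}(v_1)$, the sign taken entrywise. Here $\operatorname{sgn}(x)=+1$ if $x>0$ and $-1$ if $x<0$ (any fixed convention in $\{\pm1\}$ at $0$). *)

theory Defs
  imports "HOL-Probability.Probability" "Jordan_Normal_Form.Matrix"
begin

hide_type (open) Finite_Cartesian_Product.vec
hide_const (open) Finite_Cartesian_Product.vec Finite_Cartesian_Product.mat
unbundle no vec_syntax and no inner_syntax

text \<open>
  Vectors and matrices whose dimension is a natural number are those of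
  \<^theory>\<open>Jordan_Normal_Form.Matrix\<close>. Their indices start at 0, so the node set is
  \<open>{..<N}\<close> rather than \<open>{1..N}\<close>.
\<close>

definition communities :: "nat \<Rightarrow> real vec set" where
  "communities N = {\<sigma> \<in> carrier_vec N.
     (\<forall>i<N. \<sigma> $ i \<in> {-1, 1}) \<and>
     card {i. i < N \<and> \<sigma> $ i = 1} = N div 2 \<and>
     card {i. i < N \<and> \<sigma> $ i = -1} = N div 2}"

definition profile :: "real vec \<Rightarrow> nat set \<Rightarrow> nat \<times> nat" where
  "profile \<sigma> e = (card {i \<in> e. \<sigma> $ i = -1}, card {i \<in> e. \<sigma> $ i = 1})"

definition hyperedges :: "nat \<Rightarrow> nat \<Rightarrow> nat set set" where
  "hyperedges N k = {e. e \<subseteq> {..<N} \<and> card e = k}"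

definition edge_prob ::
  "nat \<Rightarrow> (nat \<Rightarrow> nat) \<Rightarrow> (nat \<Rightarrow> nat \<times> nat \<Rightarrow> real) \<Rightarrow> nat \<Rightarrow> nat \<times> nat \<Rightarrow> real" where
  "edge_prob N d \<alpha> m t = min (\<alpha> m t * ln (real N) / real ((N - 1) choose (d m - 1))) 1"

text \<open>
  Layer \<open>m\<close> has hyperedges of size \<open>d m\<close>; \<open>A (m, e)\<close> states that hyperedge \<open>e\<close> is present in
  layer \<open>m\<close>. Outside the index set of the product, \<open>A\<close> is \<open>False\<close>.
\<close>

definition hsbm ::
  "nat \<Rightarrow> nat \<Rightarrow> (nat \<Rightarrow> nat) \<Rightarrow> (nat \<Rightarrow> nat \<times> nat \<Rightarrow> real) \<Rightarrow>
   (real vec \<times> (nat \<times> nat set \<Rightarrow> bool)) pmf" where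
  "hsbm N M d \<alpha> =
     bind_pmf (pmf_of_set (communities N)) (\<lambda>\<sigma>.
       map_pmf (\<lambda>A. (\<sigma>, A))
         (Pi_pmf (SIGMA m:{1..M}. hyperedges N (d m)) False
           (\<lambda>(m, e). bernoulli_pmf (edge_prob N d \<alpha> m (profile \<sigma> e)))))"

definition similarity_matrix ::
  "nat \<Rightarrow> nat \<Rightarrow> (nat \<Rightarrow> nat) \<Rightarrow> (nat \<times> nat set \<Rightarrow> bool) \<Rightarrow> real mat" where
  "similarity_matrix N M d A = mat N N (\<lambda>(i, j).
     if i = j then 0
     else \<Sum>m=1..M. \<Sum>e\<in>{e \<in> hyperedges N (d m). i \<in> e \<and> j \<in> e}. of_bool (A (m, e)))"

definition pos_semidef :: "nat \<Rightarrow> real mat \<Rightarrow> bool" where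
  "pos_semidef N X \<longleftrightarrow> (\<forall>x \<in> carrier_vec N. 0 \<le> x \<bullet> (X *\<^sub>v x))"

definition sdp_feasible :: "nat \<Rightarrow> real mat set" where
  "sdp_feasible N = {X \<in> carrier_mat N N.
     transpose_mat X = X \<and>
     (\<Sum>i<N. \<Sum>j<N. X $$ (i, j)) = 0 \<and>
     (\<forall>i<N. X $$ (i, i) = 1) \<and>
     pos_semidef N X}"

definition sdp_objective :: "nat \<Rightarrow> real mat \<Rightarrow> real \<Rightarrow> real mat \<Rightarrow> real" where
  "sdp_objective N W s X = (\<Sum>j<N. \<Sum>i<j. s * W $$ (i, j) * X $$ (i, j))"

definition sdp_optimal :: "nat \<Rightarrow> real mat \<Rightarrow> real \<Rightarrow> real mat \<Rightarrow> bool" where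
  "sdp_optimal N W s X \<longleftrightarrow>
     X \<in> sdp_feasible N \<and> (\<forall>Y \<in> sdp_feasible N. sdp_objective N W s Y \<le> sdp_objective N W s X)"

definition eigendecomposition ::
  "nat \<Rightarrow> real mat \<Rightarrow> (nat \<Rightarrow> real) \<Rightarrow> (nat \<Rightarrow> real vec) \<Rightarrow> bool" where
  "eigendecomposition N X \<mu> v \<longleftrightarrow>
     (\<forall>k<N. v k \<in> carrier_vec N) \<and>
     (\<forall>k<N. \<forall>l<N. v k \<bullet> v l = (if k = l then 1 else 0)) \<and>
     (\<forall>k l. k \<le> l \<and> l < N \<longrightarrow> \<mu> l \<le> \<mu> k) \<and>
     X = mat N N (\<lambda>(i, j). \<Sum>k<N. \<mu> k * v k $ i * v k $ j)"

definition sgn_at :: "real \<Rightarrow> real \<Rightarrow> real" where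
  "sgn_at c x = (if x > 0 then 1 else if x < 0 then -1 else c)"

text \<open>
  Neither the optimal solution nor its eigendecomposition need be unique, so the algorithm has a
  set of admissible outputs. The parameter \<open>c\<close> is the value of the sign function at 0.
\<close>

definition sdp_outputs :: "real \<Rightarrow> nat \<Rightarrow> real mat \<Rightarrow> real \<Rightarrow> real vec set" where
  "sdp_outputs c N W s =
     {map_vec (sgn_at c) (v 0) | X \<mu> v. sdp_optimal N W s X \<and> eigendecomposition N X \<mu> v}"

text \<open>
  Exact recovery is required of every admissible output; their existence is included so that the
  event cannot hold vacuously.
\<close>

definition sdp_recovers ::
  "real \<Rightarrow> nat \<Rightarrow> nat \<Rightarrow> (nat \<Rightarrow> nat) \<Rightarrow> real \<Rightarrow> (real vec \<times> (nat \<times> nat set \<Rightarrow> bool)) set" where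
  "sdp_recovers c N M d s = {(\<sigma>, A).
     sdp_outputs c N (similarity_matrix N M d A) s \<noteq> {} \<and>
     sdp_outputs c N (similarity_matrix N M d A) s \<subseteq> {\<sigma>, - \<sigma>}}"

definition xi :: "nat \<Rightarrow> (nat \<Rightarrow> nat) \<Rightarrow> (nat \<Rightarrow> nat \<times> nat \<Rightarrow> real) \<Rightarrow> real" where
  "xi M d \<alpha> = (\<Sum>m=1..M. (1 / 2 ^ (d m - 1)) *
     (\<Sum>r=0..d m - 1. real ((d m - 1) choose r) * (real (d m) - 1 - 2 * real r) * \<alpha> m (r, d m - r)))"

definition recovery_rate :: "nat \<Rightarrow> (nat \<Rightarrow> nat) \<Rightarrow> (nat \<Rightarrow> nat \<times> nat \<Rightarrow> real) \<Rightarrow> real" where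
  "recovery_rate M d \<alpha> = (SUP l::real. \<Sum>m=1..M. \<Sum>r=0..d m - 1.
     (1 / 2 ^ (d m - 1)) * real ((d m - 1) choose r) * \<alpha> m (r, d m - r) *
     (1 - exp (- l * (real (d m) - 1 - 2 * real r))))"

end

theory Submission
  imports Defs "HOL-Real_Asymp.Real_Asymp"
begin

text \<open>
  Fix the communities \<open>\<sigma>\<close>, write \<open>s\<close> for the sign of \<open>\<xi>\<close> and \<open>w = s W\<close>, and let \<open>D\<close> be the diagonal
  matrix of the signed degrees \<open>D\<^sub>i = \<Sum>\<^sub>j w\<^sub>i\<^sub>j \<sigma>\<^sub>i \<sigma>\<^sub>j\<close>. The matrix \<open>D - w\<close> annihilates \<open>\<sigma>\<close>, and it is
  the dual certificate of the semidefinite program: if its quadratic form is positive on all nonzero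
  vectors orthogonal to \<open>1\<close> and to \<open>\<sigma>\<close>, then \<open>\<sigma> \<sigma>\<^sup>T\<close> is the only optimal solution
  (\<open>sdp_dual_certificate\<close>, proved with a Gram decomposition of the competitor), and every leading
  eigenvector of \<open>\<sigma> \<sigma>\<^sup>T\<close> is a multiple of \<open>\<sigma>\<close>. It remains to show that, with probability tending to 1,
  every \<open>D\<^sub>i\<close> is at least \<open>\<epsilon> ln N\<close> for a fixed \<open>\<epsilon> > 0\<close>, while the form of \<open>w\<close> on such vectors is at
  most \<open>(\<epsilon> / 2) ln N\<close> times the squared norm.
  
  Signed degrees. \<open>D\<^sub>i\<close> is a sum of independent contributions of the hyperedges at \<open>i\<close>; one with \<open>r\<close>
  members in the opposite community contributes \<open>s (d - 1 - 2 r)\<close>. The exponential Markov inequality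
  with parameter \<open>l\<close> gives \<open>P (D\<^sub>i \<le> \<epsilon> ln N) \<le> N powr (\<bar>l\<bar> \<epsilon> - f l + o(1))\<close>, where the supremum of \<open>f\<close>
  is the recovery rate. As this exceeds 1, some \<open>l\<close> has \<open>f l > 1\<close>, and a small \<open>\<epsilon>\<close> lets a union bound over
  \<open>i\<close> succeed. The inequality \<open>f l \<le> l \<xi>\<close> shows that \<open>l\<close> has the sign \<open>s\<close>, which is why this is the sign
  that the algorithm must use.
  
  Quadratic form. Split \<open>W\<close> into its mean \<open>V\<close> given \<open>\<sigma>\<close> and the fluctuation \<open>W - V\<close>. By exchangeability
  within the communities and the symmetry of the rates, \<open>V\<close> is off the diagonal a combination of the
  all-ones matrix and \<open>\<sigma> \<sigma>\<^sup>T\<close>, so on vectors orthogonal to both it acts as a scalar of size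
  \<open>O(ln N / N)\<close> (\<open>V_form_orthogonal\<close>). For the fluctuation the bound \<open>\<tau> ln N\<close>, for an arbitrary fixed
  \<open>\<tau> > 0\<close>, suffices (\<open>centered_quadratic_form_small\<close>), which is weaker than the usual \<open>O(sqrt (ln N))\<close> bound. The
  slack is what makes the following direct argument work, for a unit vector \<open>x\<close> and a large constant \<open>K\<close>.
  
  \<^item> The part of \<open>x\<close> with \<open>\<bar>x\<^sub>i\<bar> \<le> K / sqrt N\<close> is rounded to a grid with \<open>const ^ N\<close> points. At each grid
    point a large deviation has probability \<open>exp (- c N ln N)\<close>, so a union bound wins by the factor \<open>ln N\<close>
    in the exponent.
  
  \<^item> Pairs with a larger coordinate are controlled by positivity alone. By
    \<open>\<bar>x\<^sub>i\<bar> \<bar>x\<^sub>j\<bar> \<le> min\<^sup>2 / (2 \<gamma>) + \<gamma> max\<^sup>2 / 2\<close> they cost at most \<open>\<gamma>\<close> times the maximal degree, which is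
    \<open>O(ln N)\<close>, plus \<open>1 / (2 \<gamma>)\<close> times \<open>\<Sum> W\<^sub>i\<^sub>j min (x\<^sub>i\<^sup>2) (x\<^sub>j\<^sup>2)\<close>. The level sets of \<open>x\<close> above
    \<open>\<eta> K / sqrt N\<close> are small subsets of the vertices, all small subsets \<open>S\<close> carry weight at most
    \<open>\<epsilon>' ln N\<close> times their size, and summation over the levels bounds the last sum by \<open>\<epsilon>' ln N\<close>.
\<close>



section \<open>A deterministic bound for quadratic forms of sparse matrices\<close>

text \<open>
  The layer-cake argument for \<open>min\<close>: the weight of the pairs with \<open>min (u i) (u j) \<ge> t\<close> is the weight
  inside the level set of \<open>u\<close> at height \<open>t\<close>. Integration over \<open>t\<close> becomes an induction that lowers all
  values by the least one and then drops the vertex where it is attained.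
\<close>

lemma sum_min_le_of_sparse_subsets:
  fixes w :: "'a \<Rightarrow> 'a \<Rightarrow> real" and u :: "'a \<Rightarrow> real"
  assumes "finite H" and "\<And>i. i \<in> H \<Longrightarrow> 0 \<le> u i"
    and "\<And>S. S \<subseteq> H \<Longrightarrow> (\<Sum>i\<in>S. \<Sum>j\<in>S. w i j) \<le> a * real (card S)"
  shows "(\<Sum>i\<in>H. \<Sum>j\<in>H. w i j * min (u i) (u j)) \<le> a * (\<Sum>i\<in>H. u i)"
  using assms
proof (induction "card H" arbitrary: H u)
  case 0
  then show ?case by simp
next
  case (Suc n)
  then have "H \<noteq> {}" by auto
  then obtain k where k: "k \<in> H" "\<And>i. i \<in> H \<Longrightarrow> u k \<le> u i"
    using ex_min_if_finite[of "u ` H"] Suc.prems(1) by (auto simp: not_less)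
  define u' where "u' i = u i - u k" for i
  define K where "K = H - {k}"
  have H: "H = insert k K" "k \<notin> K" "finite K" using k Suc.prems(1) by (auto simp: K_def)
  have u': "u' k = 0" "\<And>i. i \<in> H \<Longrightarrow> 0 \<le> u' i" using k by (auto simp: u'_def)
  have IH: "(\<Sum>i\<in>K. \<Sum>j\<in>K. w i j * min (u' i) (u' j)) \<le> a * (\<Sum>i\<in>K. u' i)"
  proof (rule Suc.hyps(1))
    show "n = card K" using Suc.hyps(2) H by simp
    show "finite K" by (rule H)
    show "\<And>i. i \<in> K \<Longrightarrow> 0 \<le> u' i" using u' H by auto
    show "\<And>S. S \<subseteq> K \<Longrightarrow> (\<Sum>i\<in>S. \<Sum>j\<in>S. w i j) \<le> a * real (card S)"
      using Suc.prems(3) H(1) by (meson subset_insertI2)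
  qed
  have min_u': "w i j * min (u i) (u j) = u k * w i j + w i j * min (u' i) (u' j)" for i j
    by (simp add: u'_def min_def algebra_simps)
  have z: "min (u' i) (u' k) = 0" "min (u' k) (u' i) = 0" if "i \<in> H" for i
    using u' that by auto
  have "(\<Sum>i\<in>H. \<Sum>j\<in>H. w i j * min (u' i) (u' j)) = (\<Sum>i\<in>K. \<Sum>j\<in>K. w i j * min (u' i) (u' j))"
    using H z by (simp add: sum.insert)
  then have "(\<Sum>i\<in>H. \<Sum>j\<in>H. w i j * min (u i) (u j)) =
      u k * (\<Sum>i\<in>H. \<Sum>j\<in>H. w i j) + (\<Sum>i\<in>K. \<Sum>j\<in>K. w i j * min (u' i) (u' j))"
    by (simp add: min_u' sum.distrib sum_distrib_left)
  also have "\<dots> \<le> u k * (a * card H) + a * (\<Sum>i\<in>K. u' i)"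
    using Suc.prems(2)[OF k(1)] Suc.prems(3)[of H] IH by (intro add_mono mult_left_mono) auto
  also have "(\<Sum>i\<in>K. u' i) = (\<Sum>i\<in>H. u' i)" using H u' by simp
  also have "u k * (a * card H) + a * \<dots> = a * (\<Sum>i\<in>H. u i)"
    by (simp add: u'_def sum_subtractf algebra_simps)
  finally show ?case .
qed

lemma young_real:
  fixes a b c :: real
  assumes "c > 0"
  shows "a * b \<le> (a\<^sup>2 / c + c * b\<^sup>2) / 2"
proof -
  have "0 \<le> (a - c * b)\<^sup>2 / c" using assms by simp
  also have "\<dots> = a\<^sup>2 / c + c * b\<^sup>2 - 2 * (a * b)"
    using assms by (simp add: field_simps power2_eq_square)
  finally show ?thesis by simp
qed

text \<open>
  Schur's test with a free parameter \<open>c\<close>, which will balance a rounding error of norm \<open>h\<close> against a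
  vector of norm 1.
\<close>

lemma bilinear_form_le_row_sums:
  fixes R :: "nat \<Rightarrow> nat \<Rightarrow> real"
  assumes nonneg: "\<And>i j. 0 \<le> R i j"
    and row: "\<And>i. i < N \<Longrightarrow> (\<Sum>j<N. R i j) \<le> B" and col: "\<And>j. j < N \<Longrightarrow> (\<Sum>i<N. R i j) \<le> B"
    and "(\<Sum>i<N. (a i)\<^sup>2) \<le> A" "(\<Sum>i<N. (b i)\<^sup>2) \<le> D" "c > 0" "0 \<le> B"
  shows "(\<Sum>i<N. \<Sum>j<N. R i j * (a i * b j)) \<le> B * (A / c + c * D) / 2"
proof -
  have "(\<Sum>i<N. \<Sum>j<N. R i j * (a i * b j)) \<le>
      (\<Sum>i<N. \<Sum>j<N. R i j * (((a i)\<^sup>2 / c + c * (b j)\<^sup>2) / 2))"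
    by (intro sum_mono mult_left_mono young_real nonneg assms)
  also have "\<dots> = (\<Sum>i<N. \<Sum>j<N. R i j * ((a i)\<^sup>2 / (2 * c))) + (\<Sum>i<N. \<Sum>j<N. R i j * (c / 2 * (b j)\<^sup>2))"
    unfolding sum.distrib[symmetric] using \<open>c > 0\<close>
    by (intro sum.cong refl) (simp add: field_simps)
  also have "(\<Sum>i<N. \<Sum>j<N. R i j * (c / 2 * (b j)\<^sup>2)) = (\<Sum>j<N. \<Sum>i<N. R i j * (c / 2 * (b j)\<^sup>2))"
    by (rule sum.swap)
  also have "(\<Sum>i<N. \<Sum>j<N. R i j * ((a i)\<^sup>2 / (2 * c))) \<le> (\<Sum>i<N. B * ((a i)\<^sup>2 / (2 * c)))"
    unfolding sum_distrib_right[symmetric]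
    using \<open>c > 0\<close> by (intro sum_mono mult_right_mono row) auto
  also have "(\<Sum>j<N. \<Sum>i<N. R i j * (c / 2 * (b j)\<^sup>2)) \<le> (\<Sum>j<N. B * (c / 2 * (b j)\<^sup>2))"
    unfolding sum_distrib_right[symmetric]
    using \<open>c > 0\<close> by (intro sum_mono mult_right_mono col) auto
  also have "(\<Sum>i<N. B * ((a i)\<^sup>2 / (2 * c))) = B / (2 * c) * (\<Sum>i<N. (a i)\<^sup>2)"
    by (simp add: sum_distrib_left)
  also have "\<dots> \<le> B / (2 * c) * A"
    using assms by (intro mult_left_mono) auto
  also have "(\<Sum>j<N. B * (c / 2 * (b j)\<^sup>2)) = B * c / 2 * (\<Sum>j<N. (b j)\<^sup>2)"
    by (simp add: sum_distrib_left mult.assoc)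
  also have "\<dots> \<le> B * c / 2 * D"
    using assms by (intro mult_left_mono) auto
  also have "B / (2 * c) * A + B * c / 2 * D = B * (A / c + c * D) / 2"
    using \<open>c > 0\<close> by (simp add: field_simps)
  finally show ?thesis by simp
qed

text \<open>
  Rounding is towards zero, so that the rounded vector has no larger norm and no larger entries.
\<close>

lemma exists_truncation_to_grid:
  fixes z g :: real and Q :: nat
  assumes "0 < g" "\<bar>z\<bar> \<le> real Q * g"
  shows "\<exists>k::int. k \<in> {- int Q..int Q} \<and> \<bar>z - g * of_int k\<bar> \<le> g \<and> \<bar>g * of_int k\<bar> \<le> \<bar>z\<bar>"
proof -
  have *: "\<exists>k::int. k \<in> {0..int Q} \<and> \<bar>y - g * of_int k\<bar> \<le> g \<and> \<bar>g * of_int k\<bar> \<le> y"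
    if "0 \<le> y" "y \<le> real Q * g" for y
  proof (intro exI[of _ "\<lfloor>y / g\<rfloor>"] conjI)
    have r: "of_int \<lfloor>y / g\<rfloor> \<le> y / g" "y / g < of_int \<lfloor>y / g\<rfloor> + 1" by linarith+
    have f0: "0 \<le> \<lfloor>y / g\<rfloor>" using that assms by simp
    have "y / g \<le> real Q" using that assms by (simp add: field_simps)
    then have "\<lfloor>y / g\<rfloor> \<le> int Q" by (simp add: floor_le_iff)
    with f0 show "\<lfloor>y / g\<rfloor> \<in> {0..int Q}" by simp
    have r': "g * of_int \<lfloor>y / g\<rfloor> \<le> y" "y \<le> g * of_int \<lfloor>y / g\<rfloor> + g"
      using mult_left_mono[OF r(1), of g] mult_left_mono[OF less_imp_le[OF r(2)], of g] assms
      by (simp_all add: distrib_left)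
    then show "\<bar>y - g * of_int \<lfloor>y / g\<rfloor>\<bar> \<le> g" by linarith
    have "0 \<le> g * of_int \<lfloor>y / g\<rfloor>" using f0 assms by simp
    with r' show "\<bar>g * of_int \<lfloor>y / g\<rfloor>\<bar> \<le> y" by linarith
  qed
  show ?thesis
  proof (cases "0 \<le> z")
    case True
    then obtain k where k: "k \<in> {0..int Q}" "\<bar>z - g * of_int k\<bar> \<le> g" "\<bar>g * of_int k\<bar> \<le> z"
      using *[of z] assms by auto
    show ?thesis by (rule exI[of _ k]) (use k True in auto)
  next
    case False
    then obtain k where k: "k \<in> {0..int Q}" "\<bar>- z - g * of_int k\<bar> \<le> g" "\<bar>g * of_int k\<bar> \<le> - z"
      using *[of "- z"] assms by auto
    show ?thesis by (rule exI[of _ "- k"]) (use k False in auto)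
  qed
qed

text \<open>
  The rounding error is governed by the row and column sums of \<open>\<bar>R\<bar>\<close>. They are of the order of the target, and the factor
  \<open>h\<close>, the norm of the vector of rounding errors, makes the error small.
\<close>

lemma quadratic_form_le_of_grid:
  fixes R :: "nat \<Rightarrow> nat \<Rightarrow> real"
  assumes "N \<ge> 1" "h > 0" "0 \<le> B"
    and row: "\<And>i. i < N \<Longrightarrow> (\<Sum>j<N. \<bar>R i j\<bar>) \<le> B" and col: "\<And>j. j < N \<Longrightarrow> (\<Sum>i<N. \<bar>R i j\<bar>) \<le> B"
    and grid: "\<And>k :: nat \<Rightarrow> int. k \<in> PiE {..<N} (\<lambda>_. {- int Q..int Q}) \<Longrightarrow>
        (\<Sum>i<N. \<Sum>j<N. R i j * ((h / sqrt N * k i) * (h / sqrt N * k j))) \<le> b"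
    and z: "(\<Sum>i<N. (z i)\<^sup>2) \<le> 1" "\<And>i. i < N \<Longrightarrow> \<bar>z i\<bar> \<le> Q * h / sqrt N"
  shows "(\<Sum>i<N. \<Sum>j<N. R i j * (z i * z j)) \<le> b + 2 * B * h"
proof -
  define g where "g = h / sqrt N"
  have g: "g > 0" "real N * g\<^sup>2 = h\<^sup>2"
    using assms(1,2) by (auto simp: g_def power_divide)
  have "\<forall>i\<in>{..<N}. \<exists>k::int. k \<in> {- int Q..int Q} \<and> \<bar>z i - g * of_int k\<bar> \<le> g \<and> \<bar>g * of_int k\<bar> \<le> \<bar>z i\<bar>"
    using z(2) g by (intro ballI exists_truncation_to_grid) (auto simp: g_def)
  then obtain k0 where k0: "\<And>i. i < N \<Longrightarrow> k0 i \<in> {- int Q..int Q} \<and> \<bar>z i - g * of_int (k0 i)\<bar> \<le> g \<and>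
      \<bar>g * of_int (k0 i)\<bar> \<le> \<bar>z i\<bar>"
    unfolding bchoice_iff by auto
  define k where "k = restrict k0 {..<N}"
  define y where "y i = g * of_int (k i)" for i
  have k: "k \<in> PiE {..<N} (\<lambda>_. {- int Q..int Q})" using k0 by (auto simp: k_def)
  have y: "\<bar>z i - y i\<bar> \<le> g" "\<bar>y i\<bar> \<le> \<bar>z i\<bar>" if "i < N" for i
    using k0[OF that] that by (auto simp: k_def y_def)
  have dz: "(\<Sum>i<N. (\<bar>z i - y i\<bar>)\<^sup>2) \<le> h\<^sup>2"
  proof -
    have "(\<Sum>i<N. (\<bar>z i - y i\<bar>)\<^sup>2) \<le> (\<Sum>i<N. g\<^sup>2)"
      using y g by (intro sum_mono power_mono) auto
    then show ?thesis using g by simp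
  qed
  have yy: "(\<Sum>i<N. (\<bar>y i\<bar>)\<^sup>2) \<le> 1"
  proof -
    have "(\<Sum>i<N. (\<bar>y i\<bar>)\<^sup>2) \<le> (\<Sum>i<N. (\<bar>z i\<bar>)\<^sup>2)"
      using y by (intro sum_mono power_mono) auto
    then show ?thesis using z(1) by simp
  qed
  have "(\<Sum>i<N. \<Sum>j<N. R i j * (z i * z j)) \<le> (\<Sum>i<N. \<Sum>j<N. R i j * (y i * y j) +
      (\<bar>R i j\<bar> * (\<bar>z i - y i\<bar> * \<bar>z j\<bar>) + \<bar>R i j\<bar> * (\<bar>y i\<bar> * \<bar>z j - y j\<bar>)))"
  proof (intro sum_mono)
    fix i j
    have "R i j * (z i * z j) - R i j * (y i * y j) = R i j * ((z i - y i) * z j) + R i j * (y i * (z j - y j))"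
      by (simp add: algebra_simps)
    also have "\<dots> \<le> \<bar>R i j * ((z i - y i) * z j)\<bar> + \<bar>R i j * (y i * (z j - y j))\<bar>" by linarith
    finally show "R i j * (z i * z j) \<le> R i j * (y i * y j) +
      (\<bar>R i j\<bar> * (\<bar>z i - y i\<bar> * \<bar>z j\<bar>) + \<bar>R i j\<bar> * (\<bar>y i\<bar> * \<bar>z j - y j\<bar>))"
      by (simp add: abs_mult)
  qed
  also have "\<dots> = (\<Sum>i<N. \<Sum>j<N. R i j * (y i * y j)) +
      ((\<Sum>i<N. \<Sum>j<N. \<bar>R i j\<bar> * (\<bar>z i - y i\<bar> * \<bar>z j\<bar>)) +
      (\<Sum>i<N. \<Sum>j<N. \<bar>R i j\<bar> * (\<bar>y i\<bar> * \<bar>z j - y j\<bar>)))"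
    by (simp add: sum.distrib)
  also have "\<dots> \<le> b + (B * (h\<^sup>2 / h + h * 1) / 2 + B * (1 / (1 / h) + (1 / h) * h\<^sup>2) / 2)"
  proof (intro add_mono)
    show "(\<Sum>i<N. \<Sum>j<N. R i j * (y i * y j)) \<le> b"
      using grid[OF k] by (simp add: y_def g_def)
    show "(\<Sum>i<N. \<Sum>j<N. \<bar>R i j\<bar> * (\<bar>z i - y i\<bar> * \<bar>z j\<bar>)) \<le> B * (h\<^sup>2 / h + h * 1) / 2"
      by (rule bilinear_form_le_row_sums) (use assms dz z in auto)
    show "(\<Sum>i<N. \<Sum>j<N. \<bar>R i j\<bar> * (\<bar>y i\<bar> * \<bar>z j - y j\<bar>)) \<le> B * (1 / (1 / h) + (1 / h) * h\<^sup>2) / 2"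
      by (rule bilinear_form_le_row_sums) (use assms dz yy in auto)
  qed
  also have "\<dots> = b + 2 * B * h"
    using \<open>h > 0\<close> by (simp add: field_simps power2_eq_square)
  finally show ?thesis .
qed

text \<open>
  Pairs with at least one entry above the threshold \<open>T\<close>. If both entries are at least \<open>\<eta> T\<close>, the
  layer-cake bound applies, because the level sets above \<open>\<eta> T\<close> are small enough for \<open>sparse\<close>.
  Otherwise the smaller entry is below \<open>\<eta> T\<close>, and at most \<open>1 / T\<^sup>2\<close> vertices lie above \<open>T\<close>, so these
  pairs contribute at most \<open>2 \<eta>\<^sup>2\<close> times the maximal degree to the sum of the squared minima.
\<close>

lemma heavy_pairs_weight_le:
  fixes W :: "nat \<Rightarrow> nat \<Rightarrow> real"
  assumes nonneg: "\<And>i j. 0 \<le> W i j" and sym: "\<And>i j. W i j = W j i"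
    and row: "\<And>i. i < N \<Longrightarrow> (\<Sum>j<N. W i j) \<le> B"
    and x: "(\<Sum>i<N. (x i)\<^sup>2) \<le> 1" and T: "T > 0" and \<eta>: "\<eta> > 0" and \<gamma>: "\<gamma> > 0" and "0 \<le> B" "0 \<le> \<epsilon>"
    and sparse: "\<And>S. S \<subseteq> {..<N} \<Longrightarrow> real (card S) * (\<eta> * T)\<^sup>2 \<le> 1 \<Longrightarrow>
      (\<Sum>i\<in>S. \<Sum>j\<in>S. W i j) \<le> \<epsilon> * real (card S)"
  shows "(\<Sum>i<N. \<Sum>j<N. of_bool (T < \<bar>x i\<bar> \<or> T < \<bar>x j\<bar>) * W i j * (\<bar>x i\<bar> * \<bar>x j\<bar>))
     \<le> (\<epsilon> + 2 * \<eta>\<^sup>2 * B) / (2 * \<gamma>) + \<gamma> * B"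
proof -
  define H where "H = {i. i < N \<and> \<eta> * T \<le> \<bar>x i\<bar>}"
  define G where "G = {i. i < N \<and> T < \<bar>x i\<bar>}"
  have fin: "finite H" "finite G" "H \<subseteq> {..<N}" "G \<subseteq> {..<N}" by (auto simp: H_def G_def)
  have sub: "(\<Sum>i\<in>S. (x i)\<^sup>2) \<le> 1" if "S \<subseteq> {..<N}" for S
    by (rule order_trans[OF _ x], rule sum_mono2) (use that in auto)
  have cardH: "real (card H) * (\<eta> * T)\<^sup>2 \<le> 1"
  proof -
    have "real (card H) * (\<eta> * T)\<^sup>2 = (\<Sum>i\<in>H. (\<eta> * T)\<^sup>2)" by simp
    also have "\<dots> \<le> (\<Sum>i\<in>H. \<bar>x i\<bar>\<^sup>2)" using T \<eta> by (intro sum_mono power_mono) (auto simp: H_def)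
    finally show ?thesis using sub[OF fin(3)] by simp
  qed
  have cardG: "real (card G) * T\<^sup>2 \<le> 1"
  proof -
    have "real (card G) * T\<^sup>2 = (\<Sum>i\<in>G. T\<^sup>2)" by simp
    also have "\<dots> \<le> (\<Sum>i\<in>G. \<bar>x i\<bar>\<^sup>2)" using T by (intro sum_mono power_mono) (auto simp: G_def)
    finally show ?thesis using sub[OF fin(4)] by simp
  qed
  have layer: "(\<Sum>i\<in>H. \<Sum>j\<in>H. W i j * min ((x i)\<^sup>2) ((x j)\<^sup>2)) \<le> \<epsilon>"
  proof -
    have "(\<Sum>i\<in>H. \<Sum>j\<in>H. W i j * min ((x i)\<^sup>2) ((x j)\<^sup>2)) \<le> \<epsilon> * (\<Sum>i\<in>H. (x i)\<^sup>2)"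
    proof (rule sum_min_le_of_sparse_subsets)
      fix S assume S: "S \<subseteq> H"
      have "real (card S) * (\<eta> * T)\<^sup>2 \<le> real (card H) * (\<eta> * T)\<^sup>2"
        using card_mono[OF fin(1) S] by (intro mult_right_mono) auto
      then show "(\<Sum>i\<in>S. \<Sum>j\<in>S. W i j) \<le> \<epsilon> * real (card S)"
        using S fin cardH by (intro sparse) auto
    qed (use fin in auto)
    also have "\<dots> \<le> \<epsilon>" using sub[OF fin(3)] \<open>0 \<le> \<epsilon>\<close> by (simp add: mult_left_le)
    finally show ?thesis .
  qed
  have pointwise: "of_bool (T < \<bar>x i\<bar> \<or> T < \<bar>x j\<bar>) * (\<bar>x i\<bar> * \<bar>x j\<bar>) \<le>
      (of_bool (i \<in> H \<and> j \<in> H) * min ((x i)\<^sup>2) ((x j)\<^sup>2) + (\<eta> * T)\<^sup>2 * (of_bool (i \<in> G) + of_bool (j \<in> G))) / (2 * \<gamma>)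
      + \<gamma> / 2 * ((x i)\<^sup>2 + (x j)\<^sup>2)" (is "?l \<le> (?m) / _ + ?r") if "i < N" "j < N" for i j
  proof (cases "T < \<bar>x i\<bar> \<or> T < \<bar>x j\<bar>")
    case False
    have "0 \<le> ?m / (2 * \<gamma>) + ?r" using \<gamma> by (intro add_nonneg_nonneg divide_nonneg_pos) auto
    then show ?thesis using False by simp
  next
    case True
    define mn mx where "mn = min \<bar>x i\<bar> \<bar>x j\<bar>" "mx = max \<bar>x i\<bar> \<bar>x j\<bar>"
    have "\<bar>x i\<bar> * \<bar>x j\<bar> = mn * mx" by (auto simp: mn_mx_def min_def max_def)
    also have "\<dots> \<le> (mn\<^sup>2 / \<gamma> + \<gamma> * mx\<^sup>2) / 2" by (rule young_real[OF \<gamma>])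
    also have "\<dots> \<le> ?m / (2 * \<gamma>) + ?r"
    proof -
      have mx: "mx\<^sup>2 \<le> (x i)\<^sup>2 + (x j)\<^sup>2" by (auto simp: mn_mx_def max_def)
      have mn: "mn\<^sup>2 \<le> ?m"
      proof (cases "i \<in> H \<and> j \<in> H")
        case True
        have "mn\<^sup>2 = min ((x i)\<^sup>2) ((x j)\<^sup>2)"
          by (auto simp: mn_mx_def min_def abs_le_square_iff)
        then show ?thesis using True by simp
      next
        case F: False
        have "mn\<^sup>2 \<le> (\<eta> * T)\<^sup>2"
          using F that T \<eta> by (intro power_mono) (auto simp: mn_mx_def H_def)
        also have "\<dots> \<le> ?m" using True F that by (auto simp: G_def)
        finally show ?thesis .
      qed
      have "(mn\<^sup>2 / \<gamma> + \<gamma> * mx\<^sup>2) / 2 = mn\<^sup>2 / (2 * \<gamma>) + \<gamma> / 2 * mx\<^sup>2" by (simp add: field_simps)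
      also have "\<dots> \<le> ?m / (2 * \<gamma>) + ?r"
        using mn mx \<gamma> by (intro add_mono divide_right_mono mult_left_mono) auto
      finally show ?thesis .
    qed
    finally show ?thesis using True by simp
  qed
  have col: "(\<Sum>i<N. W i j) \<le> B" if "j < N" for j
    using row[OF that] by (subst (asm) sym) simp
  have sq: "(\<Sum>i<N. \<Sum>j<N. W i j * (x i)\<^sup>2) \<le> B"
  proof -
    have "(\<Sum>i<N. \<Sum>j<N. W i j * (x i)\<^sup>2) \<le> (\<Sum>i<N. B * (x i)\<^sup>2)"
      unfolding sum_distrib_right[symmetric] by (intro sum_mono mult_right_mono row) auto
    also have "\<dots> \<le> B" unfolding sum_distrib_left[symmetric] using x \<open>0 \<le> B\<close> by (simp add: mult_left_le)
    finally show ?thesis .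
  qed
  have sqG: "(\<Sum>i<N. \<Sum>j<N. W i j * of_bool (i \<in> G)) \<le> B * card G"
  proof -
    have "(\<Sum>i<N. \<Sum>j<N. W i j * of_bool (i \<in> G)) \<le> (\<Sum>i<N. B * of_bool (i \<in> G))"
      unfolding sum_distrib_right[symmetric] by (intro sum_mono mult_right_mono row) auto
    also have "\<dots> = B * card ({..<N} \<inter> G)"
      unfolding sum_distrib_left[symmetric] by (simp add: Collect_conj_eq)
    also have "{..<N} \<inter> G = G" using fin by auto
    finally show ?thesis .
  qed
  have swap: "(\<Sum>i<N. \<Sum>j<N. W i j * f j) = (\<Sum>i<N. \<Sum>j<N. W i j * f i)" for f
    by (subst sum.swap) (simp add: sym)
  have "(\<Sum>i<N. \<Sum>j<N. of_bool (T < \<bar>x i\<bar> \<or> T < \<bar>x j\<bar>) * W i j * (\<bar>x i\<bar> * \<bar>x j\<bar>)) \<le>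
     (\<Sum>i<N. \<Sum>j<N. W i j * ((of_bool (i \<in> H \<and> j \<in> H) * min ((x i)\<^sup>2) ((x j)\<^sup>2) +
       (\<eta> * T)\<^sup>2 * (of_bool (i \<in> G) + of_bool (j \<in> G))) / (2 * \<gamma>) + \<gamma> / 2 * ((x i)\<^sup>2 + (x j)\<^sup>2)))"
  proof (intro sum_mono)
    fix i j assume "i \<in> {..<N}" "j \<in> {..<N}"
    then show "of_bool (T < \<bar>x i\<bar> \<or> T < \<bar>x j\<bar>) * W i j * (\<bar>x i\<bar> * \<bar>x j\<bar>) \<le>
      W i j * ((of_bool (i \<in> H \<and> j \<in> H) * min ((x i)\<^sup>2) ((x j)\<^sup>2) +
       (\<eta> * T)\<^sup>2 * (of_bool (i \<in> G) + of_bool (j \<in> G))) / (2 * \<gamma>) + \<gamma> / 2 * ((x i)\<^sup>2 + (x j)\<^sup>2))"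
      using mult_left_mono[OF pointwise[of i j] nonneg[of i j]] by (simp add: mult.assoc mult.left_commute)
  qed
  also have "\<dots> = ((\<Sum>i<N. \<Sum>j<N. of_bool (i \<in> H \<and> j \<in> H) * (W i j * min ((x i)\<^sup>2) ((x j)\<^sup>2))) +
      (\<eta> * T)\<^sup>2 * ((\<Sum>i<N. \<Sum>j<N. W i j * of_bool (i \<in> G)) + (\<Sum>i<N. \<Sum>j<N. W i j * of_bool (j \<in> G)))) / (2 * \<gamma>)
      + \<gamma> / 2 * ((\<Sum>i<N. \<Sum>j<N. W i j * (x i)\<^sup>2) + (\<Sum>i<N. \<Sum>j<N. W i j * (x j)\<^sup>2))"
  proof -
    have "w * ((p * m + e * (g1 + g2)) / (2 * \<gamma>) + \<gamma> / 2 * (a + b)) =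
        (p * (w * m) + e * (w * g1 + w * g2)) / (2 * \<gamma>) + \<gamma> / 2 * (w * a + w * b)"
      for w p m e g1 g2 a b :: real
      using \<gamma> by (simp add: field_simps)
    then show ?thesis
      unfolding sum.distrib[symmetric] sum_distrib_left sum_divide_distrib
      by (intro sum.cong refl) (simp only: sum.distrib)
  qed
  also have "(\<Sum>i<N. \<Sum>j<N. of_bool (i \<in> H \<and> j \<in> H) * (W i j * min ((x i)\<^sup>2) ((x j)\<^sup>2))) =
      (\<Sum>i\<in>H. \<Sum>j\<in>H. W i j * min ((x i)\<^sup>2) ((x j)\<^sup>2))"
  proof -
    have "(\<Sum>i\<in>H. \<Sum>j\<in>H. W i j * min ((x i)\<^sup>2) ((x j)\<^sup>2)) =
      (\<Sum>i<N. \<Sum>j\<in>H. of_bool (i \<in> H \<and> j \<in> H) * (W i j * min ((x i)\<^sup>2) ((x j)\<^sup>2)))"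
      using fin by (intro sum.mono_neutral_cong_left) auto
    also have "\<dots> = (\<Sum>i<N. \<Sum>j<N. of_bool (i \<in> H \<and> j \<in> H) * (W i j * min ((x i)\<^sup>2) ((x j)\<^sup>2)))"
      using fin by (intro sum.cong refl sum.mono_neutral_left) auto
    finally show ?thesis by simp
  qed
  also have "(\<dots> + (\<eta> * T)\<^sup>2 * ((\<Sum>i<N. \<Sum>j<N. W i j * of_bool (i \<in> G)) + (\<Sum>i<N. \<Sum>j<N. W i j * of_bool (j \<in> G)))) / (2 * \<gamma>)
      + \<gamma> / 2 * ((\<Sum>i<N. \<Sum>j<N. W i j * (x i)\<^sup>2) + (\<Sum>i<N. \<Sum>j<N. W i j * (x j)\<^sup>2)) \<le>
      (\<epsilon> + (\<eta> * T)\<^sup>2 * (B * card G + B * card G)) / (2 * \<gamma>) + \<gamma> / 2 * (B + B)"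
    using layer sqG sq \<gamma> unfolding swap[of "\<lambda>j. of_bool (j \<in> G)"] swap[of "\<lambda>j. (x j)\<^sup>2"]
    by (intro add_mono divide_right_mono mult_left_mono) (simp_all del: sum_mult_of_bool_eq)
  also have "(\<eta> * T)\<^sup>2 * (B * card G + B * card G) = 2 * \<eta>\<^sup>2 * B * (card G * T\<^sup>2)"
    by (simp add: power_mult_distrib)
  also have "\<dots> \<le> 2 * \<eta>\<^sup>2 * B" using cardG \<open>0 \<le> B\<close> by (intro mult_left_le) auto
  finally show ?thesis using \<gamma> by (simp add: divide_right_mono)
qed

lemma sum_abs_le_sqrt:
  fixes x :: "nat \<Rightarrow> real"
  assumes "(\<Sum>i<N. (x i)\<^sup>2) \<le> 1"
  shows "(\<Sum>i<N. \<bar>x i\<bar>) \<le> sqrt (real N)"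
proof (cases "N = 0")
  case False
  then have s: "sqrt N > 0" "real N / sqrt N = sqrt N" by (auto simp: real_div_sqrt)
  have "(\<Sum>i<N. \<bar>x i\<bar> * 1) \<le> (\<Sum>i<N. (\<bar>x i\<bar>\<^sup>2 / (1 / sqrt N) + (1 / sqrt N) * 1\<^sup>2) / 2)"
    using s by (intro sum_mono young_real) auto
  also have "\<dots> = (\<Sum>i<N. sqrt N / 2 * (x i)\<^sup>2 + 1 / (2 * sqrt N))"
    by (intro sum.cong refl) (simp add: field_simps)
  also have "\<dots> = sqrt N / 2 * (\<Sum>i<N. (x i)\<^sup>2) + sqrt N / 2"
    unfolding sum.distrib sum_distrib_left[symmetric] using s(2) by simp
  also have "\<dots> \<le> sqrt N / 2 * 1 + sqrt N / 2"
    using s assms by (intro add_mono mult_left_mono) auto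
  finally show ?thesis by simp
qed simp

text \<open>
  The mean matrix is spread out: the entries above \<open>T\<close> sum to at most \<open>1 / T\<close>, all entries to at
  most \<open>sqrt N\<close>.
\<close>

lemma heavy_pairs_mean_le:
  fixes V :: "nat \<Rightarrow> nat \<Rightarrow> real"
  assumes V: "\<And>i j. i < N \<Longrightarrow> j < N \<Longrightarrow> V i j \<le> B / real N"
    and x: "(\<Sum>i<N. (x i)\<^sup>2) \<le> 1" and T: "T > 0" and "0 \<le> B"
  shows "(\<Sum>i<N. \<Sum>j<N. of_bool (T < \<bar>x i\<bar> \<or> T < \<bar>x j\<bar>) * V i j * (\<bar>x i\<bar> * \<bar>x j\<bar>))
     \<le> 2 * B / (T * sqrt N)"
proof -
  let ?h = "\<lambda>i. of_bool (T < \<bar>x i\<bar>) * \<bar>x i\<bar>"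
  have pt: "of_bool (T < \<bar>x i\<bar> \<or> T < \<bar>x j\<bar>) * V i j * (\<bar>x i\<bar> * \<bar>x j\<bar>) \<le> B / N * (?h i * \<bar>x j\<bar> + \<bar>x i\<bar> * ?h j)"
    if "i < N" "j < N" for i j
  proof -
    have "of_bool (T < \<bar>x i\<bar> \<or> T < \<bar>x j\<bar>) * V i j * (\<bar>x i\<bar> * \<bar>x j\<bar>) \<le>
      of_bool (T < \<bar>x i\<bar> \<or> T < \<bar>x j\<bar>) * (B / N) * (\<bar>x i\<bar> * \<bar>x j\<bar>)"
      using V[OF that] by (intro mult_right_mono mult_left_mono) auto
    also have "\<dots> = B / N * (of_bool (T < \<bar>x i\<bar> \<or> T < \<bar>x j\<bar>) * (\<bar>x i\<bar> * \<bar>x j\<bar>))" by simp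
    also have "\<dots> \<le> B / N * (?h i * \<bar>x j\<bar> + \<bar>x i\<bar> * ?h j)"
      using \<open>0 \<le> B\<close> by (intro mult_left_mono) auto
    finally show ?thesis .
  qed
  have "(\<Sum>i<N. \<Sum>j<N. of_bool (T < \<bar>x i\<bar> \<or> T < \<bar>x j\<bar>) * V i j * (\<bar>x i\<bar> * \<bar>x j\<bar>)) \<le>
      (\<Sum>i<N. \<Sum>j<N. B / N * (?h i * \<bar>x j\<bar> + \<bar>x i\<bar> * ?h j))"
    by (intro sum_mono pt) auto
  also have "\<dots> = 2 * (B / N) * ((\<Sum>i<N. ?h i) * (\<Sum>j<N. \<bar>x j\<bar>))"
  proof -
    have "(\<Sum>i<N. \<Sum>j<N. B / N * (?h i * \<bar>x j\<bar> + \<bar>x i\<bar> * ?h j)) =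
      B / N * ((\<Sum>i<N. \<Sum>j<N. ?h i * \<bar>x j\<bar>) + (\<Sum>i<N. \<Sum>j<N. \<bar>x i\<bar> * ?h j))"
      by (simp only: sum_distrib_left sum.distrib distrib_left)
    also have "\<dots> = 2 * (B / N) * ((\<Sum>i<N. ?h i) * (\<Sum>j<N. \<bar>x j\<bar>))"
      unfolding sum_product[symmetric] by (simp only: mult.commute[of "\<Sum>j<N. \<bar>x j\<bar>"]) simp
    finally show ?thesis .
  qed
  also have "\<dots> \<le> 2 * (B / N) * ((1 / T) * sqrt N)"
  proof (intro mult_left_mono mult_mono)
    have "(\<Sum>i<N. ?h i) \<le> (\<Sum>i<N. (x i)\<^sup>2 / T)"
    proof (intro sum_mono)
      fix i
      show "?h i \<le> (x i)\<^sup>2 / T"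
      proof (cases "T < \<bar>x i\<bar>")
        case True
        then have "\<bar>x i\<bar> * T \<le> \<bar>x i\<bar> * \<bar>x i\<bar>" by (intro mult_left_mono) auto
        then show ?thesis using True T by (simp add: field_simps power2_eq_square)
      qed (use T in simp)
    qed
    also have "\<dots> \<le> 1 / T" using x T by (simp add: sum_divide_distrib[symmetric] divide_right_mono)
    finally show "(\<Sum>i<N. ?h i) \<le> 1 / T" .
    show "(\<Sum>j<N. \<bar>x j\<bar>) \<le> sqrt N" by (rule sum_abs_le_sqrt[OF x])
  qed (use T \<open>0 \<le> B\<close> in \<open>auto intro: sum_nonneg\<close>)
  also have "\<dots> = 2 * B / (T * sqrt N)"
  proof (cases "N = 0")
    case False
    have "2 * (B / (r * r)) * (1 / T * r) = 2 * B / (T * r)" if "r > 0" for r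
      using that by (simp add: field_simps)
    from this[of "sqrt N"] show ?thesis using False by simp
  qed simp
  finally show ?thesis .
qed

text \<open>
  The threshold is \<open>T = Q h / sqrt N\<close>, the largest value on the grid. The error terms are, in this order,
  the grid value \<open>b\<close>, the rounding, the heavy pairs of \<open>W\<close> (two terms) and the heavy pairs of \<open>V\<close>. For
  a given \<open>B\<close>, the last four are made small by choosing first \<open>h\<close> and \<open>\<gamma>\<close>, then \<open>\<epsilon>\<close> and
  \<open>\<eta>\<close>, and finally a large \<open>Q\<close>.
\<close>

lemma quadratic_form_le_of_sparse:
  fixes W V :: "nat \<Rightarrow> nat \<Rightarrow> real"
  assumes N: "N \<ge> 1" and nonneg: "\<And>i j. 0 \<le> W i j" "\<And>i j. 0 \<le> V i j"
    and sym: "\<And>i j. W i j = W j i" "\<And>i j. V i j = V j i"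
    and row: "\<And>i. i < N \<Longrightarrow> (\<Sum>j<N. W i j) \<le> B"
    and V: "\<And>i j. i < N \<Longrightarrow> j < N \<Longrightarrow> V i j \<le> B / real N"
    and pos: "\<eta> > 0" "\<gamma> > 0" "0 \<le> B" "0 \<le> \<epsilon>" "h > 0" "Q > 0"
    and sparse: "\<And>S. S \<subseteq> {..<N} \<Longrightarrow> real (card S) * (\<eta> * Q * h)\<^sup>2 \<le> real N \<Longrightarrow>
      (\<Sum>i\<in>S. \<Sum>j\<in>S. W i j) \<le> \<epsilon> * real (card S)"
    and s: "s \<in> {-1, 1}"
    and grid: "\<And>k :: nat \<Rightarrow> int. k \<in> PiE {..<N} (\<lambda>_. {- int Q..int Q}) \<Longrightarrow>
        (\<Sum>i<N. \<Sum>j<N. s * (W i j - V i j) * ((h / sqrt N * k i) * (h / sqrt N * k j))) \<le> b"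
    and x: "(\<Sum>i<N. (x i)\<^sup>2) \<le> 1"
  shows "(\<Sum>i<N. \<Sum>j<N. s * (W i j - V i j) * (x i * x j)) \<le>
      b + 4 * B * h + (\<epsilon> + 2 * \<eta>\<^sup>2 * B) / (2 * \<gamma>) + \<gamma> * B + 2 * B / (Q * h)"
proof -
  define T where "T = Q * h / sqrt N"
  define z where "z i = of_bool (\<bar>x i\<bar> \<le> T) * x i" for i
  define R where "R i j = s * (W i j - V i j)" for i j
  let ?hv = "\<lambda>i j. of_bool (T < \<bar>x i\<bar> \<or> T < \<bar>x j\<bar>) :: real"
  have T: "T > 0" using pos N by (simp add: T_def)
  have Rabs: "\<bar>R i j\<bar> \<le> W i j + V i j" for i j
    using s nonneg[of i j] by (auto simp: R_def)
  have Vrow: "(\<Sum>j<N. V i j) \<le> B" if "i < N" for i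
  proof -
    have "(\<Sum>j<N. V i j) \<le> (\<Sum>j<N. B / real N)" using that by (intro sum_mono V) auto
    then show ?thesis using N by simp
  qed
  have Rrow: "(\<Sum>j<N. \<bar>R i j\<bar>) \<le> 2 * B" if "i < N" for i
  proof -
    have "(\<Sum>j<N. \<bar>R i j\<bar>) \<le> (\<Sum>j<N. W i j + V i j)" by (intro sum_mono Rabs)
    then show ?thesis using row[OF that] Vrow[OF that] by (simp add: sum.distrib)
  qed
  have Rsym: "R i j = R j i" for i j using sym by (simp add: R_def)
  have flat: "(\<Sum>i<N. \<Sum>j<N. R i j * (z i * z j)) \<le> b + 2 * (2 * B) * h"
  proof (rule quadratic_form_le_of_grid[where Q = Q and N = N])
    show "(\<Sum>i<N. \<bar>R i j\<bar>) \<le> 2 * B" if "j < N" for j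
      using Rrow[OF that] by (subst Rsym)
    have "(\<Sum>i<N. (z i)\<^sup>2) \<le> (\<Sum>i<N. (x i)\<^sup>2)" by (intro sum_mono) (auto simp: z_def)
    then show "(\<Sum>i<N. (z i)\<^sup>2) \<le> 1" using x by simp
    show "\<bar>z i\<bar> \<le> Q * h / sqrt N" if "i < N" for i
      using T by (auto simp: z_def T_def)
  qed (use N pos Rrow grid in \<open>auto simp: R_def\<close>)
  have pt: "R i j * (x i * x j) \<le> R i j * (z i * z j) + (?hv i j * W i j * (\<bar>x i\<bar> * \<bar>x j\<bar>) + ?hv i j * V i j * (\<bar>x i\<bar> * \<bar>x j\<bar>))" for i j
  proof (cases "T < \<bar>x i\<bar> \<or> T < \<bar>x j\<bar>")
    case True
    have "R i j * (x i * x j) \<le> \<bar>R i j * (x i * x j)\<bar>" by simp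
    also have "\<dots> = \<bar>R i j\<bar> * (\<bar>x i\<bar> * \<bar>x j\<bar>)" by (simp add: abs_mult)
    also have "\<dots> \<le> (W i j + V i j) * (\<bar>x i\<bar> * \<bar>x j\<bar>)" by (intro mult_right_mono Rabs) auto
    finally have "R i j * (x i * x j) \<le> W i j * (\<bar>x i\<bar> * \<bar>x j\<bar>) + V i j * (\<bar>x i\<bar> * \<bar>x j\<bar>)"
      by (simp add: algebra_simps)
    moreover have "R i j * (z i * z j) = 0" "?hv i j = 1" using True by (auto simp: z_def)
    ultimately show ?thesis by (simp only: mult_1 add_0)
  qed (auto simp: z_def)
  have "(\<Sum>i<N. \<Sum>j<N. R i j * (x i * x j)) \<le> (\<Sum>i<N. \<Sum>j<N. R i j * (z i * z j) +
      (?hv i j * W i j * (\<bar>x i\<bar> * \<bar>x j\<bar>) + ?hv i j * V i j * (\<bar>x i\<bar> * \<bar>x j\<bar>)))"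
    by (intro sum_mono pt)
  also have "\<dots> = (\<Sum>i<N. \<Sum>j<N. R i j * (z i * z j)) + ((\<Sum>i<N. \<Sum>j<N. ?hv i j * W i j * (\<bar>x i\<bar> * \<bar>x j\<bar>))
      + (\<Sum>i<N. \<Sum>j<N. ?hv i j * V i j * (\<bar>x i\<bar> * \<bar>x j\<bar>)))"
    by (simp only: sum.distrib)
  also have "\<dots> \<le> (b + 2 * (2 * B) * h) + (((\<epsilon> + 2 * \<eta>\<^sup>2 * B) / (2 * \<gamma>) + \<gamma> * B) + 2 * B / (T * sqrt N))"
  proof (intro add_mono flat)
    show "(\<Sum>i<N. \<Sum>j<N. ?hv i j * V i j * (\<bar>x i\<bar> * \<bar>x j\<bar>)) \<le> 2 * B / (T * sqrt N)"
      by (rule heavy_pairs_mean_le[OF V x T pos(3)])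
    show "(\<Sum>i<N. \<Sum>j<N. ?hv i j * W i j * (\<bar>x i\<bar> * \<bar>x j\<bar>)) \<le> (\<epsilon> + 2 * \<eta>\<^sup>2 * B) / (2 * \<gamma>) + \<gamma> * B"
    proof (rule heavy_pairs_weight_le[OF nonneg(1) sym(1) row x T pos(1,2,3,4)])
      fix S assume S: "S \<subseteq> {..<N}" "real (card S) * (\<eta> * T)\<^sup>2 \<le> 1"
      have "real (card S) * (\<eta> * Q * h)\<^sup>2 = real (card S) * (\<eta> * T)\<^sup>2 * N"
        using N by (simp add: T_def power_mult_distrib power_divide)
      also have "\<dots> \<le> 1 * real N" using S(2) by (intro mult_right_mono) auto
      finally show "(\<Sum>i\<in>S. \<Sum>j\<in>S. W i j) \<le> \<epsilon> * real (card S)" using S(1) by (intro sparse) auto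
    qed
  qed
  also have "T * sqrt N = Q * h" using N by (simp add: T_def)
  finally show ?thesis by (simp add: R_def algebra_simps)
qed

section \<open>Tail bounds for independent Bernoulli variables\<close>

text \<open>
  The exponential Markov inequality. The Laplace parameter is absorbed into \<open>f\<close> and \<open>t\<close>, so that the one
  inequality serves upper tails, lower tails and quadratic forms.
\<close>

lemma prob_linear_form_ge_le:
  fixes f p :: "'e \<Rightarrow> real"
  assumes "finite E" and p: "\<And>e. e \<in> E \<Longrightarrow> 0 \<le> p e \<and> p e \<le> 1"
  shows "measure_pmf.prob (Pi_pmf E False (\<lambda>e. bernoulli_pmf (p e)))
      {A. t \<le> (\<Sum>e\<in>E. of_bool (A e) * f e)} \<le> exp (- t + (\<Sum>e\<in>E. p e * (exp (f e) - 1)))"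
proof -
  let ?P = "Pi_pmf E False (\<lambda>e. bernoulli_pmf (p e))"
  let ?u = "\<lambda>A. \<Prod>e\<in>E. exp (of_bool (A e) * f e)"
  have fin: "finite (set_pmf (bernoulli_pmf q))" for q
    by (rule finite_subset[of _ UNIV]) auto
  have int: "integrable (measure_pmf ?P) ?u"
    by (rule integrable_prod_Pi_pmf) (auto intro!: integrable_measure_pmf_finite fin assms)
  have "measure_pmf.prob ?P {A. t \<le> (\<Sum>e\<in>E. of_bool (A e) * f e)} = measure_pmf.prob ?P {A. exp t \<le> ?u A}"
    by (simp add: assms(1) flip: exp_sum)
  also have "\<dots> \<le> measure_pmf.expectation ?P ?u / exp t"
  proof -
    have "AE A in measure_pmf ?P. 0 \<le> ?u A" by (intro AE_I2 prod_nonneg) auto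
    from integral_Markov_inequality_measure[OF int _ this, of UNIV "exp t"] show ?thesis by simp
  qed
  also have "measure_pmf.expectation ?P ?u = (\<Prod>e\<in>E. measure_pmf.expectation (bernoulli_pmf (p e)) (\<lambda>a. exp (of_bool a * f e)))"
    by (rule expectation_prod_Pi_pmf) (auto intro!: integrable_measure_pmf_finite fin assms)
  also have "\<dots> = (\<Prod>e\<in>E. 1 + p e * (exp (f e) - 1))"
    using p by (intro prod.cong refl) (simp add: algebra_simps)
  also have "\<dots> \<le> (\<Prod>e\<in>E. exp (p e * (exp (f e) - 1)))"
  proof (intro prod_mono conjI)
    fix e assume e: "e \<in> E"
    have "1 + p e * (exp (f e) - 1) = (1 - p e) + p e * exp (f e)" by (simp add: algebra_simps)
    moreover have "0 \<le> p e * exp (f e)" using p[OF e] by simp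
    ultimately show "0 \<le> 1 + p e * (exp (f e) - 1)" using p[OF e] by linarith
    show "1 + p e * (exp (f e) - 1) \<le> exp (p e * (exp (f e) - 1))" by (rule exp_ge_add_one_self)
  qed
  also have "\<dots> = exp (\<Sum>e\<in>E. p e * (exp (f e) - 1))" by (simp add: assms(1) exp_sum)
  finally have "measure_pmf.prob ?P {A. t \<le> (\<Sum>e\<in>E. of_bool (A e) * f e)} \<le>
      exp (\<Sum>e\<in>E. p e * (exp (f e) - 1)) / exp t"
    by (simp add: divide_right_mono)
  also have "\<dots> = exp (- t + (\<Sum>e\<in>E. p e * (exp (f e) - 1)))"
    by (simp only: exp_diff[symmetric]) simp
  finally show ?thesis .
qed

lemma exp_le_quadratic:
  fixes x :: real
  assumes "\<bar>x\<bar> \<le> 1"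
  shows "exp x \<le> 1 + x + x\<^sup>2"
proof (cases "x \<ge> 0")
  case True
  then show ?thesis using assms by (intro exp_bound) auto
next
  case False
  define y where "y = - x"
  have y: "0 < y" "y \<le> 1" using False assms by (auto simp: y_def)
  have "1 + y + y\<^sup>2 / 2 \<le> exp y" using exp_lower_Taylor_quadratic[of y] y by simp
  then have "exp (- y) \<le> 1 / (1 + y + y\<^sup>2 / 2)"
    using y by (simp add: exp_minus inverse_eq_divide field_simps add_pos_pos)
  also have "\<dots> \<le> 1 - y + y\<^sup>2"
  proof -
    have "0 \<le> y\<^sup>2 / 2 + y ^ 3 / 2 + y ^ 4 / 2" using y by simp
    also have "\<dots> = (1 - y + y\<^sup>2) * (1 + y + y\<^sup>2 / 2) - 1" 
      by (simp add: field_simps power2_eq_square power3_eq_cube power4_eq_xxxx)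
    finally show ?thesis using y by (simp add: divide_le_eq add_pos_pos)
  qed
  finally show ?thesis by (simp add: y_def)
qed

lemma prob_Collect_mono:
  fixes P :: "'x pmf"
  assumes "\<And>A. B A \<Longrightarrow> C A"
  shows "measure_pmf.prob P {A. B A} \<le> measure_pmf.prob P {A. C A}"
  using assms by (intro measure_pmf.finite_measure_mono) auto

lemma prob_Bex_le:
  fixes P :: "'x pmf"
  assumes "finite S" "\<And>i. i \<in> S \<Longrightarrow> measure_pmf.prob P {A. B i A} \<le> b i"
  shows "measure_pmf.prob P {A. \<exists>i\<in>S. B i A} \<le> (\<Sum>i\<in>S. b i)"
proof -
  have "{A. \<exists>i\<in>S. B i A} = (\<Union>i\<in>S. {A. B i A})" by auto
  then have "measure_pmf.prob P {A. \<exists>i\<in>S. B i A} \<le> (\<Sum>i\<in>S. measure_pmf.prob P {A. B i A})"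
    using assms(1) measure_pmf.finite_measure_subadditive_finite[of S "\<lambda>i. {A. B i A}" P] by simp
  also have "\<dots> \<le> (\<Sum>i\<in>S. b i)" by (intro sum_mono assms)
  finally show ?thesis .
qed

lemma prob_disj_le:
  fixes P :: "'x pmf"
  assumes "measure_pmf.prob P {A. B A} \<le> b" "measure_pmf.prob P {A. C A} \<le> c"
  shows "measure_pmf.prob P {A. B A \<or> C A} \<le> b + c"
proof -
  have "{A. B A \<or> C A} = {A. B A} \<union> {A. C A}" by auto
  then show ?thesis using measure_Un_le[of "{A. B A}" "measure_pmf P" "{A. C A}"] assms by simp
qed

section \<open>Random hypergraphs of logarithmic degree\<close>

text \<open>
  Independent hyperedges \<open>e\<close> with vertex sets \<open>v e\<close> of bounded size, whose expected degrees are
  \<open>O(ln N)\<close> and whose expected codegrees are \<open>O(ln N / N)\<close>. The degree condition bounds the row sums and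
  the total number of hyperedges, the codegree condition the entries of the mean and hence the weight of
  small vertex sets. \<open>W\<close> counts the hyperedges through a pair of vertices, and \<open>V\<close> is its mean.
\<close>

locale random_hypergraph =
  fixes N :: nat and E :: "'e set" and v :: "'e \<Rightarrow> nat set" and p :: "'e \<Rightarrow> real" and D :: nat and C :: real
  assumes N: "N \<ge> 1" and finite_E: "finite E"
    and p01: "\<And>e. e \<in> E \<Longrightarrow> 0 \<le> p e \<and> p e \<le> 1"
    and v_sub: "\<And>e. e \<in> E \<Longrightarrow> v e \<subseteq> {..<N}" and v_card: "\<And>e. e \<in> E \<Longrightarrow> card (v e) \<le> D"
    and C: "C \<ge> 0"
    and deg: "\<And>i. i < N \<Longrightarrow> (\<Sum>e\<in>{e\<in>E. i \<in> v e}. p e) \<le> C * ln N"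
    and codeg: "\<And>i j. i < N \<Longrightarrow> j < N \<Longrightarrow> i \<noteq> j \<Longrightarrow> (\<Sum>e\<in>{e\<in>E. i \<in> v e \<and> j \<in> v e}. p e) \<le> C * ln N / N"
begin

definition G where "G = Pi_pmf E False (\<lambda>e. bernoulli_pmf (p e))"

definition pair where "pair e i j = (of_bool (i \<noteq> j \<and> i \<in> v e \<and> j \<in> v e) :: real)"

definition W where "W A i j = (\<Sum>e\<in>E. of_bool (A e) * pair e i j)"

definition V where "V i j = (\<Sum>e\<in>E. p e * pair e i j)"

lemma lnN: "0 \<le> ln (real N)" using N by simp

lemma finite_v: "e \<in> E \<Longrightarrow> finite (v e)" using v_sub finite_subset by blast

lemma sum_lessThan_v: "e \<in> E \<Longrightarrow> (\<Sum>j<N. of_bool (j \<in> v e) * g j) = (\<Sum>j\<in>v e. g j :: real)"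
  using v_sub by (intro sum.mono_neutral_cong_right) auto

lemma W_sym: "W A i j = W A j i" and V_sym: "V i j = V j i"
  by (auto simp: W_def V_def pair_def conj_commute intro!: sum.cong)

lemma W_nonneg: "0 \<le> W A i j" and V_nonneg: "0 \<le> V i j"
  using p01 by (auto simp: W_def V_def pair_def intro!: sum_nonneg)

lemma V_le: "i < N \<Longrightarrow> j < N \<Longrightarrow> V i j \<le> C * ln N / N"
proof (cases "i = j")
  case True
  then show ?thesis using C lnN by (simp add: V_def pair_def)
next
  case False
  assume "i < N" "j < N"
  have "V i j = (\<Sum>e\<in>{e\<in>E. i \<in> v e \<and> j \<in> v e}. p e)"
    unfolding V_def using finite_E False by (intro sum.mono_neutral_cong_right) (auto simp: pair_def)
  then show ?thesis using codeg[of i j] False \<open>i < N\<close> \<open>j < N\<close> by simp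
qed

lemma pair_row: "e \<in> E \<Longrightarrow> (\<Sum>j<N. pair e i j) \<le> real D * of_bool (i \<in> v e)"
proof -
  assume e: "e \<in> E"
  have "(\<Sum>j<N. pair e i j) \<le> (\<Sum>j<N. of_bool (i \<in> v e) * (of_bool (j \<in> v e) * 1))"
    by (intro sum_mono) (auto simp: pair_def)
  also have "\<dots> = of_bool (i \<in> v e) * card (v e)"
    unfolding sum_distrib_left[symmetric] sum_lessThan_v[OF e] by simp
  finally show "(\<Sum>j<N. pair e i j) \<le> real D * of_bool (i \<in> v e)" using v_card[OF e] by auto
qed

lemma prob_degree:
  "measure_pmf.prob G {A. \<exists>i\<in>{..<N}. D * (2 + 2 * C) * ln N < (\<Sum>j<N. W A i j)} \<le> 1 / N"
proof -
  have "measure_pmf.prob G {A. D * (2 + 2 * C) * ln N < (\<Sum>j<N. W A i j)} \<le> 1 / (real N)\<^sup>2" if i: "i < N" for i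
  proof -
    let ?f = "\<lambda>e. of_bool (i \<in> v e) :: real"
    have row: "(\<Sum>j<N. W A i j) \<le> D * (\<Sum>e\<in>E. of_bool (A e) * ?f e)" for A
    proof -
      have "(\<Sum>j<N. W A i j) = (\<Sum>e\<in>E. of_bool (A e) * (\<Sum>j<N. pair e i j))"
        unfolding W_def by (subst sum.swap) (simp add: sum_distrib_left)
      also have "\<dots> \<le> (\<Sum>e\<in>E. of_bool (A e) * (D * ?f e))"
        by (intro sum_mono mult_left_mono pair_row) auto
      finally show ?thesis by (simp add: sum_distrib_left mult.left_commute)
    qed
    have "measure_pmf.prob G {A. D * (2 + 2 * C) * ln N < (\<Sum>j<N. W A i j)} \<le>
        measure_pmf.prob G {A. (2 + 2 * C) * ln N \<le> (\<Sum>e\<in>E. of_bool (A e) * ?f e)}"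
    proof (rule prob_Collect_mono)
      fix A assume "D * (2 + 2 * C) * ln N < (\<Sum>j<N. W A i j)"
      then have "real D * ((2 + 2 * C) * ln N) < D * (\<Sum>e\<in>E. of_bool (A e) * ?f e)"
        using row[of A] by (simp only: mult.assoc)
      then show "(2 + 2 * C) * ln N \<le> (\<Sum>e\<in>E. of_bool (A e) * ?f e)"
        by (meson less_imp_le mult_left_less_imp_less of_nat_0_le_iff)
    qed
    also have "\<dots> \<le> exp (- ((2 + 2 * C) * ln N) + (\<Sum>e\<in>E. p e * (exp (?f e) - 1)))"
      unfolding G_def by (rule prob_linear_form_ge_le[OF finite_E p01])
    also have "\<dots> \<le> exp (- (2 * ln N))"
    proof -
      have "(\<Sum>e\<in>E. p e * (exp (?f e) - 1)) = (exp 1 - 1) * (\<Sum>e\<in>{e\<in>E. i \<in> v e}. p e)"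
        unfolding sum_distrib_left using finite_E by (intro sum.mono_neutral_cong_right) auto
      also have "\<dots> \<le> 2 * (C * ln N)"
        using exp_le deg[OF i] C lnN p01 by (intro mult_mono) (auto intro!: sum_nonneg)
      finally show ?thesis by (simp add: algebra_simps)
    qed
    also have "\<dots> = 1 / (real N)\<^sup>2"
      using N by (simp add: exp_minus exp_double power_one_over inverse_eq_divide)
    finally show ?thesis .
  qed
  then have "measure_pmf.prob G {A. \<exists>i\<in>{..<N}. D * (2 + 2 * C) * ln N < (\<Sum>j<N. W A i j)} \<le> (\<Sum>i<N. 1 / (real N)\<^sup>2)"
    by (intro prob_Bex_le) auto
  also have "\<dots> = 1 / N" using N by (simp add: power2_eq_square)
  finally show ?thesis .
qed

lemma sum_pair_le: "e \<in> E \<Longrightarrow> S \<subseteq> {..<N} \<Longrightarrow> (\<Sum>i\<in>S. \<Sum>j\<in>S. pair e i j) \<le> D\<^sup>2"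
proof -
  assume e: "e \<in> E" and S: "S \<subseteq> {..<N}"
  have "(\<Sum>i\<in>S. \<Sum>j\<in>S. pair e i j) \<le> (\<Sum>i\<in>S. \<Sum>j<N. pair e i j)"
    using S by (intro sum_mono sum_mono2) (auto simp: pair_def)
  also have "\<dots> \<le> (\<Sum>i<N. \<Sum>j<N. pair e i j)"
    using S by (intro sum_mono2 sum_nonneg) (auto simp: pair_def)
  also have "\<dots> \<le> (\<Sum>i<N. of_bool (i \<in> v e) * real D)"
    by (intro sum_mono) (use pair_row[OF e] in \<open>auto simp: mult.commute\<close>)
  also have "\<dots> = real (card (v e)) * D"
    unfolding sum_lessThan_v[OF e] by simp
  also have "\<dots> \<le> real D * D" using v_card[OF e] by (intro mult_right_mono) auto
  finally show ?thesis by (simp add: power2_eq_square)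
qed

text \<open>
  Inside a fixed set of \<open>h \<le> \<delta> N\<close> vertices the expected weight is at most \<open>C \<delta> h ln N\<close>, and for small
  \<open>\<delta>\<close> a weight of \<open>\<epsilon> h ln N\<close> has probability at most \<open>N\<close> to the power \<open>- 2 h\<close>. The sum over all
  nonempty sets is \<open>(1 + 1 / N\<^sup>2)\<close> to the power \<open>N\<close>, minus 1.
\<close>

lemma prob_dense_subset:
  fixes \<epsilon> \<delta> :: real
  assumes \<epsilon>: "\<epsilon> > 0" and \<delta>: "\<delta> \<ge> 0" "exp (4 * D\<^sup>2 / \<epsilon>) * C * \<delta> \<le> 1"
  shows "measure_pmf.prob G {A. \<exists>S\<in>{S. S \<subseteq> {..<N} \<and> real (card S) \<le> \<delta> * N}.
      \<epsilon> * ln N * card S < (\<Sum>i\<in>S. \<Sum>j\<in>S. W A i j)} \<le> exp (1 / real N) - 1"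
proof -
  let ?F = "{S. S \<subseteq> {..<N} \<and> real (card S) \<le> \<delta> * N}"
  let ?bad = "\<lambda>S A. \<epsilon> * ln N * card S < (\<Sum>i\<in>S. \<Sum>j\<in>S. W A i j)"
  have single: "measure_pmf.prob G {A. ?bad S A} \<le> (1 / (real N)\<^sup>2) ^ card S" if S: "S \<in> ?F" "S \<noteq> {}" for S
  proof -
    define w where "w e = (\<Sum>i\<in>S. \<Sum>j\<in>S. pair e i j)" for e
    \<comment> \<open>The tilt turns the deviation into \<open>exp (- 4 h ln N)\<close>; the compensator costs at most one of the four,
      and two are kept.\<close>
    define \<theta> where "\<theta> = 4 / \<epsilon>"
    have \<theta>: "\<theta> > 0" "\<theta> * \<epsilon> = 4" using \<epsilon> by (auto simp: \<theta>_def)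
    have finS: "finite S" using S by (auto intro: finite_subset)
    have w0: "0 \<le> w e" for e by (auto simp: w_def pair_def intro!: sum_nonneg)
    have wD: "w e \<le> D\<^sup>2" if "e \<in> E" for e
      unfolding w_def using that S by (intro sum_pair_le) auto
    \<comment> \<open>The weight of a hyperedge inside \<open>S\<close> is an integer, so it is at least 1 unless it vanishes.\<close>
    have w1: "exp (\<theta> * w e) - 1 \<le> exp (4 * D\<^sup>2 / \<epsilon>) * w e" if "e \<in> E" for e
    proof (cases "w e = 0")
      case False
      have "w e = real (card {(i, j). (i, j) \<in> S \<times> S \<and> i \<noteq> j \<and> i \<in> v e \<and> j \<in> v e})"
        unfolding w_def sum.cartesian_product pair_def using finS
        by (simp add: case_prod_unfold Int_def) (rule arg_cong[where f = card], auto)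
      then have "\<exists>n::nat. w e = real n" by blast
      then have "w e \<ge> 1" using False by (auto simp: Suc_le_eq)
      have "exp (\<theta> * w e) \<le> exp (4 * D\<^sup>2 / \<epsilon>)" 
        using wD[OF that] \<epsilon> by (simp add: \<theta>_def field_simps)
      also have "\<dots> * 1 \<le> exp (4 * D\<^sup>2 / \<epsilon>) * w e" using \<open>w e \<ge> 1\<close> by (intro mult_left_mono) auto
      finally show ?thesis by simp
    qed simp
    have W_eq: "(\<Sum>i\<in>S. \<Sum>j\<in>S. W A i j) = (\<Sum>e\<in>E. of_bool (A e) * w e)" for A
      unfolding W_def w_def
      by (subst sum.swap[of _ E], subst sum.swap[of _ E]) (simp add: sum_distrib_left)
    have V_eq: "(\<Sum>i\<in>S. \<Sum>j\<in>S. V i j) = (\<Sum>e\<in>E. p e * w e)"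
      unfolding V_def w_def
      by (subst sum.swap[of _ E], subst sum.swap[of _ E]) (simp add: sum_distrib_left)
    have "measure_pmf.prob G {A. ?bad S A} \<le>
        measure_pmf.prob G {A. 4 * ln N * card S \<le> (\<Sum>e\<in>E. of_bool (A e) * (\<theta> * w e))}"
    proof (rule prob_Collect_mono)
      fix A assume "?bad S A"
      then have "\<theta> * (\<epsilon> * ln N * card S) \<le> \<theta> * (\<Sum>e\<in>E. of_bool (A e) * w e)"
        using \<theta> unfolding W_eq by (intro mult_left_mono) auto
      also have "\<theta> * (\<epsilon> * ln N * card S) = 4 * ln N * card S"
        using \<theta> by (simp flip: mult.assoc)
      finally show "4 * ln N * card S \<le> (\<Sum>e\<in>E. of_bool (A e) * (\<theta> * w e))"
        by (simp only: sum_distrib_left mult.left_commute)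
    qed
    also have "\<dots> \<le> exp (- (4 * ln N * card S) + (\<Sum>e\<in>E. p e * (exp (\<theta> * w e) - 1)))"
      unfolding G_def by (rule prob_linear_form_ge_le[OF finite_E p01])
    also have "\<dots> \<le> exp (- (2 * ln N * card S))"
    proof -
      have "(\<Sum>e\<in>E. p e * (exp (\<theta> * w e) - 1)) \<le> (\<Sum>e\<in>E. p e * (exp (4 * D\<^sup>2 / \<epsilon>) * w e))"
        using p01 by (intro sum_mono mult_left_mono w1) auto
      also have "\<dots> = exp (4 * D\<^sup>2 / \<epsilon>) * (\<Sum>i\<in>S. \<Sum>j\<in>S. V i j)"
        unfolding V_eq by (simp add: sum_distrib_left mult.left_commute)
      also have "\<dots> \<le> exp (4 * D\<^sup>2 / \<epsilon>) * (\<Sum>i\<in>S. \<Sum>j\<in>S. C * ln N / N)"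
        using S by (intro mult_left_mono sum_mono V_le) auto
      also have "\<dots> = exp (4 * D\<^sup>2 / \<epsilon>) * C * (card S / N) * (ln N * card S)" by simp
      also have "\<dots> \<le> exp (4 * D\<^sup>2 / \<epsilon>) * C * \<delta> * (ln N * card S)"
        using S C lnN N by (intro mult_right_mono mult_left_mono) (auto simp: field_simps)
      also have "\<dots> \<le> 1 * (ln N * card S)"
        using \<delta> lnN by (intro mult_right_mono) auto
      also have "\<dots> \<le> 2 * ln N * card S" using lnN by simp
      finally show ?thesis by (simp add: mult_ac)
    qed
    also have "\<dots> = (1 / (real N)\<^sup>2) ^ card S"
    proof -
      have "exp (- (2 * ln N * card S)) = exp (real (card S) * (- (2 * ln N)))" by (simp add: mult.commute)
      also have "\<dots> = exp (- (2 * ln N)) ^ card S" by (rule exp_of_nat_mult)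
      also have "exp (- (2 * ln N)) = 1 / (real N)\<^sup>2"
        using N by (simp add: exp_minus exp_double power_one_over inverse_eq_divide)
      finally show ?thesis .
    qed
    finally show ?thesis .
  qed
  have "measure_pmf.prob G {A. \<exists>S\<in>?F. ?bad S A} \<le> measure_pmf.prob G {A. \<exists>S\<in>?F - {{}}. ?bad S A}"
    by (intro measure_pmf.finite_measure_mono subsetI) auto
  also have "\<dots> \<le> (\<Sum>S\<in>?F - {{}}. (1 / (real N)\<^sup>2) ^ card S)"
    using single by (intro prob_Bex_le) auto
  also have "\<dots> \<le> (\<Sum>S\<in>Pow {..<N} - {{}}. (1 / (real N)\<^sup>2) ^ card S)"
    by (intro sum_mono2) auto
  also have "\<dots> = (\<Sum>S\<in>Pow {..<N}. (1 / (real N)\<^sup>2) ^ card S) - 1"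
    by (subst sum_diff1) auto
  also have "(\<Sum>S\<in>Pow {..<N}. (1 / (real N)\<^sup>2) ^ card S) = (\<Prod>i<N. 1 / (real N)\<^sup>2 + 1)"
    by (subst prod_add) auto
  also have "\<dots> \<le> (\<Prod>i<N. exp (1 / (real N)\<^sup>2))"
    by (intro prod_mono) (auto simp: add.commute intro: exp_ge_add_one_self)
  also have "\<dots> = exp (1 / real N)"
    using N by (simp add: exp_of_nat_mult[symmetric] power2_eq_square)
  finally show ?thesis by simp
qed

text \<open>
  Hyperedges without vertices are excluded, since the degree condition says nothing about them.
\<close>

lemma total_mass: "(\<Sum>e\<in>E. p e * of_bool (v e \<noteq> {})) \<le> N * (C * ln N)"
proof -
  have "(\<Sum>e\<in>E. p e * of_bool (v e \<noteq> {})) \<le> (\<Sum>e\<in>E. p e * (\<Sum>i<N. of_bool (i \<in> v e) * 1))"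
  proof (intro sum_mono mult_left_mono)
    fix e assume e: "e \<in> E"
    have "of_bool (v e \<noteq> {}) \<le> real (card (v e))" using finite_v[OF e] by (auto simp: Suc_le_eq card_gt_0_iff)
    then show "of_bool (v e \<noteq> {}) \<le> (\<Sum>i<N. of_bool (i \<in> v e) * (1::real))"
      unfolding sum_lessThan_v[OF e] by simp
    show "0 \<le> p e" using p01[OF e] by simp
  qed
  also have "\<dots> = (\<Sum>i<N. \<Sum>e\<in>E. of_bool (i \<in> v e) * p e)"
    by (subst sum.swap) (simp add: sum_distrib_left mult.commute)
  also have "\<dots> \<le> (\<Sum>i<N. C * ln N)"
  proof (intro sum_mono)
    fix i assume "i \<in> {..<N}"
    have "(\<Sum>e\<in>E. of_bool (i \<in> v e) * p e) = (\<Sum>e\<in>{e\<in>E. i \<in> v e}. p e)"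
      using finite_E by (intro sum.mono_neutral_cong_right) auto
    then show "(\<Sum>e\<in>E. of_bool (i \<in> v e) * p e) \<le> C * ln N" using deg \<open>i \<in> _\<close> by simp
  qed
  finally show ?thesis by simp
qed

text \<open>
  With entries of size \<open>K / sqrt N\<close>, a single hyperedge contributes \<open>O(1 / N)\<close> to the form, so the Laplace
  parameter may be as large as \<open>t N\<close> for a small constant \<open>t\<close>. The linear gain \<open>t b N ln N\<close> then beats the
  quadratic compensator \<open>O(t\<^sup>2 N ln N)\<close>.
\<close>

lemma prob_flat_vector:
  fixes y :: "nat \<Rightarrow> real" and K t b :: real
  assumes y: "\<And>i. i < N \<Longrightarrow> \<bar>y i\<bar> \<le> K / sqrt N" and K: "K \<ge> 0" and s: "s \<in> {-1, 1::real}"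
    and t: "0 < t" "t * (D * K)\<^sup>2 \<le> 1" "t * (D * K) ^ 4 * C \<le> b / 2" "b > 0"
  shows "measure_pmf.prob G {A. b * ln N < (\<Sum>i<N. \<Sum>j<N. s * (W A i j - V i j) * (y i * y j))}
    \<le> exp (- (t * b / 2) * (N * ln N))"
proof -
  define q where "q e = s * (\<Sum>i<N. \<Sum>j<N. pair e i j * (y i * y j))" for e
  define \<theta> where "\<theta> = t * N"
  have \<theta>: "\<theta> > 0" using t N by (simp add: \<theta>_def)
  have q: "\<bar>q e\<bar> \<le> (D * K)\<^sup>2 / N" if e: "e \<in> E" for e
  proof -
    have "\<bar>q e\<bar> \<le> (\<Sum>i<N. \<Sum>j<N. \<bar>pair e i j * (y i * y j)\<bar>)"
      using s unfolding q_def abs_mult by (auto intro!: order_trans[OF sum_abs] sum_mono simp: abs_mult)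
    also have "\<dots> \<le> (\<Sum>i<N. \<Sum>j<N. pair e i j * (K\<^sup>2 / N))"
    proof (intro sum_mono)
      fix i j assume "i \<in> {..<N}" "j \<in> {..<N}"
      then have "\<bar>y i\<bar> * \<bar>y j\<bar> \<le> (K / sqrt N) * (K / sqrt N)"
        using y[of i] y[of j] K by (intro mult_mono) auto
      then show "\<bar>pair e i j * (y i * y j)\<bar> \<le> pair e i j * (K\<^sup>2 / N)"
        by (simp add: abs_mult pair_def power2_eq_square)
    qed
    also have "\<dots> = (\<Sum>i<N. \<Sum>j<N. pair e i j) * (K\<^sup>2 / N)"
      by (simp only: sum_distrib_right)
    also have "\<dots> \<le> (D\<^sup>2) * (K\<^sup>2 / N)"
      by (intro mult_right_mono sum_pair_le e) auto
    finally show ?thesis by (simp add: power_mult_distrib)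
  qed
  have qe: "q e = 0" if "v e = {}" for e using that by (simp add: q_def pair_def)
  have form: "(\<Sum>i<N. \<Sum>j<N. s * (W A i j - V i j) * (y i * y j)) = (\<Sum>e\<in>E. of_bool (A e) * q e) - (\<Sum>e\<in>E. p e * q e)" for A
  proof -
    have *: "(\<Sum>e\<in>E. a e * q e) = (\<Sum>i<N. \<Sum>j<N. s * (\<Sum>e\<in>E. a e * pair e i j) * (y i * y j))" for a
    proof -
      have "(\<Sum>e\<in>E. a e * q e) = (\<Sum>e\<in>E. \<Sum>i<N. \<Sum>j<N. s * (a e * pair e i j) * (y i * y j))"
        by (simp add: q_def sum_distrib_left mult_ac)
      also have "\<dots> = (\<Sum>i<N. \<Sum>j<N. \<Sum>e\<in>E. s * (a e * pair e i j) * (y i * y j))"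
        by (subst sum.swap, subst sum.swap[of _ _ E]) simp
      finally show ?thesis by (simp add: sum_distrib_left sum_distrib_right)
    qed
    show ?thesis
      unfolding W_def V_def *
      by (simp only: sum_subtractf left_diff_distrib right_diff_distrib)
  qed
  have "measure_pmf.prob G {A. b * ln N < (\<Sum>i<N. \<Sum>j<N. s * (W A i j - V i j) * (y i * y j))} \<le>
    measure_pmf.prob G {A. \<theta> * (b * ln N + (\<Sum>e\<in>E. p e * q e)) \<le> (\<Sum>e\<in>E. of_bool (A e) * (\<theta> * q e))}"
  proof (rule prob_Collect_mono, unfold form)
    fix A assume "b * ln N < (\<Sum>e\<in>E. of_bool (A e) * q e) - (\<Sum>e\<in>E. p e * q e)"
    then have "\<theta> * (b * ln N + (\<Sum>e\<in>E. p e * q e)) \<le> \<theta> * (\<Sum>e\<in>E. of_bool (A e) * q e)"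
      using \<theta> by (intro mult_left_mono) auto
    then show "\<theta> * (b * ln N + (\<Sum>e\<in>E. p e * q e)) \<le> (\<Sum>e\<in>E. of_bool (A e) * (\<theta> * q e))"
      by (simp only: sum_distrib_left mult.left_commute)
  qed
  also have "\<dots> \<le> exp (- (\<theta> * (b * ln N + (\<Sum>e\<in>E. p e * q e))) + (\<Sum>e\<in>E. p e * (exp (\<theta> * q e) - 1)))"
    unfolding G_def by (rule prob_linear_form_ge_le[OF finite_E p01])
  also have "\<dots> \<le> exp (- (t * b / 2) * (N * ln N))"
  proof -
    have bound: "p e * (exp (\<theta> * q e) - 1) \<le> p e * (\<theta> * q e) + (t\<^sup>2 * (D * K) ^ 4) * (p e * of_bool (v e \<noteq> {}))"
      if e: "e \<in> E" for e
    proof -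
      have aq: "\<bar>\<theta> * q e\<bar> \<le> t * (D * K)\<^sup>2"
      proof -
        have "\<bar>\<theta> * q e\<bar> \<le> \<theta> * ((D * K)\<^sup>2 / N)" using mult_left_mono[OF q[OF e] less_imp_le[OF \<theta>]] \<theta> by (simp add: abs_mult)
        then show ?thesis using N by (simp add: \<theta>_def)
      qed
      have "exp (\<theta> * q e) \<le> 1 + \<theta> * q e + (\<theta> * q e)\<^sup>2"
        using aq t by (intro exp_le_quadratic) auto
      moreover have "(\<theta> * q e)\<^sup>2 \<le> t\<^sup>2 * (D * K) ^ 4 * of_bool (v e \<noteq> {})"
      proof (cases "v e = {}")
        case False
        have "\<bar>\<theta> * q e\<bar>\<^sup>2 \<le> (t * (D * K)\<^sup>2)\<^sup>2" using aq by (intro power_mono) auto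
        then show ?thesis using False by (simp add: power_mult_distrib flip: power_mult)
      qed (simp add: qe)
      ultimately have "exp (\<theta> * q e) - 1 \<le> \<theta> * q e + t\<^sup>2 * (D * K) ^ 4 * of_bool (v e \<noteq> {})" by simp
      from mult_left_mono[OF this, of "p e"] show ?thesis
        using p01[OF e] by (simp add: algebra_simps)
    qed
    have "(\<Sum>e\<in>E. p e * (exp (\<theta> * q e) - 1)) \<le> (\<Sum>e\<in>E. p e * (\<theta> * q e) + (t\<^sup>2 * (D * K) ^ 4) * (p e * of_bool (v e \<noteq> {})))"
      by (intro sum_mono bound)
    also have "\<dots> = \<theta> * (\<Sum>e\<in>E. p e * q e) + (t\<^sup>2 * (D * K) ^ 4) * (\<Sum>e\<in>E. p e * of_bool (v e \<noteq> {}))"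
      by (simp only: sum.distrib sum_distrib_left mult.left_commute)
    also have "\<dots> \<le> \<theta> * (\<Sum>e\<in>E. p e * q e) + (t\<^sup>2 * (D * K) ^ 4) * (N * (C * ln N))"
      by (intro add_left_mono mult_left_mono total_mass) auto
    also have "(t\<^sup>2 * (D * K) ^ 4) * (N * (C * ln N)) = t * (t * (D * K) ^ 4 * C) * (N * ln N)"
      by (simp add: power2_eq_square)
    also have "\<dots> \<le> t * (b / 2) * (N * ln N)"
      using t lnN by (intro mult_right_mono mult_left_mono) auto
    finally show ?thesis by (simp add: \<theta>_def algebra_simps)
  qed
  finally show ?thesis .
qed

lemma prob_flat_grid:
  fixes Q :: nat and h t b :: real
  assumes h: "h > 0" and s: "s \<in> {-1, 1::real}"
    and t: "0 < t" "t * (D * (Q * h))\<^sup>2 \<le> 1" "t * (D * (Q * h)) ^ 4 * C \<le> b / 2" "b > 0"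
  shows "measure_pmf.prob G {A. \<exists>k\<in>PiE {..<N} (\<lambda>_. {- int Q..int Q}). b * ln N <
      (\<Sum>i<N. \<Sum>j<N. s * (W A i j - V i j) * ((h / sqrt N * k i) * (h / sqrt N * k j)))}
    \<le> ((2 * Q + 1) * exp (- (t * b / 2) * ln N)) ^ N"
proof -
  have "measure_pmf.prob G {A. \<exists>k\<in>PiE {..<N} (\<lambda>_. {- int Q..int Q}). b * ln N <
      (\<Sum>i<N. \<Sum>j<N. s * (W A i j - V i j) * ((h / sqrt N * k i) * (h / sqrt N * k j)))} \<le>
     (\<Sum>k\<in>PiE {..<N} (\<lambda>_. {- int Q..int Q}). exp (- (t * b / 2) * (N * ln N)))"
  proof (rule prob_Bex_le)
    fix k assume k: "k \<in> PiE {..<N} (\<lambda>_. {- int Q..int Q})"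
    show "measure_pmf.prob G {A. b * ln N < (\<Sum>i<N. \<Sum>j<N. s * (W A i j - V i j) * ((h / sqrt N * k i) * (h / sqrt N * k j)))}
       \<le> exp (- (t * b / 2) * (N * ln N))"
    proof (rule prob_flat_vector[where K = "Q * h"])
      fix i assume "i < N"
      then have "\<bar>k i\<bar> \<le> int Q" using PiE_mem[OF k, of i] by auto
      then have "\<bar>real_of_int (k i)\<bar> \<le> Q" by linarith
      then have "h / sqrt N * \<bar>real_of_int (k i)\<bar> \<le> h / sqrt N * Q" using h by (intro mult_left_mono) auto
      then show "\<bar>h / sqrt N * k i\<bar> \<le> Q * h / sqrt N" using h by (simp add: abs_mult mult.commute)
    qed (use assms in auto)
  qed (auto intro: finite_PiE)
  also have "\<dots> = real (2 * Q + 1) ^ N * exp (- (t * b / 2) * (N * ln N))"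
    by (simp add: card_PiE nat_add_distrib) 
  also have "exp (- (t * b / 2) * (N * ln N)) = exp (- (t * b / 2) * ln N) ^ N"
    by (simp flip: exp_of_nat_mult)
  also have "real (2 * Q + 1) ^ N * \<dots> = ((2 * Q + 1) * exp (- (t * b / 2) * ln N)) ^ N"
    by (simp add: power_mult_distrib)
  finally show ?thesis .
qed

end

context random_hypergraph
begin

lemma prob_quadratic_form_large:
  fixes Q :: nat and B \<eta> \<gamma> \<epsilon> h b t \<tau> :: real
  assumes s: "s \<in> {-1, 1}"
    and pos: "\<eta> > 0" "\<gamma> > 0" "\<epsilon> > 0" "h > 0" "b > 0" "Q > 0"
    and B: "D * (2 + 2 * C) \<le> B" "C \<le> B"
    and sparse: "exp (4 * D\<^sup>2 / \<epsilon>) * C \<le> (\<eta> * Q * h)\<^sup>2"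
    and t: "0 < t" "t * (D * (Q * h))\<^sup>2 \<le> 1" "t * (D * (Q * h)) ^ 4 * C \<le> b / 2"
    and \<tau>: "b + 4 * B * h + (\<epsilon> + 2 * \<eta>\<^sup>2 * B) / (2 * \<gamma>) + \<gamma> * B + 2 * B / (Q * h) \<le> \<tau>"
  shows "measure_pmf.prob G {A. \<not> (\<forall>x. (\<Sum>i<N. \<Sum>j<N. s * (W A i j - V i j) * (x i * x j)) \<le> \<tau> * ln N * (\<Sum>i<N. (x i)\<^sup>2))}
    \<le> 1 / N + (exp (1 / N) - 1) + ((2 * Q + 1) * exp (- (t * b / 2) * ln N)) ^ N"
proof -
  define \<delta> where "\<delta> = 1 / (\<eta> * Q * h)\<^sup>2"
  let ?form = "\<lambda>A x. (\<Sum>i<N. \<Sum>j<N. s * (W A i j - V i j) * (x i * x j))"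
  let ?bad1 = "\<lambda>A. \<exists>i\<in>{..<N}. D * (2 + 2 * C) * ln N < (\<Sum>j<N. W A i j)"
  let ?bad2 = "\<lambda>A. \<exists>S\<in>{S. S \<subseteq> {..<N} \<and> real (card S) \<le> \<delta> * N}. \<epsilon> * ln N * card S < (\<Sum>i\<in>S. \<Sum>j\<in>S. W A i j)"
  let ?bad3 = "\<lambda>A. \<exists>k\<in>PiE {..<N} (\<lambda>_. {- int Q..int Q}). b * ln N <
      (\<Sum>i<N. \<Sum>j<N. s * (W A i j - V i j) * ((h / sqrt N * k i) * (h / sqrt N * k j)))"
  have B0: "0 \<le> B" using B C by simp
  have unit: "?form A x \<le> \<tau> * ln N" if good: "\<not> ?bad1 A" "\<not> ?bad2 A" "\<not> ?bad3 A" and x: "(\<Sum>i<N. (x i)\<^sup>2) \<le> 1" for A x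
  proof -
    have "?form A x \<le> b * ln N + 4 * (B * ln N) * h + (\<epsilon> * ln N + 2 * \<eta>\<^sup>2 * (B * ln N)) / (2 * \<gamma>) + \<gamma> * (B * ln N)
        + 2 * (B * ln N) / (Q * h)"
    proof (rule quadratic_form_le_of_sparse[OF N W_nonneg V_nonneg W_sym V_sym _ _ pos(1,2) _ _ pos(4,6) _ s _ x])
      fix i assume "i < N"
      then have "(\<Sum>j<N. W A i j) \<le> D * (2 + 2 * C) * ln N" using good(1) by (auto simp: not_less)
      also have "\<dots> \<le> B * ln N" using B lnN by (intro mult_right_mono) auto
      finally show "(\<Sum>j<N. W A i j) \<le> B * ln N" .
    next
      fix i j assume "i < N" "j < N"
      then have "V i j \<le> C * ln N / N" by (rule V_le)
      also have "\<dots> \<le> B * ln N / N" using B lnN by (intro divide_right_mono mult_right_mono) auto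
      finally show "V i j \<le> B * ln N / N" .
    next
      fix S assume S: "S \<subseteq> {..<N}" "real (card S) * (\<eta> * Q * h)\<^sup>2 \<le> real N"
      then have "real (card S) \<le> \<delta> * N" using pos by (simp add: \<delta>_def field_simps)
      then show "(\<Sum>i\<in>S. \<Sum>j\<in>S. W A i j) \<le> \<epsilon> * ln N * card S" using good(2) S by (auto simp: not_less)
    next
      fix k :: "nat \<Rightarrow> int" assume "k \<in> PiE {..<N} (\<lambda>_. {- int Q..int Q})"
      then show "(\<Sum>i<N. \<Sum>j<N. s * (W A i j - V i j) * ((h / sqrt N * k i) * (h / sqrt N * k j))) \<le> b * ln N"
        using good(3) by (meson not_less)
    qed (use B0 lnN pos in auto)
    also have "\<dots> = (b + 4 * B * h + (\<epsilon> + 2 * \<eta>\<^sup>2 * B) / (2 * \<gamma>) + \<gamma> * B + 2 * B / (Q * h)) * ln N"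
      by (simp add: algebra_simps add_divide_distrib)
    also have "\<dots> \<le> \<tau> * ln N" using \<tau> lnN by (rule mult_right_mono)
    finally show ?thesis .
  qed
  have "?form A x \<le> \<tau> * ln N * (\<Sum>i<N. (x i)\<^sup>2)" if good: "\<not> ?bad1 A" "\<not> ?bad2 A" "\<not> ?bad3 A" for A x
  proof (cases "(\<Sum>i<N. (x i)\<^sup>2) = 0")
    case True
    then have "\<And>i. i < N \<Longrightarrow> x i = 0" by (simp add: sum_nonneg_eq_0_iff)
    then show ?thesis by simp
  next
    case False
    define r where "r = (\<Sum>i<N. (x i)\<^sup>2)"
    have r: "r > 0" using False by (auto simp: r_def less_le intro!: sum_nonneg)
    have "?form A (\<lambda>i. x i / sqrt r) \<le> \<tau> * ln N"
      using r by (intro unit good) (simp add: power_divide flip: sum_divide_distrib r_def)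
    moreover have "?form A (\<lambda>i. x i / sqrt r) = ?form A x / r"
      unfolding sum_divide_distrib using r by simp
    ultimately have "?form A x / r \<le> \<tau> * ln N" by (simp only:)
    then have "?form A x \<le> \<tau> * ln N * r" by (simp only: pos_divide_le_eq[OF r])
    then show ?thesis by (simp only: r_def)
  qed
  then have "measure_pmf.prob G {A. \<not> (\<forall>x. ?form A x \<le> \<tau> * ln N * (\<Sum>i<N. (x i)\<^sup>2))} \<le>
      measure_pmf.prob G {A. (?bad1 A \<or> ?bad2 A) \<or> ?bad3 A}"
    by (intro prob_Collect_mono) blast
  also have "\<dots> \<le> 1 / N + (exp (1 / N) - 1) + ((2 * Q + 1) * exp (- (t * b / 2) * ln N)) ^ N"
  proof (intro prob_disj_le prob_degree)
    show "measure_pmf.prob G {A. ?bad2 A} \<le> exp (1 / N) - 1"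
      using pos sparse by (intro prob_dense_subset) (auto simp: \<delta>_def field_simps)
    show "measure_pmf.prob G {A. ?bad3 A} \<le> ((2 * Q + 1) * exp (- (t * b / 2) * ln N)) ^ N"
      by (rule prob_flat_grid[OF pos(4) s t pos(5)])
  qed
  finally show ?thesis .
qed

end

text \<open>
  The bound \<open>b\<close> depends on \<open>\<tau>\<close>, \<open>C\<close> and \<open>D\<close> alone. It must not depend on the hypergraph, because it is used
  for all community vectors at once.
\<close>

theorem centered_quadratic_form_small:
  fixes \<tau> C :: real and D :: nat
  assumes \<tau>: "\<tau> > 0" and C: "C \<ge> 0"
  shows "\<exists>b. b \<longlonglongrightarrow> 0 \<and> (\<forall>N (E :: 'e set) v p s. random_hypergraph N E v p D C \<longrightarrow> s \<in> {-1, 1} \<longrightarrow>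
    measure_pmf.prob (Pi_pmf E False (\<lambda>e. bernoulli_pmf (p e)))
      {A. \<not> (\<forall>x. (\<Sum>i<N. \<Sum>j<N. s * (random_hypergraph.W E v A i j - random_hypergraph.V E v p i j) * (x i * x j))
         \<le> \<tau> * ln N * (\<Sum>i<N. (x i)\<^sup>2))} \<le> b N)"
proof -
  \<comment> \<open>\<open>B\<close> dominates the degrees of both \<open>W\<close> and \<open>V\<close>; the other constants make each of the five error terms
    of \<open>quadratic_form_le_of_sparse\<close> at most \<open>\<tau> / 5\<close>.\<close>
  define B where "B = D * (2 + 2 * C) + C + 1"
  define b where "b = \<tau> / 5"
  define h where "h = \<tau> / (20 * B)"
  define \<gamma> where "\<gamma> = \<tau> / (5 * B)"
  define \<epsilon> where "\<epsilon> = \<gamma> * \<tau> / 5"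
  define \<eta> where "\<eta> = sqrt (\<gamma> * \<tau> / (10 * B))"
  define Q where "Q = nat \<lceil>10 * B / (\<tau> * h) + exp (4 * D\<^sup>2 / \<epsilon>) * C / (\<eta> * h)\<^sup>2 + 1\<rceil>"
  define X where "X = (D * (Q * h))"
  define t where "t = min (1 / (1 + X\<^sup>2)) (b / (2 * (1 + X ^ 4 * C)))"
  have B: "B > 0" "D * (2 + 2 * C) \<le> B" "C \<le> B"
    using C by (auto simp: B_def intro!: add_nonneg_pos mult_nonneg_nonneg add_nonneg_nonneg)
  have pos: "b > 0" "h > 0" "\<gamma> > 0" "\<epsilon> > 0" "\<eta> > 0"
    using \<tau> B by (auto simp: b_def h_def \<gamma>_def \<epsilon>_def \<eta>_def)
  have \<eta>2: "\<eta>\<^sup>2 = \<gamma> * \<tau> / (10 * B)"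
    unfolding \<eta>_def using \<tau> B pos by (intro real_sqrt_pow2) auto
  have Q_ge: "10 * B / (\<tau> * h) + exp (4 * D\<^sup>2 / \<epsilon>) * C / (\<eta> * h)\<^sup>2 + 1 \<le> Q" unfolding Q_def by linarith
  have nn: "0 \<le> 10 * B / (\<tau> * h)" "0 \<le> exp (4 * D\<^sup>2 / \<epsilon>) * C / (\<eta> * h)\<^sup>2" using \<tau> B C pos by auto
  have Q1: "1 \<le> real Q" and Q2: "10 * B / (\<tau> * h) \<le> Q" and Q3: "exp (4 * D\<^sup>2 / \<epsilon>) * C / (\<eta> * h)\<^sup>2 \<le> Q"
    using Q_ge nn by linarith+
  have sparse: "exp (4 * D\<^sup>2 / \<epsilon>) * C \<le> (\<eta> * Q * h)\<^sup>2"
  proof -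
    have "exp (4 * D\<^sup>2 / \<epsilon>) * C \<le> Q * (\<eta> * h)\<^sup>2" using Q3 pos by (simp add: pos_divide_le_eq)
    also have "\<dots> \<le> (Q * Q) * (\<eta> * h)\<^sup>2" using Q1 by (intro mult_right_mono) auto
    finally show ?thesis by (simp add: power2_eq_square algebra_simps)
  qed
  have \<tau>_le: "b + 4 * B * h + (\<epsilon> + 2 * \<eta>\<^sup>2 * B) / (2 * \<gamma>) + \<gamma> * B + 2 * B / (Q * h) \<le> \<tau>"
  proof -
    have "4 * B * h = \<tau> / 5" "\<gamma> * B = \<tau> / 5" using B by (auto simp: h_def \<gamma>_def)
    moreover have "(\<epsilon> + 2 * \<eta>\<^sup>2 * B) / (2 * \<gamma>) = \<tau> / 5" using B pos by (simp add: \<eta>2 \<epsilon>_def field_simps)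
    moreover have "2 * B / (Q * h) \<le> \<tau> / 5" using Q1 Q2 \<tau> pos by (simp add: field_simps)
    ultimately show ?thesis unfolding b_def by linarith
  qed
  have t: "0 < t" "t * X\<^sup>2 \<le> 1" "t * X ^ 4 * C \<le> b / 2"
  proof -
    have d: "0 < 1 + X\<^sup>2" "0 < 1 + X ^ 4 * C" using C by (auto intro!: add_pos_nonneg)
    then show t0: "0 < t" using pos by (auto simp: t_def)
    have "t * X\<^sup>2 \<le> t * (1 + X\<^sup>2)" using t0 by (intro mult_left_mono) auto
    also have "\<dots> \<le> 1 / (1 + X\<^sup>2) * (1 + X\<^sup>2)" using d by (intro mult_right_mono) (auto simp: t_def)
    finally show "t * X\<^sup>2 \<le> 1" using d by simp
    have "t * X ^ 4 * C \<le> t * (1 + X ^ 4 * C)" using t0 by (simp add: algebra_simps)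
    also have "\<dots> \<le> b / (2 * (1 + X ^ 4 * C)) * (1 + X ^ 4 * C)" using d by (intro mult_right_mono) (auto simp: t_def)
    also have "\<dots> = b / 2" using less_imp_neq[OF d(2)] by (metis nonzero_mult_divide_mult_cancel_right times_divide_eq_left)
    finally show "t * X ^ 4 * C \<le> b / 2" .
  qed
  define base where "base N = (2 * Q + 1) * exp (- (t * b / 2) * ln (real N))" for N :: nat
  have base: "base \<longlonglongrightarrow> 0" unfolding base_def
  proof -
    have "t * b / 2 > 0" using t pos by simp
    then show "(\<lambda>N. real (2 * Q + 1) * exp (- (t * b / 2) * ln (real N))) \<longlonglongrightarrow> 0" by real_asymp
  qed
  have base_pow: "(\<lambda>N. base N ^ N) \<longlonglongrightarrow> 0"
  proof (rule tendsto_sandwich[OF _ _ tendsto_const base])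
    show "\<forall>\<^sub>F N in sequentially. 0 \<le> base N ^ N" by (simp add: base_def)
    have "\<forall>\<^sub>F N in sequentially. base N < 1" using base by (rule order_tendstoD) simp
    then show "\<forall>\<^sub>F N in sequentially. base N ^ N \<le> base N"
      using eventually_ge_at_top[of 1]
    proof eventually_elim
      case (elim N)
      then show ?case using power_decreasing[of 1 N "base N"] by (simp add: base_def)
    qed
  qed
  have inv: "(\<lambda>N. 1 / real N + (exp (1 / real N) - 1)) \<longlonglongrightarrow> 0" by real_asymp
  have "(\<lambda>N. 1 / real N + (exp (1 / real N) - 1) + base N ^ N) \<longlonglongrightarrow> 0"
    using tendsto_add[OF inv base_pow] by simp
  moreover have "measure_pmf.prob (Pi_pmf E False (\<lambda>e. bernoulli_pmf (p e)))
      {A. \<not> (\<forall>x. (\<Sum>i<N. \<Sum>j<N. s * (random_hypergraph.W E v A i j - random_hypergraph.V E v p i j) * (x i * x j))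
         \<le> \<tau> * ln N * (\<Sum>i<N. (x i)\<^sup>2))} \<le> 1 / real N + (exp (1 / real N) - 1) + base N ^ N"
    if "random_hypergraph N E v p D C" "s \<in> {-1, 1}" for N and E :: "'e set" and v p s
  proof -
    interpret random_hypergraph N E v p D C by (rule that)
    show ?thesis
      using prob_quadratic_form_large[OF that(2) pos(5,3,4,2,1) _ B(2,3) sparse t(1) _ _ \<tau>_le] t(2,3) Q1
      by (simp add: G_def base_def X_def)
  qed
  ultimately show ?thesis by blast
qed

context random_hypergraph
begin

text \<open>
  The hypothesis \<open>s * \<bar>l\<bar> = l\<close> says that \<open>l\<close> has the sign \<open>s\<close>; then the tilt by \<open>- l\<close> of the unsigned sum is
  the tilt by \<open>- \<bar>l\<bar>\<close> of the signed one.
\<close>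

lemma prob_signed_degree_le:
  assumes l: "s * \<bar>l\<bar> = l"
  shows "measure_pmf.prob G {A. (\<Sum>j<N. s * W A i j * (x i * x j)) \<le> t}
    \<le> exp (\<bar>l\<bar> * t - (\<Sum>e\<in>E. p e * (1 - exp (- l * (\<Sum>j<N. pair e i j * (x i * x j))))))"
proof -
  define g where "g e = (\<Sum>j<N. pair e i j * (x i * x j))" for e
  have lin: "(\<Sum>j<N. s * W A i j * (x i * x j)) = s * (\<Sum>e\<in>E. of_bool (A e) * g e)" for A
  proof -
    have "(\<Sum>e\<in>E. of_bool (A e) * g e) = (\<Sum>j<N. W A i j * (x i * x j))"
      unfolding g_def W_def sum_distrib_left sum_distrib_right by (subst sum.swap) (simp add: mult_ac)
    then show ?thesis by (simp add: sum_distrib_left mult.assoc)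
  qed
  have "measure_pmf.prob G {A. (\<Sum>j<N. s * W A i j * (x i * x j)) \<le> t} \<le>
      measure_pmf.prob G {A. - (\<bar>l\<bar> * t) \<le> (\<Sum>e\<in>E. of_bool (A e) * (- l * g e))}"
  proof (rule prob_Collect_mono)
    fix A assume "(\<Sum>j<N. s * W A i j * (x i * x j)) \<le> t"
    then have "\<bar>l\<bar> * (s * (\<Sum>e\<in>E. of_bool (A e) * g e)) \<le> \<bar>l\<bar> * t"
      unfolding lin by (rule mult_left_mono) simp
    moreover have "\<bar>l\<bar> * (s * (\<Sum>e\<in>E. of_bool (A e) * g e)) = l * (\<Sum>e\<in>E. of_bool (A e) * g e)"
      by (subst (2) l[symmetric]) simp
    moreover have "(\<Sum>e\<in>E. of_bool (A e) * (- l * g e)) = - (l * (\<Sum>e\<in>E. of_bool (A e) * g e))"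
      by (simp add: sum_distrib_left sum_negf mult.left_commute)
    ultimately show "- (\<bar>l\<bar> * t) \<le> (\<Sum>e\<in>E. of_bool (A e) * (- l * g e))" by linarith
  qed
  also have "\<dots> \<le> exp (- (- (\<bar>l\<bar> * t)) + (\<Sum>e\<in>E. p e * (exp (- l * g e) - 1)))"
    unfolding G_def by (rule prob_linear_form_ge_le[OF finite_E p01])
  also have "(\<Sum>e\<in>E. p e * (exp (- l * g e) - 1)) = - (\<Sum>e\<in>E. p e * (1 - exp (- l * g e)))"
    unfolding sum_negf[symmetric] by (intro sum.cong refl) (simp add: algebra_simps)
  finally show ?thesis by (simp add: g_def)
qed

end

section \<open>Counting hyperedges by their intersection with a set\<close>

text \<open>
  A \<open>k\<close>-subset of \<open>P \<union> Q\<close> with \<open>r\<close> elements in \<open>Q\<close> is a choice of \<open>r\<close> elements of \<open>Q\<close> and \<open>k - r\<close>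
  elements of \<open>P\<close>.
\<close>

lemma sum_subsets_by_intersection:
  fixes g :: "nat \<Rightarrow> real"
  assumes fin: "finite P" "finite Q" and disj: "P \<inter> Q = {}"
  shows "(\<Sum>e\<in>{e. e \<subseteq> P \<union> Q \<and> card e = k}. g (card (e \<inter> Q))) =
    (\<Sum>r\<le>k. real (card Q choose r) * real (card P choose (k - r)) * g r)"
proof -
  let ?F = "{e. e \<subseteq> P \<union> Q \<and> card e = k}"
  have finF: "finite ?F" using fin by simp
  have "(\<Sum>e\<in>?F. g (card (e \<inter> Q))) = (\<Sum>r\<le>k. \<Sum>e\<in>{e\<in>?F. card (e \<inter> Q) = r}. g (card (e \<inter> Q)))"
  proof (rule sum.group[symmetric])
    show "(\<lambda>e. card (e \<inter> Q)) ` ?F \<subseteq> {..k}"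
      using fin by (auto intro!: card_mono intro: finite_subset)
  qed (use finF in auto)
  also have "\<dots> = (\<Sum>r\<le>k. real (card Q choose r) * real (card P choose (k - r)) * g r)"
  proof (intro sum.cong refl)
    fix r assume r: "r \<in> {..k}"
    have "bij_betw (\<lambda>(a, b). a \<union> b) ({a. a \<subseteq> Q \<and> card a = r} \<times> {b. b \<subseteq> P \<and> card b = k - r})
        {e\<in>?F. card (e \<inter> Q) = r}"
    proof (rule bij_betw_byWitness[where f' = "\<lambda>e. (e \<inter> Q, e \<inter> P)"])
      show "\<forall>ab\<in>{a. a \<subseteq> Q \<and> card a = r} \<times> {b. b \<subseteq> P \<and> card b = k - r}.
          (\<lambda>e. (e \<inter> Q, e \<inter> P)) ((\<lambda>(a, b). a \<union> b) ab) = ab"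
        using disj by auto
      show "\<forall>e\<in>{e\<in>?F. card (e \<inter> Q) = r}. (\<lambda>(a, b). a \<union> b) (e \<inter> Q, e \<inter> P) = e" by auto
      show "(\<lambda>(a, b). a \<union> b) ` ({a. a \<subseteq> Q \<and> card a = r} \<times> {b. b \<subseteq> P \<and> card b = k - r})
          \<subseteq> {e\<in>?F. card (e \<inter> Q) = r}"
      proof safe
        fix a b assume a: "a \<subseteq> Q" "r = card a" and b: "b \<subseteq> P" "card b = k - card a"
        have f: "finite a" "finite b" "a \<inter> b = {}" using a b fin disj by (auto intro: finite_subset)
        show "card (a \<union> b) = k" using card_Un_disjoint[OF f] a b r by simp
        have "(a \<union> b) \<inter> Q = a" using a b disj by auto
        then show "card ((a \<union> b) \<inter> Q) = card a" by simp
      qed auto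
      show "(\<lambda>e. (e \<inter> Q, e \<inter> P)) ` {e\<in>?F. card (e \<inter> Q) = r}
          \<subseteq> {a. a \<subseteq> Q \<and> card a = r} \<times> {b. b \<subseteq> P \<and> card b = k - r}"
      proof safe
        fix e assume e: "e \<subseteq> P \<union> Q" "k = card e" "r = card (e \<inter> Q)"
        have "card ((e \<inter> Q) \<union> (e \<inter> P)) = card (e \<inter> Q) + card (e \<inter> P)"
          using fin disj by (intro card_Un_disjoint) auto
        moreover have "(e \<inter> Q) \<union> (e \<inter> P) = e" using e by auto
        ultimately show "card (e \<inter> P) = card e - card (e \<inter> Q)" by simp
      qed
    qed
    then have "card {e\<in>?F. card (e \<inter> Q) = r} = card {a. a \<subseteq> Q \<and> card a = r} * card {b. b \<subseteq> P \<and> card b = k - r}"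
      by (simp add: bij_betw_same_card flip: card_cartesian_product)
    then show "(\<Sum>e\<in>{e\<in>?F. card (e \<inter> Q) = r}. g (card (e \<inter> Q))) = real (card Q choose r) * real (card P choose (k - r)) * g r"
      using fin by (simp add: n_subsets)
  qed
  finally show ?thesis .
qed

lemma bij_betw_hyperedges_containing:
  assumes S: "S \<subseteq> {..<N}" "card S \<le> k"
  shows "bij_betw (\<lambda>e. e \<union> S) {e. e \<subseteq> {..<N} - S \<and> card e = k - card S} {e \<in> hyperedges N k. S \<subseteq> e}"
proof (rule bij_betw_byWitness[where f' = "\<lambda>e. e - S"])
  have finS: "finite S" using S finite_subset by auto
  show "(\<lambda>e. e \<union> S) ` {e. e \<subseteq> {..<N} - S \<and> card e = k - card S} \<subseteq> {e \<in> hyperedges N k. S \<subseteq> e}"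
  proof safe
    fix e assume e: "e \<subseteq> {..<N} - S" "card e = k - card S"
    then have "card (e \<union> S) = card e + card S"
      using finS by (intro card_Un_disjoint) (auto intro: finite_subset)
    then show "e \<union> S \<in> hyperedges N k" using e S by (auto simp: hyperedges_def)
  qed
  show "(\<lambda>e. e - S) ` {e \<in> hyperedges N k. S \<subseteq> e} \<subseteq> {e. e \<subseteq> {..<N} - S \<and> card e = k - card S}"
    using finS by (auto simp: hyperedges_def card_Diff_subset)
qed (use S in \<open>auto simp: hyperedges_def\<close>)

lemma card_hyperedges_containing:
  assumes "S \<subseteq> {..<N}" "card S \<le> k"
  shows "card {e \<in> hyperedges N k. S \<subseteq> e} = (N - card S) choose (k - card S)"
proof -
  have "card {e \<in> hyperedges N k. S \<subseteq> e} = card {e. e \<subseteq> {..<N} - S \<and> card e = k - card S}"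
    using bij_betw_same_card[OF bij_betw_hyperedges_containing[OF assms]] by simp
  also have "\<dots> = card ({..<N} - S) choose (k - card S)" by (rule n_subsets) simp
  also have "card ({..<N} - S) = N - card S"
    using assms by (subst card_Diff_subset) (auto intro: finite_subset)
  finally show ?thesis .
qed

text \<open>
  With \<open>S\<close> a vertex this gives the law of the signed degree, with \<open>S\<close> a pair the entries of the mean
  matrix. The right-hand side depends on \<open>S\<close> only through cardinalities, which is how exchangeability enters.
\<close>

lemma sum_hyperedges_containing:
  fixes g :: "nat \<Rightarrow> real"
  assumes S: "S \<subseteq> {..<N}" "card S \<le> k" and Q: "Q \<subseteq> {..<N}"
  shows "(\<Sum>e\<in>{e \<in> hyperedges N k. S \<subseteq> e}. g (card (e \<inter> Q))) =
    (\<Sum>r\<le>k - card S. real (card (Q - S) choose r) * real (card ({..<N} - Q - S) choose (k - card S - r)) * g (r + card (S \<inter> Q)))"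
proof -
  have fin: "finite S" "finite Q" using S Q finite_subset by auto
  have un: "{..<N} - S = ({..<N} - Q - S) \<union> (Q - S)" using Q by auto
  have "(\<Sum>e\<in>{e \<in> hyperedges N k. S \<subseteq> e}. g (card (e \<inter> Q))) =
      (\<Sum>e\<in>{e. e \<subseteq> {..<N} - S \<and> card e = k - card S}. g (card ((e \<union> S) \<inter> Q)))"
    by (rule sum.reindex_bij_betw[OF bij_betw_hyperedges_containing[OF S], symmetric])
  also have "\<dots> = (\<Sum>e\<in>{e. e \<subseteq> {..<N} - S \<and> card e = k - card S}. g (card (e \<inter> (Q - S)) + card (S \<inter> Q)))"
  proof (intro sum.cong refl)
    fix e assume "e \<in> {e. e \<subseteq> {..<N} - S \<and> card e = k - card S}"
    then have "(e \<union> S) \<inter> Q = (e \<inter> (Q - S)) \<union> (S \<inter> Q)" by auto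
    moreover have "card \<dots> = card (e \<inter> (Q - S)) + card (S \<inter> Q)"
      using fin by (intro card_Un_disjoint) auto
    ultimately show "g (card ((e \<union> S) \<inter> Q)) = g (card (e \<inter> (Q - S)) + card (S \<inter> Q))" by simp
  qed
  also have "\<dots> = (\<Sum>r\<le>k - card S. real (card (Q - S) choose r) * real (card ({..<N} - Q - S) choose (k - card S - r)) * g (r + card (S \<inter> Q)))"
    unfolding un by (rule sum_subsets_by_intersection[where g = "\<lambda>r. g (r + card (S \<inter> Q))"]) (use fin in auto)
  finally show ?thesis .
qed

section \<open>The rate function\<close>

lemma binomial_over_power_tendsto:
  fixes a :: "nat \<Rightarrow> nat" and c :: real
  assumes "(\<lambda>n. real (a n) / real n) \<longlonglongrightarrow> c"
  shows "(\<lambda>n. real (a n choose k) / real n ^ k) \<longlonglongrightarrow> c ^ k / fact k"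
proof -
  have "(\<lambda>n. (\<Prod>i<k. real (a n) / real n - real i / real n) / fact k) \<longlonglongrightarrow> (\<Prod>i<k. c - 0) / fact k"
    by (intro tendsto_divide tendsto_prod tendsto_diff assms tendsto_const lim_const_over_n) auto
  moreover have "(\<Prod>i<k. real (a n) / real n - real i / real n) / fact k = real (a n choose k) / real n ^ k" for n
    unfolding binomial_gbinomial gbinomial_prod_rev
    by (simp add: diff_divide_distrib[symmetric] prod_dividef atLeast0LessThan)
  ultimately show ?thesis by simp
qed

text \<open>
  Sampling \<open>k\<close> neighbours without replacement from two communities, of \<open>n\<close> and \<open>n - 1\<close> candidates,
  becomes \<open>k\<close> fair coin flips.
\<close>

lemma hypergeometric_tendsto_binomial:
  assumes "r \<le> k"
  shows "(\<lambda>n. real (n choose r) * real ((n - 1) choose (k - r)) / real ((2 * n - 1) choose k))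
    \<longlonglongrightarrow> real (k choose r) / 2 ^ k"
proof -
  have 1: "(\<lambda>n. real (n choose r) / real n ^ r) \<longlonglongrightarrow> 1 ^ r / fact r"
    by (rule binomial_over_power_tendsto) real_asymp
  have 2: "(\<lambda>n. real ((n - 1) choose (k - r)) / real n ^ (k - r)) \<longlonglongrightarrow> 1 ^ (k - r) / fact (k - r)"
    by (rule binomial_over_power_tendsto) real_asymp
  have 3: "(\<lambda>n. real ((2 * n - 1) choose k) / real n ^ k) \<longlonglongrightarrow> 2 ^ k / fact k"
    by (rule binomial_over_power_tendsto) real_asymp
  have "(\<lambda>n. (real (n choose r) / real n ^ r) * (real ((n - 1) choose (k - r)) / real n ^ (k - r)) /
      (real ((2 * n - 1) choose k) / real n ^ k)) \<longlonglongrightarrow>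
      (1 ^ r / fact r) * (1 ^ (k - r) / fact (k - r)) / (2 ^ k / fact k)"
    by (intro tendsto_divide tendsto_mult 1 2 3) auto
  also have "(1 ^ r / fact r) * (1 ^ (k - r) / fact (k - r)) / (2 ^ k / fact k) = real (k choose r) / 2 ^ k"
    using assms by (simp add: binomial_fact)
  finally show ?thesis
  proof (rule Lim_transform_eventually)
    show "\<forall>\<^sub>F n in sequentially. (real (n choose r) / real n ^ r) * (real ((n - 1) choose (k - r)) / real n ^ (k - r)) /
      (real ((2 * n - 1) choose k) / real n ^ k) = real (n choose r) * real ((n - 1) choose (k - r)) / real ((2 * n - 1) choose k)"
      using eventually_gt_at_top[of 0]
    proof eventually_elim
      case (elim n)
      have "real n ^ r * real n ^ (k - r) = real n ^ k" using assms by (simp flip: power_add)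
      then show ?case using elim by (simp add: field_simps)
    qed
  qed
qed

text \<open>
  For large \<open>n\<close> the edge probabilities are therefore not truncated at 1.
\<close>

lemma ln_over_binomial_tendsto_0:
  assumes "1 \<le> k"
  shows "(\<lambda>n. C * ln (real (2 * n)) / real ((2 * n - 1) choose k)) \<longlonglongrightarrow> 0"
proof -
  have 3: "(\<lambda>n. real ((2 * n - 1) choose k) / real n ^ k) \<longlonglongrightarrow> 2 ^ k / fact k"
    by (rule binomial_over_power_tendsto) real_asymp
  have "(\<lambda>n. C * ln (real (2 * n)) / real n ^ k) \<longlonglongrightarrow> 0"
  proof (rule Lim_null_comparison)
    show "\<forall>\<^sub>F n in sequentially. norm (C * ln (real (2 * n)) / real n ^ k) \<le> \<bar>C\<bar> * ln (real (2 * n)) / real n"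
      using eventually_gt_at_top[of 0]
    proof eventually_elim
      case (elim n)
      then have "real n ^ 1 \<le> real n ^ k" using assms by (intro power_increasing) auto
      then show ?case using elim
        by (auto simp: abs_mult intro!: divide_left_mono)
    qed
    show "(\<lambda>n. \<bar>C\<bar> * ln (real (2 * n)) / real n) \<longlonglongrightarrow> 0" by real_asymp
  qed
  from tendsto_divide[OF this 3]
  have "(\<lambda>n. C * ln (real (2 * n)) / real n ^ k / (real ((2 * n - 1) choose k) / real n ^ k)) \<longlonglongrightarrow> 0" by simp
  then show ?thesis
  proof (rule Lim_transform_eventually)
    show "\<forall>\<^sub>F n in sequentially. C * ln (real (2 * n)) / real n ^ k / (real ((2 * n - 1) choose k) / real n ^ k) =
       C * ln (real (2 * n)) / real ((2 * n - 1) choose k)"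
      using eventually_gt_at_top[of 0] by eventually_elim simp
  qed
qed

definition rate_function :: "nat \<Rightarrow> (nat \<Rightarrow> nat) \<Rightarrow> (nat \<Rightarrow> nat \<times> nat \<Rightarrow> real) \<Rightarrow> real \<Rightarrow> real" where
  "rate_function M d \<alpha> l = (\<Sum>m=1..M. \<Sum>r=0..d m - 1.
     (1 / 2 ^ (d m - 1)) * real ((d m - 1) choose r) * \<alpha> m (r, d m - r) *
     (1 - exp (- l * (real (d m) - 1 - 2 * real r))))"

text \<open>
  The rate function is concave and vanishes at 0, and \<open>\<xi>\<close> is its slope there.
\<close>

lemma rate_function_le_tangent:
  assumes "\<And>m r. m \<in> {1..M} \<Longrightarrow> r \<le> d m \<Longrightarrow> 0 < \<alpha> m (r, d m - r)"
  shows "rate_function M d \<alpha> l \<le> l * xi M d \<alpha>"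
proof -
  have "rate_function M d \<alpha> l \<le> (\<Sum>m=1..M. \<Sum>r=0..d m - 1.
     (1 / 2 ^ (d m - 1)) * real ((d m - 1) choose r) * \<alpha> m (r, d m - r) * (l * (real (d m) - 1 - 2 * real r)))"
    unfolding rate_function_def
  proof (intro sum_mono mult_left_mono)
    fix m r assume m: "m \<in> {1..M}" and r: "r \<in> {0..d m - 1}"
    show "1 - exp (- l * (real (d m) - 1 - 2 * real r)) \<le> l * (real (d m) - 1 - 2 * real r)"
      using exp_ge_add_one_self[of "- l * (real (d m) - 1 - 2 * real r)"] by simp
    have "0 < \<alpha> m (r, d m - r)" using r by (intro assms m) auto
    then show "0 \<le> 1 / 2 ^ (d m - 1) * real ((d m - 1) choose r) * \<alpha> m (r, d m - r)" by simp
  qed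
  also have "\<dots> = l * xi M d \<alpha>"
    by (simp add: xi_def sum_distrib_left mult_ac)
  finally show ?thesis .
qed

text \<open>
  Since \<open>l \<xi>\<close> bounds the rate at \<open>l\<close>, a rate above 1 forces \<open>\<xi> \<noteq> 0\<close> and forces \<open>l\<close> to have the sign of \<open>\<xi>\<close>.
\<close>

lemma exists_rate_gt_one:
  assumes pos: "\<And>m r. m \<in> {1..M} \<Longrightarrow> r \<le> d m \<Longrightarrow> 0 < \<alpha> m (r, d m - r)"
    and "recovery_rate M d \<alpha> > 1"
  shows "\<exists>l. rate_function M d \<alpha> l > 1 \<and> sgn_at c (xi M d \<alpha>) * \<bar>l\<bar> = l"
proof -
  have "bdd_above (range (rate_function M d \<alpha>))"
  proof (rule bdd_aboveI2)
    fix l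
    show "rate_function M d \<alpha> l \<le> (\<Sum>m=1..M. \<Sum>r=0..d m - 1. (1 / 2 ^ (d m - 1)) * real ((d m - 1) choose r) * \<alpha> m (r, d m - r) * 1)"
      unfolding rate_function_def
    proof (intro sum_mono mult_left_mono)
      fix m r assume m: "m \<in> {1..M}" and r: "r \<in> {0..d m - 1}"
      have "0 < \<alpha> m (r, d m - r)" using r by (intro pos m) auto
      then show "0 \<le> 1 / 2 ^ (d m - 1) * real ((d m - 1) choose r) * \<alpha> m (r, d m - r)" by simp
    qed simp
  qed
  moreover have "1 < (SUP l. rate_function M d \<alpha> l)"
    using assms(2) by (simp add: recovery_rate_def rate_function_def)
  ultimately obtain l where l: "1 < rate_function M d \<alpha> l"
    using less_cSUP_iff[of UNIV "rate_function M d \<alpha>" 1] by auto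
  then have "0 < l * xi M d \<alpha>" using rate_function_le_tangent[of M d \<alpha> l] pos by fastforce
  then have "sgn_at c (xi M d \<alpha>) * \<bar>l\<bar> = l" by (auto simp: sgn_at_def zero_less_mult_iff)
  with l show ?thesis by blast
qed

section \<open>The semidefinite program and its dual certificate\<close>

text \<open>
  Elimination of one index at a time: subtracting the rank-one kernel of the row of \<open>a\<close> leaves the Schur
  complement, which is again positive semidefinite. If the diagonal entry \<open>c\<close> vanishes, so does the whole
  row; with \<open>S / 0 = 0\<close> the same formulas then cover this case.
\<close>

lemma psd_kernel_gram:
  fixes X :: "'a \<Rightarrow> 'a \<Rightarrow> real"
  assumes "finite I" and "\<And>i j. i \<in> I \<Longrightarrow> j \<in> I \<Longrightarrow> X i j = X j i"
    and "\<And>x. 0 \<le> (\<Sum>i\<in>I. \<Sum>j\<in>I. x i * X i j * x j)"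
  shows "\<exists>(K::nat) b. \<forall>i\<in>I. \<forall>j\<in>I. X i j = (\<Sum>k<K. b k i * b k j)"
  using assms
proof (induction I arbitrary: X rule: finite_induct)
  case empty
  then show ?case by simp
next
  case (insert a I)
  define c where "c = X a a"
  have expand: "(\<Sum>i\<in>insert a I. \<Sum>j\<in>insert a I. x i * X i j * x j) =
      c * (x a)\<^sup>2 + 2 * x a * (\<Sum>i\<in>I. X a i * x i) + (\<Sum>i\<in>I. \<Sum>j\<in>I. x i * X i j * x j)" for x
  proof -
    have "(\<Sum>i\<in>I. x i * X i a * x a) = (\<Sum>i\<in>I. x a * (X a i * x i))"
      using insert.prems(1) by (intro sum.cong refl) simp
    then show ?thesis using insert.hyps
      by (simp add: c_def sum.distrib power2_eq_square sum_distrib_left algebra_simps)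
  qed
  have c0: "0 \<le> c"
    using insert.prems(2)[of "\<lambda>i. of_bool (i = a)"] insert.hyps unfolding expand
    by (simp add: sum.neutral)
  have zero: "X a i = 0" if "c = 0" "i \<in> I" for i
  proof (rule ccontr)
    assume nz: "X a i \<noteq> 0"
    \<comment> \<open>The form at \<open>e\<^sub>i + t e\<^sub>a\<close> is \<open>X i i + 2 t X a i\<close>; this \<open>t\<close> makes it \<open>- 1\<close>.\<close>
    define y where "y = (\<lambda>j. if j = a then - (X i i + 1) / (2 * X a i) else of_bool (j = i))"
    have "i \<noteq> a" using that insert.hyps by auto
    have yI: "y j = of_bool (j = i)" if "j \<in> I" for j using that insert.hyps by (auto simp: y_def)
    have "(\<Sum>j\<in>I. X a j * y j) = X a i"
    proof -
      have "(\<Sum>j\<in>I. X a j * y j) = (\<Sum>j\<in>I. if j = i then X a j else 0)"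
        by (intro sum.cong refl) (simp add: yI)
      then show ?thesis using that insert.hyps by (simp add: sum.delta')
    qed
    moreover have "(\<Sum>j\<in>I. \<Sum>l\<in>I. y j * X j l * y l) = X i i"
    proof -
      have "(\<Sum>j\<in>I. \<Sum>l\<in>I. y j * X j l * y l) = (\<Sum>j\<in>I. \<Sum>l\<in>I. if l = i then (if j = i then X j l else 0) else 0)"
        by (intro sum.cong refl) (simp add: yI)
      then show ?thesis using that insert.hyps by (simp add: sum.delta')
    qed
    moreover have "2 * y a * X a i = - (X i i + 1)" using nz by (simp add: y_def field_simps)
    ultimately show False using insert.prems(2)[of y] that unfolding expand by simp
  qed
  define Y where "Y i j = X i j - X a i * X a j / c" for i j
  have "\<exists>(K::nat) b. \<forall>i\<in>I. \<forall>j\<in>I. Y i j = (\<Sum>k<K. b k i * b k j)"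
  proof (rule insert.IH)
    show "\<And>i j. i \<in> I \<Longrightarrow> j \<in> I \<Longrightarrow> Y i j = Y j i" using insert.prems(1) by (simp add: Y_def)
    fix x :: "'a \<Rightarrow> real"
    define S where "S = (\<Sum>i\<in>I. X a i * x i)"
    define x' where "x' = x(a := - S / c)"
    have x'I: "x' i = x i" if "i \<in> I" for i using that insert.hyps by (auto simp: x'_def)
    have SS: "(\<Sum>i\<in>I. \<Sum>j\<in>I. (X a i * x i) * (X a j * x j) / c) = S * S / c"
      unfolding S_def sum_product sum_divide_distrib ..
    have "c = 0 \<Longrightarrow> S = 0" using zero by (simp add: S_def)
    have "0 \<le> c * (x' a)\<^sup>2 + 2 * x' a * (\<Sum>i\<in>I. X a i * x' i) + (\<Sum>i\<in>I. \<Sum>j\<in>I. x' i * X i j * x' j)"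
      using insert.prems(2)[of x'] unfolding expand .
    also have "(\<Sum>i\<in>I. X a i * x' i) = S" by (simp add: S_def x'I)
    also have "(\<Sum>i\<in>I. \<Sum>j\<in>I. x' i * X i j * x' j) = (\<Sum>i\<in>I. \<Sum>j\<in>I. x i * X i j * x j)"
      by (intro sum.cong refl) (simp add: x'I)
    also have "c * (x' a)\<^sup>2 + 2 * x' a * S + (\<Sum>i\<in>I. \<Sum>j\<in>I. x i * X i j * x j) =
        (\<Sum>i\<in>I. \<Sum>j\<in>I. x i * X i j * x j) - S * S / c"
      by (cases "c = 0") (auto simp: x'_def \<open>c = 0 \<Longrightarrow> S = 0\<close> power2_eq_square field_simps)
    also have "\<dots> = (\<Sum>i\<in>I. \<Sum>j\<in>I. x i * Y i j * x j)"
      unfolding SS[symmetric] sum_subtractf[symmetric]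
      by (intro sum.cong refl) (simp add: Y_def algebra_simps)
    finally show "0 \<le> (\<Sum>i\<in>I. \<Sum>j\<in>I. x i * Y i j * x j)" .
  qed
  then obtain K :: nat and b where b: "\<And>i j. i \<in> I \<Longrightarrow> j \<in> I \<Longrightarrow> Y i j = (\<Sum>k<K. b k i * b k j)" by blast
  define b' where "b' k i = (if k = K then X a i / sqrt c else if i = a then 0 else b k i)" for k i
  have last: "b' K i * b' K j = X a i * X a j / c" for i j
    using c0 by (simp add: b'_def)
  have "X i j = (\<Sum>k<Suc K. b' k i * b' k j)" if ij: "i \<in> insert a I" "j \<in> insert a I" for i j
  proof (cases "i = a \<or> j = a")
    case True
    then have "(\<Sum>k<K. b' k i * b' k j) = 0" by (auto simp: b'_def intro!: sum.neutral)
    moreover have "X i j = X a i * X a j / c"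
      using True ij zero insert.prems(1)[of i a] by (cases "c = 0") (auto simp: c_def)
    ultimately show ?thesis using last by simp
  next
    case False
    then have "(\<Sum>k<K. b' k i * b' k j) = Y i j" using ij by (auto simp: b'_def b)
    then show ?thesis using last by (simp add: Y_def)
  qed
  then show ?case by blast
qed

text \<open>
  The quadratic form of \<open>D - w\<close>. After multiplying coordinates by the signs \<open>s\<close> it is the Laplacian of the
  weights \<open>w i j * s i * s j\<close>, which may be negative.
\<close>

definition signed_laplacian_form :: "nat \<Rightarrow> (nat \<Rightarrow> nat \<Rightarrow> real) \<Rightarrow> (nat \<Rightarrow> real) \<Rightarrow> (nat \<Rightarrow> real) \<Rightarrow> real" where
  "signed_laplacian_form N w s x =
     (\<Sum>i<N. (\<Sum>j<N. w i j * s i * s j) * (x i)\<^sup>2) - (\<Sum>i<N. \<Sum>j<N. w i j * x i * x j)"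

text \<open>
  This makes it visible that adding a multiple of \<open>s\<close> to \<open>x\<close> does not change the form.
\<close>

lemma signed_laplacian_form_eq:
  assumes sym: "\<And>i j. i < N \<Longrightarrow> j < N \<Longrightarrow> w i j = w j i" and s: "\<And>i. i < N \<Longrightarrow> s i \<in> {-1, 1}"
  shows "signed_laplacian_form N w s x = (\<Sum>i<N. \<Sum>j<N. w i j * s i * s j * (s i * x i - s j * x j)\<^sup>2) / 2"
proof -
  have "(\<Sum>i<N. \<Sum>j<N. w i j * s i * s j * (s i * x i - s j * x j)\<^sup>2) =
      (\<Sum>i<N. \<Sum>j<N. w i j * s i * s j * (x i)\<^sup>2 + w i j * s i * s j * (x j)\<^sup>2 - 2 * (w i j * x i * x j))"
  proof (intro sum.cong refl)
    fix i j assume "i \<in> {..<N}" "j \<in> {..<N}"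
    then have "s i = -1 \<or> s i = 1" "s j = -1 \<or> s j = 1" using s by auto
    then show "w i j * s i * s j * (s i * x i - s j * x j)\<^sup>2 =
        w i j * s i * s j * (x i)\<^sup>2 + w i j * s i * s j * (x j)\<^sup>2 - 2 * (w i j * x i * x j)"
      by (elim disjE) (simp_all add: power2_eq_square algebra_simps)
  qed
  also have "\<dots> = (\<Sum>i<N. \<Sum>j<N. w i j * s i * s j * (x i)\<^sup>2) + (\<Sum>i<N. \<Sum>j<N. w i j * s i * s j * (x j)\<^sup>2)
      - 2 * (\<Sum>i<N. \<Sum>j<N. w i j * x i * x j)"
    by (simp only: sum.distrib sum_subtractf sum_distrib_left)
  also have "(\<Sum>i<N. \<Sum>j<N. w i j * s i * s j * (x j)\<^sup>2) = (\<Sum>i<N. \<Sum>j<N. w i j * s i * s j * (x i)\<^sup>2)"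
    by (subst sum.swap) (intro sum.cong refl, use sym in \<open>simp add: mult_ac\<close>)
  finally show ?thesis unfolding signed_laplacian_form_def sum_distrib_right by linarith
qed

text \<open>
  Write \<open>X\<close> as a sum of \<open>b\<^sub>k b\<^sub>k\<^sup>T\<close>. The entries of \<open>X\<close> sum to 0, so every \<open>b\<^sub>k\<close> is orthogonal to \<open>1\<close>, and the
  unit diagonal makes the gap between the two objective values the sum of the values of the Laplacian form at
  the \<open>b\<^sub>k\<close>. Each of them is nonnegative, and it is 0 only if \<open>b\<^sub>k\<close> is a multiple of \<open>s\<close>.
\<close>

lemma sdp_dual_certificate:
  fixes X w :: "nat \<Rightarrow> nat \<Rightarrow> real"
  assumes N: "N > 0" and w_sym: "\<And>i j. i < N \<Longrightarrow> j < N \<Longrightarrow> w i j = w j i"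
    and s: "\<And>i. i < N \<Longrightarrow> s i \<in> {-1, 1}" and s0: "(\<Sum>i<N. s i) = 0"
    and gap: "\<And>x. (\<Sum>i<N. x i) = 0 \<Longrightarrow> (\<Sum>i<N. s i * x i) = 0 \<Longrightarrow> \<exists>i<N. x i \<noteq> 0 \<Longrightarrow> 0 < signed_laplacian_form N w s x"
    and X_sym: "\<And>i j. i < N \<Longrightarrow> j < N \<Longrightarrow> X i j = X j i"
    and X_psd: "\<And>x. 0 \<le> (\<Sum>i<N. \<Sum>j<N. x i * X i j * x j)"
    and X_diag: "\<And>i. i < N \<Longrightarrow> X i i = 1" and X_sum: "(\<Sum>i<N. \<Sum>j<N. X i j) = 0"
  shows "(\<Sum>i<N. \<Sum>j<N. w i j * X i j) \<le> (\<Sum>i<N. \<Sum>j<N. w i j * (s i * s j))"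
    and "(\<Sum>i<N. \<Sum>j<N. w i j * X i j) = (\<Sum>i<N. \<Sum>j<N. w i j * (s i * s j)) \<Longrightarrow> i < N \<Longrightarrow> j < N \<Longrightarrow> X i j = s i * s j"
proof -
  let ?q = "signed_laplacian_form N w s"
  have ss: "s i * s i = 1" if "i < N" for i using s[OF that] by auto
  obtain K :: nat and b where b: "\<And>i j. i < N \<Longrightarrow> j < N \<Longrightarrow> X i j = (\<Sum>k<K. b k i * b k j)"
    using psd_kernel_gram[of "{..<N}" X] X_sym X_psd by auto
  have "(\<Sum>i<N. \<Sum>j<N. X i j) = (\<Sum>k<K. (\<Sum>i<N. b k i)\<^sup>2)"
  proof -
    have "(\<Sum>i<N. \<Sum>j<N. X i j) = (\<Sum>i<N. \<Sum>j<N. \<Sum>k<K. b k i * b k j)"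
      by (intro sum.cong refl) (simp add: b)
    also have "\<dots> = (\<Sum>k<K. \<Sum>i<N. \<Sum>j<N. b k i * b k j)"
      by (subst sum.swap[of _ "{..<K}"], subst sum.swap[of _ "{..<K}"]) simp
    finally show ?thesis by (simp add: power2_eq_square sum_product)
  qed
  then have b_sum: "(\<Sum>i<N. b k i) = 0" if "k < K" for k
    using X_sum that by (simp add: sum_nonneg_eq_0_iff)
  \<comment> \<open>\<open>y k\<close> is the component of \<open>b k\<close> orthogonal to \<open>s\<close>.\<close>
  define c where "c k = (\<Sum>i<N. s i * b k i) / N" for k
  define y where "y k i = b k i - c k * s i" for k i
  have q_eq: "?q x = (\<Sum>i<N. \<Sum>j<N. w i j * s i * s j * (s i * x i - s j * x j)\<^sup>2) / 2" for x
    by (rule signed_laplacian_form_eq) (use w_sym s in auto)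
  have q_y: "?q (b k) = ?q (y k)" for k
    unfolding q_eq
  proof (intro arg_cong[where f = "\<lambda>x. x / 2"] sum.cong refl)
    fix i j assume "i \<in> {..<N}" "j \<in> {..<N}"
    then have "s i * y k i - s j * y k j = s i * b k i - s j * b k j"
      using ss by (simp add: y_def right_diff_distrib mult.left_commute)
    then show "w i j * s i * s j * (s i * b k i - s j * b k j)\<^sup>2 = w i j * s i * s j * (s i * y k i - s j * y k j)\<^sup>2"
      by simp
  qed
  have y_orth: "(\<Sum>i<N. y k i) = 0" "(\<Sum>i<N. s i * y k i) = 0" if "k < K" for k
  proof -
    show "(\<Sum>i<N. y k i) = 0"
      using b_sum[OF that] s0 by (simp add: y_def sum_subtractf flip: sum_distrib_left)
    have "(\<Sum>i<N. s i * y k i) = (\<Sum>i<N. s i * b k i - c k)"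
      by (intro sum.cong refl) (simp add: y_def right_diff_distrib mult.left_commute ss)
    then show "(\<Sum>i<N. s i * y k i) = 0" using N by (simp add: sum_subtractf c_def)
  qed
  have q0: "0 \<le> ?q (b k)" if "k < K" for k
  proof (cases "\<exists>i<N. y k i \<noteq> 0")
    case True
    then show ?thesis unfolding q_y using gap[OF y_orth[OF that]] by simp
  next
    case False
    then have "?q (y k) = 0" by (simp add: signed_laplacian_form_def)
    then show ?thesis using q_y by simp
  qed
  have total: "(\<Sum>i<N. \<Sum>j<N. w i j * (s i * s j)) - (\<Sum>i<N. \<Sum>j<N. w i j * X i j) = (\<Sum>k<K. ?q (b k))"
  proof -
    have 1: "(\<Sum>k<K. \<Sum>i<N. (\<Sum>j<N. w i j * s i * s j) * (b k i)\<^sup>2) = (\<Sum>i<N. \<Sum>j<N. w i j * (s i * s j))"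
    proof -
      have "(\<Sum>k<K. \<Sum>i<N. (\<Sum>j<N. w i j * s i * s j) * (b k i)\<^sup>2) = (\<Sum>i<N. (\<Sum>j<N. w i j * s i * s j) * X i i)"
        by (subst sum.swap) (intro sum.cong refl, simp add: b power2_eq_square sum_distrib_left)
      then show ?thesis using X_diag by (simp add: mult.assoc)
    qed
    have 2: "(\<Sum>k<K. \<Sum>i<N. \<Sum>j<N. w i j * b k i * b k j) = (\<Sum>i<N. \<Sum>j<N. w i j * X i j)"
    proof -
      have "(\<Sum>i<N. \<Sum>j<N. w i j * X i j) = (\<Sum>i<N. \<Sum>j<N. \<Sum>k<K. w i j * b k i * b k j)"
        by (intro sum.cong refl) (simp add: b sum_distrib_left mult.assoc)
      also have "\<dots> = (\<Sum>k<K. \<Sum>i<N. \<Sum>j<N. w i j * b k i * b k j)"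
        by (subst sum.swap[of _ "{..<K}"], subst sum.swap[of _ "{..<K}"]) simp
      finally show ?thesis ..
    qed
    show ?thesis unfolding signed_laplacian_form_def sum_subtractf 1 2 ..
  qed
  show "(\<Sum>i<N. \<Sum>j<N. w i j * X i j) \<le> (\<Sum>i<N. \<Sum>j<N. w i j * (s i * s j))"
    using total sum_nonneg[of "{..<K}" "\<lambda>k. ?q (b k)"] q0 by auto
  show "X i j = s i * s j" if eq: "(\<Sum>i<N. \<Sum>j<N. w i j * X i j) = (\<Sum>i<N. \<Sum>j<N. w i j * (s i * s j))"
    and ij: "i < N" "j < N" for i j
  proof -
    have "(\<Sum>k<K. ?q (b k)) = 0" using total eq by simp
    then have "?q (b k) = 0" if "k < K" for k
      using sum_nonneg_eq_0_iff[of "{..<K}" "\<lambda>k. ?q (b k)"] q0 that by auto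
    then have "y k i = 0" if "k < K" "i < N" for k i
      using gap[OF y_orth] that q_y by (metis less_irrefl)
    then have bk: "b k i = c k * s i" if "k < K" "i < N" for k i
      using that by (simp add: y_def)
    have X: "X i j = (\<Sum>k<K. (c k)\<^sup>2) * (s i * s j)" if "i < N" "j < N" for i j
      unfolding b[OF that] sum_distrib_right using that
      by (intro sum.cong refl) (simp add: bk power2_eq_square)
    have "(\<Sum>k<K. (c k)\<^sup>2) = 1" using X[OF N N] X_diag[OF N] ss[OF N] by simp
    then show ?thesis using X[OF ij] by simp
  qed
qed

lemma sum_symmetric_off_diagonal:
  fixes f :: "nat \<Rightarrow> nat \<Rightarrow> real"
  assumes "\<And>i j. i < N \<Longrightarrow> j < N \<Longrightarrow> f i j = f j i" "\<And>i. i < N \<Longrightarrow> f i i = 0"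
  shows "(\<Sum>i<N. \<Sum>j<N. f i j) = 2 * (\<Sum>j<N. \<Sum>i<j. f i j)"
  using assms
proof (induction N)
  case (Suc N)
  have IH: "(\<Sum>i<N. \<Sum>j<N. f i j) = 2 * (\<Sum>j<N. \<Sum>i<j. f i j)" using Suc.prems by (intro Suc.IH) auto
  have "(\<Sum>j<N. f N j) = (\<Sum>j<N. f j N)" using Suc.prems by (intro sum.cong refl) auto
  then show ?case using IH Suc.prems(2)[of N] by (simp add: sum.distrib)
qed simp

lemma quadratic_form_mat:
  fixes X :: "real mat"
  assumes "X \<in> carrier_mat N N" "x \<in> carrier_vec N"
  shows "x \<bullet> (X *\<^sub>v x) = (\<Sum>i<N. \<Sum>j<N. x $ i * X $$ (i, j) * x $ j)"
  using assms by (simp add: scalar_prod_def atLeast0LessThan sum_distrib_left mult.assoc)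

lemma communitiesD:
  assumes "\<sigma> \<in> communities N"
  shows "\<sigma> \<in> carrier_vec N" "i < N \<Longrightarrow> \<sigma> $ i \<in> {-1, 1}" "(\<Sum>i<N. \<sigma> $ i) = 0"
proof -
  show c: "\<sigma> \<in> carrier_vec N" and s: "i < N \<Longrightarrow> \<sigma> $ i \<in> {-1, 1}" for i
    using assms by (auto simp: communities_def)
  have "(\<Sum>i<N. \<sigma> $ i) = (\<Sum>i<N. of_bool (\<sigma> $ i = 1) - of_bool (\<sigma> $ i = -1))"
    using s by (intro sum.cong refl) fastforce
  also have "\<dots> = 0" using assms by (simp add: communities_def sum_subtractf lessThan_def Collect_conj_eq)
  finally show "(\<Sum>i<N. \<sigma> $ i) = 0" .
qed

definition rank_one_mat :: "nat \<Rightarrow> real vec \<Rightarrow> real mat" where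
  "rank_one_mat N \<sigma> = mat N N (\<lambda>(i, j). \<sigma> $ i * \<sigma> $ j)"

lemma rank_one_feasible:
  assumes "\<sigma> \<in> communities N"
  shows "rank_one_mat N \<sigma> \<in> sdp_feasible N"
proof -
  note \<sigma> = communitiesD[OF assms]
  have c: "rank_one_mat N \<sigma> \<in> carrier_mat N N" by (simp add: rank_one_mat_def)
  have "(\<Sum>i<N. \<Sum>j<N. rank_one_mat N \<sigma> $$ (i, j)) = (\<Sum>i<N. \<sigma> $ i) * (\<Sum>i<N. \<sigma> $ i)"
    by (simp add: rank_one_mat_def sum_product)
  moreover have "pos_semidef N (rank_one_mat N \<sigma>)"
    unfolding pos_semidef_def
  proof
    fix x :: "real vec" assume "x \<in> carrier_vec N"
    then have "x \<bullet> (rank_one_mat N \<sigma> *\<^sub>v x) = (\<Sum>i<N. \<Sum>j<N. (x $ i * \<sigma> $ i) * (x $ j * \<sigma> $ j))"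
      unfolding quadratic_form_mat[OF c \<open>x \<in> _\<close>] by (simp add: rank_one_mat_def mult_ac)
    also have "\<dots> = (\<Sum>i<N. x $ i * \<sigma> $ i) * (\<Sum>i<N. x $ i * \<sigma> $ i)" by (simp add: sum_product)
    finally show "0 \<le> x \<bullet> (rank_one_mat N \<sigma> *\<^sub>v x)" by simp
  qed
  moreover have "rank_one_mat N \<sigma> $$ (i, i) = 1" if "i < N" for i
    using \<sigma>(2)[OF that] that by (auto simp: rank_one_mat_def)
  moreover have "transpose_mat (rank_one_mat N \<sigma>) = rank_one_mat N \<sigma>"
    by (rule eq_matI) (auto simp: rank_one_mat_def)
  ultimately show ?thesis using c \<sigma>(3) by (simp add: sdp_feasible_def)
qed

lemma sdp_optimal_iff_rank_one:
  assumes N: "N > 0" and \<sigma>: "\<sigma> \<in> communities N"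
    and W_sym: "\<And>i j. i < N \<Longrightarrow> j < N \<Longrightarrow> W $$ (i, j) = W $$ (j, i)" and W_diag: "\<And>i. i < N \<Longrightarrow> W $$ (i, i) = 0"
    and gap: "\<And>x. (\<Sum>i<N. x i) = 0 \<Longrightarrow> (\<Sum>i<N. \<sigma> $ i * x i) = 0 \<Longrightarrow> \<exists>i<N. x i \<noteq> 0 \<Longrightarrow>
      0 < signed_laplacian_form N (\<lambda>i j. s * W $$ (i, j)) (\<lambda>i. \<sigma> $ i) x"
  shows "sdp_optimal N W s X \<longleftrightarrow> X = rank_one_mat N \<sigma>"
proof -
  note \<sigma>' = communitiesD[OF \<sigma>]
  let ?X0 = "rank_one_mat N \<sigma>" and ?w = "\<lambda>i j. s * W $$ (i, j)"
  have obj: "2 * sdp_objective N W s X = (\<Sum>i<N. \<Sum>j<N. ?w i j * X $$ (i, j))" if "X \<in> sdp_feasible N" for X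
  proof -
    have "X $$ (i, j) = X $$ (j, i)" if "i < N" "j < N" for i j
      using \<open>X \<in> _\<close> that index_transpose_mat(1)[of i X j] by (auto simp: sdp_feasible_def)
    then show ?thesis unfolding sdp_objective_def
      using W_sym W_diag by (subst sum_symmetric_off_diagonal) auto
  qed
  have obj0: "(\<Sum>i<N. \<Sum>j<N. ?w i j * ?X0 $$ (i, j)) = (\<Sum>i<N. \<Sum>j<N. ?w i j * (\<sigma> $ i * \<sigma> $ j))"
    by (simp add: rank_one_mat_def)
  have cert: "sdp_objective N W s X \<le> sdp_objective N W s ?X0"
    "sdp_objective N W s X = sdp_objective N W s ?X0 \<Longrightarrow> X = ?X0" if X: "X \<in> sdp_feasible N" for X
  proof -
    have X': "X \<in> carrier_mat N N" "transpose_mat X = X" "(\<Sum>i<N. \<Sum>j<N. X $$ (i, j)) = 0"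
      "\<And>i. i < N \<Longrightarrow> X $$ (i, i) = 1" "pos_semidef N X"
      using X by (auto simp: sdp_feasible_def)
    have X_sym: "X $$ (i, j) = X $$ (j, i)" if "i < N" "j < N" for i j
      using X'(1,2) that index_transpose_mat(1)[of i X j] by auto
    have X_psd: "0 \<le> (\<Sum>i<N. \<Sum>j<N. x i * X $$ (i, j) * x j)" for x
    proof -
      have "0 \<le> vec N x \<bullet> (X *\<^sub>v vec N x)" using X'(5) by (simp add: pos_semidef_def)
      then show ?thesis by (subst (asm) quadratic_form_mat[OF X'(1)]) simp_all
    qed
    have w_sym: "?w i j = ?w j i" if "i < N" "j < N" for i j using W_sym that by simp
    have c1: "(\<Sum>i<N. \<Sum>j<N. ?w i j * X $$ (i, j)) \<le> (\<Sum>i<N. \<Sum>j<N. ?w i j * (\<sigma> $ i * \<sigma> $ j))"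
      by (rule sdp_dual_certificate(1)[where w = ?w and s = "\<lambda>i. \<sigma> $ i" and X = "\<lambda>i j. X $$ (i, j)" and N = N])
        ((rule N w_sym \<sigma>'(2) \<sigma>'(3) gap X_sym X_psd X'(3) X'(4); assumption)+)
    have c2: "X $$ (i, j) = \<sigma> $ i * \<sigma> $ j"
      if eq: "(\<Sum>i<N. \<Sum>j<N. ?w i j * X $$ (i, j)) = (\<Sum>i<N. \<Sum>j<N. ?w i j * (\<sigma> $ i * \<sigma> $ j))"
        and ij: "i < N" "j < N" for i j
      by (rule sdp_dual_certificate(2)[where w = ?w and s = "\<lambda>i. \<sigma> $ i" and X = "\<lambda>i j. X $$ (i, j)" and N = N])
        ((rule N w_sym \<sigma>'(2) \<sigma>'(3) gap X_sym X_psd X'(3) X'(4) eq ij; assumption)+)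
    show "sdp_objective N W s X \<le> sdp_objective N W s ?X0"
      using c1 obj[OF X] obj[OF rank_one_feasible[OF \<sigma>]] obj0 by simp
    assume "sdp_objective N W s X = sdp_objective N W s ?X0"
    then have "(\<Sum>i<N. \<Sum>j<N. ?w i j * X $$ (i, j)) = (\<Sum>i<N. \<Sum>j<N. ?w i j * (\<sigma> $ i * \<sigma> $ j))"
      using obj[OF X] obj[OF rank_one_feasible[OF \<sigma>]] obj0 by simp
    then show "X = ?X0"
      using c2 X'(1) by (intro eq_matI) (auto simp: rank_one_mat_def)
  qed
  show ?thesis
  proof
    assume "sdp_optimal N W s X"
    then have X: "X \<in> sdp_feasible N" "sdp_objective N W s ?X0 \<le> sdp_objective N W s X"
      using rank_one_feasible[OF \<sigma>] by (auto simp: sdp_optimal_def)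
    then show "X = ?X0" using cert[OF X(1)] by simp
  next
    assume "X = ?X0"
    then show "sdp_optimal N W s X" using cert(1) rank_one_feasible[OF \<sigma>] by (simp add: sdp_optimal_def)
  qed
qed

lemma sgn_at_mult:
  assumes "a \<in> {-1, 1}" "t \<noteq> 0"
  shows "sgn_at c (a * t) = a * sgn t"
  using assms by (auto simp: sgn_at_def sgn_if)

text \<open>
  The eigenvalues sum to the trace \<open>N\<close>, so the leading one is positive. Its eigenvector lies in the range of
  \<open>\<sigma> \<sigma>\<^sup>T\<close> and is thus a nonzero multiple of \<open>\<sigma>\<close>; in particular it has no zero entries.
\<close>

lemma eigendecomposition_rank_one_sign:
  assumes N: "N > 0" and \<sigma>: "\<sigma> \<in> communities N" and ed: "eigendecomposition N (rank_one_mat N \<sigma>) \<mu> v"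
  shows "map_vec (sgn_at c) (v 0) \<in> {\<sigma>, - \<sigma>}"
proof -
  note \<sigma>' = communitiesD[OF \<sigma>]
  have v: "v k \<in> carrier_vec N" if "k < N" for k using ed that by (simp add: eigendecomposition_def)
  have orth: "(\<Sum>i<N. v k $ i * v l $ i) = of_bool (k = l)" if "k < N" "l < N" for k l
  proof -
    have "v k \<bullet> v l = of_bool (k = l)" using ed that by (simp add: eigendecomposition_def)
    then show ?thesis using v[OF that(2)] by (simp add: scalar_prod_def atLeast0LessThan)
  qed
  have dec: "\<mu> k \<le> \<mu> 0" if "k < N" for k using ed that by (simp add: eigendecomposition_def)
  have X: "\<sigma> $ i * \<sigma> $ j = (\<Sum>k<N. \<mu> k * v k $ i * v k $ j)" if "i < N" "j < N" for i j
  proof -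
    have "rank_one_mat N \<sigma> $$ (i, j) = mat N N (\<lambda>(i, j). \<Sum>k<N. \<mu> k * v k $ i * v k $ j) $$ (i, j)"
      using ed by (simp add: eigendecomposition_def)
    then show ?thesis using that by (simp add: rank_one_mat_def)
  qed
  have "real N = (\<Sum>i<N. \<sigma> $ i * \<sigma> $ i)"
  proof -
    have "(\<Sum>i<N. \<sigma> $ i * \<sigma> $ i) = (\<Sum>i<N. 1)" using \<sigma>'(2) by (intro sum.cong refl) fastforce
    then show ?thesis by simp
  qed
  also have "\<dots> = (\<Sum>i<N. \<Sum>k<N. \<mu> k * v k $ i * v k $ i)" by (intro sum.cong refl) (simp add: X)
  also have "\<dots> = (\<Sum>k<N. \<mu> k * (\<Sum>i<N. v k $ i * v k $ i))"
    by (subst sum.swap) (simp add: sum_distrib_left mult.assoc)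
  also have "\<dots> = (\<Sum>k<N. \<mu> k)" by (simp add: orth)
  also have "\<dots> \<le> (\<Sum>k<N. \<mu> 0)" by (intro sum_mono dec) auto
  finally have \<mu>0: "0 < \<mu> 0" using N by simp
  define t where "t = (\<Sum>j<N. \<sigma> $ j * v 0 $ j) / \<mu> 0"
  have v0: "v 0 $ i = \<sigma> $ i * t" if i: "i < N" for i
  proof -
    have "\<sigma> $ i * (\<Sum>j<N. \<sigma> $ j * v 0 $ j) = (\<Sum>j<N. (\<sigma> $ i * \<sigma> $ j) * v 0 $ j)"
      by (simp add: sum_distrib_left mult.assoc)
    also have "\<dots> = (\<Sum>j<N. \<Sum>k<N. \<mu> k * v k $ i * (v k $ j * v 0 $ j))"
      using i by (intro sum.cong refl) (simp add: X sum_distrib_right mult.assoc)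
    also have "\<dots> = (\<Sum>k<N. \<mu> k * v k $ i * (\<Sum>j<N. v k $ j * v 0 $ j))"
      by (subst sum.swap) (simp add: sum_distrib_left)
    also have "\<dots> = (\<Sum>k<N. if k = 0 then \<mu> k * v k $ i else 0)"
      using N by (intro sum.cong refl) (simp add: orth)
    also have "\<dots> = \<mu> 0 * v 0 $ i" using N by simp
    finally show ?thesis using \<mu>0 by (simp add: t_def field_simps)
  qed
  have "t \<noteq> 0"
  proof
    assume "t = 0"
    then have "(\<Sum>i<N. v 0 $ i * v 0 $ i) = 0" using v0 by simp
    then show False using orth[OF N N] by simp
  qed
  then have sg: "sgn_at c (v 0 $ i) = \<sigma> $ i * sgn t" if "i < N" for i
    using sgn_at_mult \<sigma>'(2)[OF that] v0[OF that] by simp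
  have dims: "dim_vec \<sigma> = N" "dim_vec (v 0) = N" using \<sigma>'(1) v[OF N] by auto
  show ?thesis
  proof (cases "t > 0")
    case True
    then have "map_vec (sgn_at c) (v 0) = \<sigma>" using sg dims by (intro eq_vecI) auto
    then show ?thesis by simp
  next
    case False
    then have "map_vec (sgn_at c) (v 0) = - \<sigma>" using sg dims \<open>t \<noteq> 0\<close> by (intro eq_vecI) auto
    then show ?thesis by simp
  qed
qed

text \<open>
  The eigenbasis consists of the columns of the Householder reflection that maps the first unit vector to
  \<open>\<sigma> / sqrt N\<close>. Its normalisation \<open>- 2 / \<parallel>u\<parallel>\<^sup>2\<close> equals \<open>1 / u 0\<close>, which is finite because \<open>N \<ge> 2\<close> separates
  the two vectors.
\<close>

lemma exists_eigendecomposition_rank_one: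
  assumes N: "N \<ge> 2" and \<sigma>: "\<sigma> \<in> communities N"
  shows "\<exists>\<mu> v. eigendecomposition N (rank_one_mat N \<sigma>) \<mu> v"
proof -
  note \<sigma>' = communitiesD[OF \<sigma>]
  define u where "u i = \<sigma> $ i / sqrt N - of_bool (i = 0)" for i
  define v where "v k = vec N (\<lambda>i. of_bool (i = k) + u k * u i / u 0)" for k
  define \<mu> where "\<mu> k = (if k = 0 then real N else 0)" for k :: nat
  have sqN: "sqrt N > 1" using N by simp
  have u0: "u 0 < 0"
  proof -
    have "\<sigma> $ 0 \<le> 1" using \<sigma>'(2)[of 0] N by auto
    then have "\<sigma> $ 0 / sqrt N \<le> 1 / sqrt N" using sqN by (intro divide_right_mono) auto
    moreover have "1 / sqrt N < 1" using sqN by simp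
    ultimately show ?thesis by (simp add: u_def)
  qed
  have uu: "(\<Sum>i<N. u i * u i) = - 2 * u 0"
  proof -
    have "(\<Sum>i<N. u i * u i) = (\<Sum>i<N. 1 / N + (if i = 0 then 1 - 2 * (\<sigma> $ i / sqrt N) else 0))"
    proof (intro sum.cong refl)
      fix i assume "i \<in> {..<N}"
      then have "\<sigma> $ i * \<sigma> $ i = 1" using \<sigma>'(2)[of i] by auto
      then have "(\<sigma> $ i / sqrt N) * (\<sigma> $ i / sqrt N) = 1 / N" by simp
      then show "u i * u i = 1 / N + (if i = 0 then 1 - 2 * (\<sigma> $ i / sqrt N) else 0)"
        unfolding u_def by (cases "i = 0") (simp_all add: algebra_simps)
    qed
    also have "\<dots> = - 2 * u 0" using N by (simp add: sum.distrib u_def)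
    finally show ?thesis .
  qed
  have orth: "v k \<bullet> v l = (if k = l then 1 else 0)" if kl: "k < N" "l < N" for k l
  proof -
    have "v k \<bullet> v l = (\<Sum>i<N. (of_bool (i = k) + u k * u i / u 0) * (of_bool (i = l) + u l * u i / u 0))"
      by (simp add: v_def scalar_prod_def atLeast0LessThan)
    also have "\<dots> = (\<Sum>i<N. (if i = k then of_bool (k = l) else 0) + (if i = k then u l * u i / u 0 else 0) +
        (if i = l then u k * u i / u 0 else 0) + (u k * u l / (u 0 * u 0)) * (u i * u i))"
      by (intro sum.cong refl) (simp add: distrib_left distrib_right add_divide_distrib mult_ac)
    also have "\<dots> = of_bool (k = l) + u l * u k / u 0 + u k * u l / u 0 + (u k * u l / (u 0 * u 0)) * (- 2 * u 0)"
      unfolding sum.distrib sum_distrib_left[symmetric] uu using kl by simp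
    also have "\<dots> = of_bool (k = l)" using u0 by (simp add: divide_simps)
    finally show ?thesis by simp
  qed
  have v0: "v 0 $ i = \<sigma> $ i / sqrt N" if "i < N" for i
    using that u0 by (simp add: v_def) (simp add: u_def)
  have "eigendecomposition N (rank_one_mat N \<sigma>) \<mu> v"
    unfolding eigendecomposition_def
  proof (intro conjI allI impI)
    show "rank_one_mat N \<sigma> = mat N N (\<lambda>(i, j). \<Sum>k<N. \<mu> k * v k $ i * v k $ j)"
    proof (rule eq_matI)
      fix i j assume "i < dim_row (mat N N (\<lambda>(i, j). \<Sum>k<N. \<mu> k * v k $ i * v k $ j))"
        "j < dim_col (mat N N (\<lambda>(i, j). \<Sum>k<N. \<mu> k * v k $ i * v k $ j))"
      then have ij: "i < N" "j < N" by auto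
      have "(\<Sum>k<N. \<mu> k * v k $ i * v k $ j) = (\<Sum>k<N. if k = 0 then N * v k $ i * v k $ j else 0)"
        by (intro sum.cong refl) (simp add: \<mu>_def)
      also have "\<dots> = N * (\<sigma> $ i / sqrt N) * (\<sigma> $ j / sqrt N)" using ij N by (simp add: v0)
      also have "\<dots> = \<sigma> $ i * \<sigma> $ j" using N by (simp add: field_simps)
      finally show "rank_one_mat N \<sigma> $$ (i, j) = mat N N (\<lambda>(i, j). \<Sum>k<N. \<mu> k * v k $ i * v k $ j) $$ (i, j)"
        using ij by (simp add: rank_one_mat_def)
    qed (simp_all add: rank_one_mat_def)
    show "v k \<bullet> v l = (if k = l then 1 else 0)" if "k < N" "l < N" for k l
      using that by (rule orth)
  qed (auto simp: v_def \<mu>_def)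
  then show ?thesis by blast
qed

theorem sdp_outputs_of_spectral_gap:
  assumes N: "N \<ge> 2" and \<sigma>: "\<sigma> \<in> communities N"
    and W_sym: "\<And>i j. i < N \<Longrightarrow> j < N \<Longrightarrow> W $$ (i, j) = W $$ (j, i)" and W_diag: "\<And>i. i < N \<Longrightarrow> W $$ (i, i) = 0"
    and gap: "\<And>x. (\<Sum>i<N. x i) = 0 \<Longrightarrow> (\<Sum>i<N. \<sigma> $ i * x i) = 0 \<Longrightarrow> \<exists>i<N. x i \<noteq> 0 \<Longrightarrow>
      0 < signed_laplacian_form N (\<lambda>i j. s * W $$ (i, j)) (\<lambda>i. \<sigma> $ i) x"
  shows "sdp_outputs c N W s \<noteq> {} \<and> sdp_outputs c N W s \<subseteq> {\<sigma>, - \<sigma>}"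
proof -
  have N0: "N > 0" using N by simp
  have "sdp_optimal N W s X \<longleftrightarrow> X = rank_one_mat N \<sigma>" for X
    by (rule sdp_optimal_iff_rank_one) ((rule N0 \<sigma> W_sym W_diag gap; assumption)+)
  then have "sdp_outputs c N W s = {map_vec (sgn_at c) (v 0) | \<mu> v. eigendecomposition N (rank_one_mat N \<sigma>) \<mu> v}"
    by (simp add: sdp_outputs_def)
  then show ?thesis
    using exists_eigendecomposition_rank_one[OF N \<sigma>] eigendecomposition_rank_one_sign[OF _ \<sigma>] N by auto
qed

section \<open>The block model as a random hypergraph\<close>

definition edge_set :: "nat \<Rightarrow> nat \<Rightarrow> (nat \<Rightarrow> nat) \<Rightarrow> (nat \<times> nat set) set" where
  "edge_set N M d = (SIGMA m:{1..M}. hyperedges N (d m))"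

definition presence_prob ::
  "nat \<Rightarrow> (nat \<Rightarrow> nat) \<Rightarrow> (nat \<Rightarrow> nat \<times> nat \<Rightarrow> real) \<Rightarrow> real vec \<Rightarrow> nat \<times> nat set \<Rightarrow> real" where
  "presence_prob N d \<alpha> \<sigma> = (\<lambda>(m, e). edge_prob N d \<alpha> m (profile \<sigma> e))"

definition opposite :: "nat \<Rightarrow> real vec \<Rightarrow> nat \<Rightarrow> nat set" where
  "opposite N \<sigma> i = {j. j < N \<and> \<sigma> $ j \<noteq> \<sigma> $ i}"

lemma finite_hyperedges: "finite (hyperedges N k)"
  by (auto simp: hyperedges_def)

lemma finite_edge_set: "finite (edge_set N M d)"
  by (auto simp: edge_set_def finite_hyperedges)

lemma sum_edge_set_filter:
  fixes f :: "nat \<times> nat set \<Rightarrow> real"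
  shows "(\<Sum>e\<in>{e \<in> edge_set N M d. S \<subseteq> snd e}. f e) = (\<Sum>m=1..M. \<Sum>e\<in>{e \<in> hyperedges N (d m). S \<subseteq> e}. f (m, e))"
proof -
  have "{e \<in> edge_set N M d. S \<subseteq> snd e} = (SIGMA m:{1..M}. {e \<in> hyperedges N (d m). S \<subseteq> e})"
    by (auto simp: edge_set_def)
  then show ?thesis by (simp add: sum.Sigma finite_hyperedges)
qed

lemma sum_edge_set_of_bool:
  fixes f :: "nat \<times> nat set \<Rightarrow> real"
  assumes "\<And>e. e \<in> edge_set N M d \<Longrightarrow> \<not> S \<subseteq> snd e \<Longrightarrow> f e = 0"
  shows "(\<Sum>e\<in>edge_set N M d. f e) = (\<Sum>m=1..M. \<Sum>e\<in>{e \<in> hyperedges N (d m). S \<subseteq> e}. f (m, e))"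
  unfolding sum_edge_set_filter[symmetric]
  by (rule sum.mono_neutral_right) (use assms finite_edge_set in auto)

lemma card_opposite:
  assumes "\<sigma> \<in> communities N" "i < N"
  shows "card (opposite N \<sigma> i) = N div 2" "card ({..<N} - opposite N \<sigma> i) = N div 2"
proof -
  have s: "\<sigma> $ j = -1 \<or> \<sigma> $ j = 1" if "j < N" for j using communitiesD(2)[OF assms(1) that] by auto
  have c: "card {j. j < N \<and> \<sigma> $ j = 1} = N div 2" "card {j. j < N \<and> \<sigma> $ j = -1} = N div 2"
    using assms by (auto simp: communities_def)
  have "opposite N \<sigma> i = (if \<sigma> $ i = 1 then {j. j < N \<and> \<sigma> $ j = -1} else {j. j < N \<and> \<sigma> $ j = 1})"
    using s[OF assms(2)] by (auto simp: opposite_def dest: s)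
  then show "card (opposite N \<sigma> i) = N div 2" using c by simp
  have "{..<N} - opposite N \<sigma> i = (if \<sigma> $ i = 1 then {j. j < N \<and> \<sigma> $ j = 1} else {j. j < N \<and> \<sigma> $ j = -1})"
    using s[OF assms(2)] by (auto simp: opposite_def dest: s)
  then show "card ({..<N} - opposite N \<sigma> i) = N div 2" using c by simp
qed

lemma finite_opposite: "finite (opposite N \<sigma> i)" by (simp add: opposite_def)

lemma hyperedge_card_opposite:
  assumes "e \<in> hyperedges N k"
  shows "card (e \<inter> opposite N \<sigma> i) \<le> k" "card (e - opposite N \<sigma> i) = k - card (e \<inter> opposite N \<sigma> i)"
proof -
  have "finite e" "card e = k" using assms by (auto simp: hyperedges_def intro: finite_subset)
  then show "card (e \<inter> opposite N \<sigma> i) \<le> k" "card (e - opposite N \<sigma> i) = k - card (e \<inter> opposite N \<sigma> i)"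
    by (auto intro: card_mono card_Diff_subset_Int[THEN trans] simp: finite_opposite)
qed

locale symmetric_rates =
  fixes M :: nat and d :: "nat \<Rightarrow> nat" and \<alpha> :: "nat \<Rightarrow> nat \<times> nat \<Rightarrow> real"
  assumes d_ge: "\<And>m. m \<in> {1..M} \<Longrightarrow> d m \<ge> 2"
    and \<alpha>_sym: "\<And>m r. m \<in> {1..M} \<Longrightarrow> r \<le> d m \<Longrightarrow> \<alpha> m (r, d m - r) = \<alpha> m (d m - r, r)"
    and \<alpha>_pos: "\<And>m r. m \<in> {1..M} \<Longrightarrow> r \<le> d m \<Longrightarrow> \<alpha> m (r, d m - r) > 0"
begin

definition dmax where "dmax = (\<Sum>m=1..M. d m)"
definition \<alpha>max where "\<alpha>max = (\<Sum>m=1..M. \<Sum>r\<le>d m. \<alpha> m (r, d m - r))"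
definition degree_const where "degree_const = real M * \<alpha>max * (1 + 2 * real dmax)"

lemma d_le_dmax: "m \<in> {1..M} \<Longrightarrow> d m \<le> dmax"
  unfolding dmax_def by (rule member_le_sum) auto

lemma \<alpha>_le_max: "m \<in> {1..M} \<Longrightarrow> r \<le> d m \<Longrightarrow> \<alpha> m (r, d m - r) \<le> \<alpha>max"
proof -
  assume m: "m \<in> {1..M}" and r: "r \<le> d m"
  have nn: "0 \<le> \<alpha> m (r, d m - r)" if "m \<in> {1..M}" "r \<le> d m" for m r
    using \<alpha>_pos[OF that] by simp
  have "\<alpha> m (r, d m - r) \<le> (\<Sum>r\<le>d m. \<alpha> m (r, d m - r))"
    using r nn m by (intro member_le_sum[where f = "\<lambda>r. \<alpha> m (r, d m - r)"]) auto
  also have "\<dots> \<le> \<alpha>max" unfolding \<alpha>max_def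
    using m nn by (intro member_le_sum[where f = "\<lambda>m. \<Sum>r\<le>d m. \<alpha> m (r, d m - r)"]) (auto intro!: sum_nonneg)
  finally show ?thesis .
qed

lemma \<alpha>max_nonneg: "0 \<le> \<alpha>max"
  unfolding \<alpha>max_def using \<alpha>_pos by (intro sum_nonneg) (auto intro: less_imp_le)

text \<open>
  By symmetry of the rates, the presence probability of a hyperedge depends only on how many of its members
  are opposite to any one member \<open>i\<close>. This removes the case distinction on the sign of \<open>i\<close> from all later
  sums.
\<close>

lemma edge_prob_profile:
  assumes \<sigma>: "\<sigma> \<in> communities N" and m: "m \<in> {1..M}" and e: "e \<in> hyperedges N (d m)" and i: "i \<in> e"
  shows "edge_prob N d \<alpha> m (profile \<sigma> e) =
    edge_prob N d \<alpha> m (card (e \<inter> opposite N \<sigma> i), d m - card (e \<inter> opposite N \<sigma> i))"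
proof -
  let ?r = "card (e \<inter> opposite N \<sigma> i)"
  have eN: "e \<subseteq> {..<N}" using e by (auto simp: hyperedges_def)
  have s: "\<sigma> $ j = -1 \<or> \<sigma> $ j = 1" if "j \<in> e" for j using communitiesD(2)[OF \<sigma>, of j] that eN by auto
  note c = hyperedge_card_opposite[OF e, of \<sigma> i]
  show ?thesis
  proof (cases "\<sigma> $ i = 1")
    case True
    then have "{j \<in> e. \<sigma> $ j = -1} = e \<inter> opposite N \<sigma> i" "{j \<in> e. \<sigma> $ j = 1} = e - opposite N \<sigma> i"
      using s eN unfolding opposite_def by force+
    then show ?thesis using c by (simp add: profile_def)
  next
    case False
    then have "{j \<in> e. \<sigma> $ j = 1} = e \<inter> opposite N \<sigma> i" "{j \<in> e. \<sigma> $ j = -1} = e - opposite N \<sigma> i"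
      using s[OF i] s eN unfolding opposite_def by force+
    then show ?thesis using c \<alpha>_sym[OF m c(1)] by (simp add: profile_def edge_prob_def)
  qed
qed

lemma edge_prob_bounds:
  assumes \<sigma>: "\<sigma> \<in> communities N" and N: "N \<ge> 1" and m: "m \<in> {1..M}" and e: "e \<in> hyperedges N (d m)"
  shows "0 \<le> edge_prob N d \<alpha> m (profile \<sigma> e)" "edge_prob N d \<alpha> m (profile \<sigma> e) \<le> 1"
    "edge_prob N d \<alpha> m (profile \<sigma> e) \<le> \<alpha>max * ln N / ((N - 1) choose (d m - 1))"
proof -
  have "card e \<ge> 2" using e d_ge[OF m] by (simp add: hyperedges_def)
  then obtain i where i: "i \<in> e" by fastforce
  define r where "r = card (e \<inter> opposite N \<sigma> i)"
  have r: "r \<le> d m" unfolding r_def by (rule hyperedge_card_opposite[OF e])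
  have eq: "edge_prob N d \<alpha> m (profile \<sigma> e) = edge_prob N d \<alpha> m (r, d m - r)"
    unfolding r_def by (rule edge_prob_profile[OF \<sigma> m e i])
  have L: "0 \<le> ln (real N)" using N by simp
  have \<alpha>: "0 < \<alpha> m (r, d m - r)" "\<alpha> m (r, d m - r) \<le> \<alpha>max" using \<alpha>_pos \<alpha>_le_max m r by auto
  show "0 \<le> edge_prob N d \<alpha> m (profile \<sigma> e)" "edge_prob N d \<alpha> m (profile \<sigma> e) \<le> 1"
    unfolding eq using \<alpha> L by (auto simp: edge_prob_def)
  have "edge_prob N d \<alpha> m (r, d m - r) \<le> \<alpha> m (r, d m - r) * ln N / ((N - 1) choose (d m - 1))"
    unfolding edge_prob_def by simp
  also have "\<dots> \<le> \<alpha>max * ln N / ((N - 1) choose (d m - 1))"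
    using \<alpha> L by (intro divide_right_mono mult_right_mono) auto
  finally show "edge_prob N d \<alpha> m (profile \<sigma> e) \<le> \<alpha>max * ln N / ((N - 1) choose (d m - 1))"
    unfolding eq .
qed

text \<open>
  The normalisation of the edge probabilities is the number of possible hyperedges at a vertex, so the degrees
  are \<open>O(ln N)\<close>; the share of those that contain a second given vertex is \<open>(d - 1) / (N - 1)\<close>.
\<close>

lemma hsbm_random_hypergraph:
  assumes \<sigma>: "\<sigma> \<in> communities N" and N: "N \<ge> 2"
  shows "random_hypergraph N (edge_set N M d) snd (presence_prob N d \<alpha> \<sigma>) dmax degree_const"
proof
  have L: "0 \<le> ln (real N)" using N by simp
  have le_sum: "(\<Sum>e\<in>{e \<in> edge_set N M d. S \<subseteq> snd e}. presence_prob N d \<alpha> \<sigma> e) \<le>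
      (\<Sum>m=1..M. real ((N - card S) choose (d m - card S)) * (\<alpha>max * ln N / ((N - 1) choose (d m - 1))))"
    if S: "S \<subseteq> {..<N}" "card S \<le> 2" for S
    unfolding sum_edge_set_filter
  proof (intro sum_mono)
    fix m assume m: "m \<in> {1..M}"
    have "(\<Sum>e\<in>{e \<in> hyperedges N (d m). S \<subseteq> e}. presence_prob N d \<alpha> \<sigma> (m, e)) \<le>
        (\<Sum>e\<in>{e \<in> hyperedges N (d m). S \<subseteq> e}. \<alpha>max * ln N / ((N - 1) choose (d m - 1)))"
      using edge_prob_bounds(3)[OF \<sigma> _ m] N by (intro sum_mono) (auto simp: presence_prob_def)
    also have "\<dots> = real (card {e \<in> hyperedges N (d m). S \<subseteq> e}) * (\<alpha>max * ln N / ((N - 1) choose (d m - 1)))"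
      by simp
    also have "card {e \<in> hyperedges N (d m). S \<subseteq> e} = (N - card S) choose (d m - card S)"
      using S d_ge[OF m] by (intro card_hyperedges_containing) auto
    finally show "(\<Sum>e\<in>{e \<in> hyperedges N (d m). S \<subseteq> e}. presence_prob N d \<alpha> \<sigma> (m, e)) \<le>
        real ((N - card S) choose (d m - card S)) * (\<alpha>max * ln N / ((N - 1) choose (d m - 1)))" .
  qed
  show "1 \<le> N" using N by simp
  show "finite (edge_set N M d)" by (rule finite_edge_set)
  show "0 \<le> presence_prob N d \<alpha> \<sigma> e \<and> presence_prob N d \<alpha> \<sigma> e \<le> 1" if "e \<in> edge_set N M d" for e
    using edge_prob_bounds(1,2)[OF \<sigma>] N that by (auto simp: edge_set_def presence_prob_def)
  show "snd e \<subseteq> {..<N}" if "e \<in> edge_set N M d" for e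
    using that by (auto simp: edge_set_def hyperedges_def)
  show "card (snd e) \<le> dmax" if "e \<in> edge_set N M d" for e
    using that d_le_dmax by (auto simp: edge_set_def hyperedges_def)
  show "0 \<le> degree_const" using \<alpha>max_nonneg by (simp add: degree_const_def)
  show "(\<Sum>e\<in>{e \<in> edge_set N M d. i \<in> snd e}. presence_prob N d \<alpha> \<sigma> e) \<le> degree_const * ln N" if i: "i < N" for i
  proof -
    have "(\<Sum>e\<in>{e \<in> edge_set N M d. {i} \<subseteq> snd e}. presence_prob N d \<alpha> \<sigma> e) \<le>
        (\<Sum>m=1..M. real ((N - card {i}) choose (d m - card {i})) * (\<alpha>max * ln N / ((N - 1) choose (d m - 1))))"
      using i by (intro le_sum) auto
    also have "\<dots> \<le> (\<Sum>m=1..M. \<alpha>max * ln N)"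
      using \<alpha>max_nonneg L by (intro sum_mono) simp
    also have "\<dots> = real M * \<alpha>max * 1 * ln N" by simp
    also have "\<dots> \<le> degree_const * ln N"
      unfolding degree_const_def using \<alpha>max_nonneg L by (intro mult_right_mono mult_left_mono) auto
    finally show ?thesis by simp
  qed
  show "(\<Sum>e\<in>{e \<in> edge_set N M d. i \<in> snd e \<and> j \<in> snd e}. presence_prob N d \<alpha> \<sigma> e) \<le> degree_const * ln N / N"
    if ij: "i < N" "j < N" "i \<noteq> j" for i j
  proof -
    have "(\<Sum>e\<in>{e \<in> edge_set N M d. {i, j} \<subseteq> snd e}. presence_prob N d \<alpha> \<sigma> e) \<le>
        (\<Sum>m=1..M. real ((N - card {i, j}) choose (d m - card {i, j})) * (\<alpha>max * ln N / ((N - 1) choose (d m - 1))))"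
      using ij by (intro le_sum) auto
    also have "\<dots> \<le> (\<Sum>m=1..M. \<alpha>max * ln N * (2 * dmax / N))"
    proof (intro sum_mono)
      fix m assume m: "m \<in> {1..M}"
      have c2: "card {i, j} = 2" using ij by simp
      let ?b = "real ((N - 1) choose (d m - 1))"
      have absorb: "real (d m - 1) * ?b = real (N - 1) * real ((N - 2) choose (d m - 2))"
      proof -
        have "(d m - 1) * ((N - 1) choose (d m - 1)) = (N - 1) * ((N - 1 - 1) choose (d m - 1 - 1))"
          using d_ge[OF m] by (intro times_binomial_minus1_eq) auto
        then have "(d m - 1) * ((N - 1) choose (d m - 1)) = (N - 1) * ((N - 2) choose (d m - 2))"
          by (simp add: numeral_2_eq_2)
        then show ?thesis by (metis of_nat_mult)
      qed
      have "real ((N - card {i, j}) choose (d m - card {i, j})) * (\<alpha>max * ln N / ?b) =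
          \<alpha>max * ln N * (real ((N - 2) choose (d m - 2)) / ?b)" unfolding c2 by simp
      also have "\<dots> \<le> \<alpha>max * ln N * (2 * dmax / N)"
      proof (intro mult_left_mono)
        show "real ((N - 2) choose (d m - 2)) / ?b \<le> 2 * dmax / N"
        proof (cases "?b = 0")
          case True
          show ?thesis unfolding True by simp
        next
          case False
          have "real ((N - 2) choose (d m - 2)) = real (d m - 1) * ?b / real (N - 1)"
            using absorb N by (simp add: field_simps)
          then have "real ((N - 2) choose (d m - 2)) / ?b = real (d m - 1) / real (N - 1)"
            using False by simp
          also have "\<dots> \<le> dmax / (N / 2)"
            using d_le_dmax[OF m] N by (intro frac_le) auto
          finally show ?thesis by (simp add: mult.commute)
        qed
      qed (use \<alpha>max_nonneg L in auto)
      finally show "real ((N - card {i, j}) choose (d m - card {i, j})) * (\<alpha>max * ln N / ?b) \<le>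
          \<alpha>max * ln N * (2 * dmax / N)" .
    qed
    also have "\<dots> = real M * \<alpha>max * (2 * dmax) * ln N / N" by simp
    also have "\<dots> \<le> degree_const * ln N / N"
      unfolding degree_const_def using \<alpha>max_nonneg L
      by (intro divide_right_mono mult_right_mono mult_left_mono) auto
    finally show ?thesis by simp
  qed
qed

lemma similarity_matrix_eq_W:
  assumes \<sigma>: "\<sigma> \<in> communities N" "N \<ge> 2" and ij: "i < N" "j < N"
  shows "similarity_matrix N M d A $$ (i, j) = random_hypergraph.W (edge_set N M d) snd A i j"
proof -
  have eq: "similarity_matrix N M d A $$ (i, j) = (\<Sum>e\<in>edge_set N M d. of_bool (A e) * of_bool (i \<noteq> j \<and> i \<in> snd e \<and> j \<in> snd e))"
  proof (cases "i = j")
    case True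
    then show ?thesis using ij by (simp add: similarity_matrix_def)
  next
    case False
    have "(\<Sum>e\<in>edge_set N M d. of_bool (A e) * of_bool (i \<noteq> j \<and> i \<in> snd e \<and> j \<in> snd e) :: real) =
        (\<Sum>m=1..M. \<Sum>e\<in>{e \<in> hyperedges N (d m). {i, j} \<subseteq> e}. of_bool (A (m, e)) * of_bool (i \<noteq> j \<and> i \<in> e \<and> j \<in> e))"
      by (rule sum_edge_set_of_bool[where S = "{i, j}"
            and f = "\<lambda>e. of_bool (A e) * of_bool (i \<noteq> j \<and> i \<in> snd e \<and> j \<in> snd e)", unfolded snd_conv]) auto
    also have "\<dots> = (\<Sum>m=1..M. \<Sum>e\<in>{e \<in> hyperedges N (d m). i \<in> e \<and> j \<in> e}. of_bool (A (m, e)))"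
      using False by (intro sum.cong) auto
    finally show ?thesis using ij False by (simp add: similarity_matrix_def)
  qed
  interpret H: random_hypergraph N "edge_set N M d" snd "presence_prob N d \<alpha> \<sigma>" dmax degree_const
    by (rule hsbm_random_hypergraph[OF \<sigma>])
  show ?thesis using eq by (simp add: H.W_def H.pair_def)
qed

end

context symmetric_rates
begin

text \<open>
  The negative logarithm of the Laplace transform bound for a signed degree when both communities have
  \<open>n\<close> members: \<open>r\<close> counts the members of a hyperedge in the opposite community.
\<close>

definition laplace_exponent :: "nat \<Rightarrow> real \<Rightarrow> real" where
  "laplace_exponent n l = (\<Sum>m=1..M. \<Sum>r\<le>d m - 1. real (n choose r) * real ((n - 1) choose (d m - 1 - r)) *
     (edge_prob (2 * n) d \<alpha> m (r, d m - r) * (1 - exp (- l * (real (d m) - 1 - 2 * real r)))))"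

lemma laplace_exponent_asymptotic: "(\<lambda>n. laplace_exponent n l / ln (2 * n)) \<longlonglongrightarrow> rate_function M d \<alpha> l"
proof -
  have summand: "(\<lambda>n. real (n choose r) * real ((n - 1) choose (d m - 1 - r)) *
     (edge_prob (2 * n) d \<alpha> m (r, d m - r) * (1 - exp (- l * (real (d m) - 1 - 2 * real r)))) / ln (2 * n))
    \<longlonglongrightarrow> (1 / 2 ^ (d m - 1)) * real ((d m - 1) choose r) * \<alpha> m (r, d m - r) *
     (1 - exp (- l * (real (d m) - 1 - 2 * real r)))" if m: "m \<in> {1..M}" and r: "r \<le> d m - 1" for m r
  proof -
    let ?a = "\<alpha> m (r, d m - r)" and ?x = "1 - exp (- l * (real (d m) - 1 - 2 * real r))" and ?k = "d m - 1"
    have k: "1 \<le> ?k" using d_ge[OF m] by simp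
    have "(\<lambda>n. (real (n choose r) * real ((n - 1) choose (?k - r)) / real ((2 * n - 1) choose ?k)) * (?a * ?x))
      \<longlonglongrightarrow> real (?k choose r) / 2 ^ ?k * (?a * ?x)"
      by (intro tendsto_mult tendsto_const hypergeometric_tendsto_binomial r)
    also have "real (?k choose r) / 2 ^ ?k * (?a * ?x) = (1 / 2 ^ ?k) * real (?k choose r) * ?a * ?x" by simp
    finally show ?thesis
    proof (rule Lim_transform_eventually)
      have "\<forall>\<^sub>F n in sequentially. ?a * ln (real (2 * n)) / real ((2 * n - 1) choose ?k) < 1"
        using ln_over_binomial_tendsto_0[OF k] by (rule order_tendstoD) simp
      then show "\<forall>\<^sub>F n in sequentially. (real (n choose r) * real ((n - 1) choose (?k - r)) / real ((2 * n - 1) choose ?k)) * (?a * ?x) =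
          real (n choose r) * real ((n - 1) choose (?k - r)) * (edge_prob (2 * n) d \<alpha> m (r, d m - r) * ?x) / ln (2 * n)"
        using eventually_gt_at_top[of 1]
      proof eventually_elim
        case (elim n)
        have "ln (real (2 * n)) > 0" using elim by simp
        moreover have "edge_prob (2 * n) d \<alpha> m (r, d m - r) = ?a * ln (real (2 * n)) / real ((2 * n - 1) choose ?k)"
          using elim by (simp add: edge_prob_def)
        ultimately show ?case by simp
      qed
    qed
  qed
  have "(\<lambda>n. \<Sum>m=1..M. \<Sum>r\<le>d m - 1. real (n choose r) * real ((n - 1) choose (d m - 1 - r)) *
     (edge_prob (2 * n) d \<alpha> m (r, d m - r) * (1 - exp (- l * (real (d m) - 1 - 2 * real r)))) / ln (2 * n))
    \<longlonglongrightarrow> (\<Sum>m=1..M. \<Sum>r\<le>d m - 1. (1 / 2 ^ (d m - 1)) * real ((d m - 1) choose r) * \<alpha> m (r, d m - r) *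
     (1 - exp (- l * (real (d m) - 1 - 2 * real r))))"
    by (intro tendsto_sum summand) auto
  then show ?thesis
    by (simp only: laplace_exponent_def rate_function_def sum_divide_distrib atMost_atLeast0)
qed

end

section \<open>Recovery for a fixed community vector\<close>

locale fixed_communities = symmetric_rates +
  fixes N :: nat and \<sigma> :: "real vec"
  assumes \<sigma>: "\<sigma> \<in> communities N" and N2: "N \<ge> 2"
begin

sublocale H: random_hypergraph N "edge_set N M d" snd "presence_prob N d \<alpha> \<sigma>" dmax degree_const
  by (rule hsbm_random_hypergraph[OF \<sigma> N2])

lemma sgn_sq: "i < N \<Longrightarrow> \<sigma> $ i * \<sigma> $ i = 1"
  using communitiesD(2)[OF \<sigma>] by fastforce

lemma sgn_mult_opposite: "i < N \<Longrightarrow> j < N \<Longrightarrow> \<sigma> $ i * \<sigma> $ j = (if j \<in> opposite N \<sigma> i then -1 else 1)"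
  using communitiesD(2)[OF \<sigma>, of i] communitiesD(2)[OF \<sigma>, of j] by (auto simp: opposite_def)

lemma pair_form:
  assumes e: "e \<in> hyperedges N (d m)" and i: "i \<in> e"
  shows "(\<Sum>j<N. H.pair (m, e) i j * (\<sigma> $ i * \<sigma> $ j)) = real (d m) - 1 - 2 * real (card (e \<inter> opposite N \<sigma> i))"
proof -
  have eN: "e \<subseteq> {..<N}" "finite e" "card e = d m" using e by (auto simp: hyperedges_def intro: finite_subset)
  then have iN: "i < N" using i by auto
  have "(\<Sum>j<N. H.pair (m, e) i j * (\<sigma> $ i * \<sigma> $ j)) = (\<Sum>j\<in>e. of_bool (i \<noteq> j) * (\<sigma> $ i * \<sigma> $ j))"
    using eN i by (intro sum.mono_neutral_cong_right) (auto simp: H.pair_def)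
  also have "\<dots> = (\<Sum>j\<in>e. 1 - (if j = i then 1 else 0) - 2 * of_bool (j \<in> opposite N \<sigma> i))"
  proof (intro sum.cong refl)
    fix j assume "j \<in> e"
    then have "j < N" using eN by auto
    have "i \<notin> opposite N \<sigma> i" by (simp add: opposite_def)
    then show "of_bool (i \<noteq> j) * (\<sigma> $ i * \<sigma> $ j) = 1 - (if j = i then 1 else 0) - 2 * of_bool (j \<in> opposite N \<sigma> i)"
      using sgn_mult_opposite[OF iN \<open>j < N\<close>] by auto
  qed
  also have "\<dots> = real (d m) - 1 - 2 * real (card (e \<inter> opposite N \<sigma> i))"
    using eN i by (simp add: sum_subtractf Int_def flip: sum_distrib_left)
  finally show ?thesis .
qed

lemma laplace_exponent_signed_degree:
  assumes i: "i < N"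
  shows "(\<Sum>e\<in>edge_set N M d. presence_prob N d \<alpha> \<sigma> e *
      (1 - exp (- l * (\<Sum>j<N. H.pair e i j * (\<sigma> $ i * \<sigma> $ j))))) = laplace_exponent (N div 2) l"
proof -
  let ?O = "opposite N \<sigma> i"
  let ?f = "\<lambda>e. presence_prob N d \<alpha> \<sigma> e * (1 - exp (- l * (\<Sum>j<N. H.pair e i j * (\<sigma> $ i * \<sigma> $ j))))"
  have even: "2 * (N div 2) = N"
  proof -
    have "?O \<union> ({..<N} - ?O) = {..<N}" by (auto simp: opposite_def)
    then have "card ?O + card ({..<N} - ?O) = card {..<N}"
      using card_Un_disjoint[of ?O "{..<N} - ?O"] finite_opposite by simp
    then show ?thesis using card_opposite[OF \<sigma> i] by simp
  qed
  have iO: "i \<notin> ?O" by (simp add: opposite_def)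
  have c1: "card (?O - {i}) = N div 2" using card_opposite[OF \<sigma> i] iO by simp
  have c2: "card ({..<N} - ?O - {i}) = N div 2 - 1"
    using card_opposite[OF \<sigma> i] iO i by (subst card_Diff_singleton) auto
  have c3: "card ({i} \<inter> ?O) = 0" using iO by simp
  have "(\<Sum>e\<in>edge_set N M d. ?f e) = (\<Sum>m=1..M. \<Sum>e\<in>{e \<in> hyperedges N (d m). {i} \<subseteq> e}. ?f (m, e))"
    by (rule sum_edge_set_of_bool) (simp add: H.pair_def)
  also have "\<dots> = laplace_exponent (N div 2) l"
    unfolding laplace_exponent_def
  proof (intro sum.cong refl)
    fix m assume m: "m \<in> {1..M}"
    let ?g = "\<lambda>r. edge_prob N d \<alpha> m (r, d m - r) * (1 - exp (- l * (real (d m) - 1 - 2 * real r)))"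
    have "(\<Sum>e\<in>{e \<in> hyperedges N (d m). {i} \<subseteq> e}. ?f (m, e)) =
        (\<Sum>e\<in>{e \<in> hyperedges N (d m). {i} \<subseteq> e}. ?g (card (e \<inter> ?O)))"
      using edge_prob_profile[OF \<sigma> m] by (intro sum.cong refl) (simp add: presence_prob_def pair_form)
    also have "\<dots> = (\<Sum>r\<le>d m - card {i}. real (card (?O - {i}) choose r) *
        real (card ({..<N} - ?O - {i}) choose (d m - card {i} - r)) * ?g (r + card ({i} \<inter> ?O)))"
      by (rule sum_hyperedges_containing) (use i d_ge[OF m] in \<open>auto simp: opposite_def\<close>)
    finally show "(\<Sum>e\<in>{e \<in> hyperedges N (d m). {i} \<subseteq> e}. ?f (m, e)) =
        (\<Sum>r\<le>d m - 1. real (N div 2 choose r) * real (N div 2 - 1 choose (d m - 1 - r)) *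
          (edge_prob (2 * (N div 2)) d \<alpha> m (r, d m - r) * (1 - exp (- l * (real (d m) - 1 - 2 * real r)))))"
      unfolding c1 c2 c3 even by simp
  qed
  finally show ?thesis .
qed

text \<open>
  The mean matrix has only two off-diagonal values. For equal signs both vertices are removed from the same
  community; for different signs one is removed from each, and the hyperedge already has one opposite member,
  hence the shift \<open>r + 1\<close>.
\<close>

lemma V_block: "\<exists>a b. \<forall>i<N. \<forall>j<N. i \<noteq> j \<longrightarrow> H.V i j = (if \<sigma> $ i = \<sigma> $ j then a else b)"
proof -
  let ?n = "N div 2"
  let ?a = "\<Sum>m=1..M. \<Sum>r\<le>d m - 2. real (?n choose r) * real ((?n - 2) choose (d m - 2 - r)) * edge_prob N d \<alpha> m (r, d m - r)"
  let ?b = "\<Sum>m=1..M. \<Sum>r\<le>d m - 2. real ((?n - 1) choose r) * real ((?n - 1) choose (d m - 2 - r)) * edge_prob N d \<alpha> m (r + 1, d m - (r + 1))"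
  have "H.V i j = (if \<sigma> $ i = \<sigma> $ j then ?a else ?b)" if ij: "i < N" "j < N" "i \<noteq> j" for i j
  proof -
    let ?O = "opposite N \<sigma> i"
    have iO: "i \<notin> ?O" by (simp add: opposite_def)
    have fin: "finite ?O" by (rule finite_opposite)
    note card = card_opposite[OF \<sigma> ij(1)]
    have c: "card {i, j} = 2" using ij by simp
    have c1: "card (?O - {i, j}) = (if \<sigma> $ i = \<sigma> $ j then ?n else ?n - 1)"
    proof (cases "\<sigma> $ i = \<sigma> $ j")
      case True
      then have "?O - {i, j} = ?O" by (auto simp: opposite_def)
      then show ?thesis using True card by simp
    next
      case False
      then have "?O - {i, j} = ?O - {j}" "j \<in> ?O" using iO ij by (auto simp: opposite_def)
      then show ?thesis using False card fin by simp
    qed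
    have c2: "card ({..<N} - ?O - {i, j}) = (if \<sigma> $ i = \<sigma> $ j then ?n - 2 else ?n - 1)"
    proof (cases "\<sigma> $ i = \<sigma> $ j")
      case True
      then have "{i, j} \<subseteq> {..<N} - ?O" using ij by (auto simp: opposite_def)
      then show ?thesis using True card c by (subst card_Diff_subset) auto
    next
      case False
      then have "{..<N} - ?O - {i, j} = {..<N} - ?O - {i}" using ij by (auto simp: opposite_def)
      moreover have "i \<in> {..<N} - ?O" using iO ij by simp
      ultimately show ?thesis using False card by (simp add: card_Diff_singleton)
    qed
    have c3: "card ({i, j} \<inter> ?O) = (if \<sigma> $ i = \<sigma> $ j then 0 else 1)"
    proof (cases "\<sigma> $ i = \<sigma> $ j")
      case True
      then have "{i, j} \<inter> ?O = {}" by (auto simp: opposite_def)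
      then show ?thesis using True by simp
    next
      case False
      then have "{i, j} \<inter> ?O = {j}" using ij by (auto simp: opposite_def)
      then show ?thesis using False by simp
    qed
    have "H.V i j = (\<Sum>m=1..M. \<Sum>e\<in>{e \<in> hyperedges N (d m). {i, j} \<subseteq> e}. presence_prob N d \<alpha> \<sigma> (m, e) * H.pair (m, e) i j)"
      unfolding H.V_def by (rule sum_edge_set_of_bool) (auto simp: H.pair_def)
    also have "\<dots> = (\<Sum>m=1..M. \<Sum>r\<le>d m - card {i, j}. real (card (?O - {i, j}) choose r) *
        real (card ({..<N} - ?O - {i, j}) choose (d m - card {i, j} - r)) *
        edge_prob N d \<alpha> m (r + card ({i, j} \<inter> ?O), d m - (r + card ({i, j} \<inter> ?O))))"
    proof (intro sum.cong refl)
      fix m assume m: "m \<in> {1..M}"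
      have "(\<Sum>e\<in>{e \<in> hyperedges N (d m). {i, j} \<subseteq> e}. presence_prob N d \<alpha> \<sigma> (m, e) * H.pair (m, e) i j) =
        (\<Sum>e\<in>{e \<in> hyperedges N (d m). {i, j} \<subseteq> e}. edge_prob N d \<alpha> m (card (e \<inter> ?O), d m - card (e \<inter> ?O)))"
        using edge_prob_profile[OF \<sigma> m] ij(3) by (intro sum.cong refl) (simp add: presence_prob_def H.pair_def)
      also have "\<dots> = (\<Sum>r\<le>d m - card {i, j}. real (card (?O - {i, j}) choose r) *
        real (card ({..<N} - ?O - {i, j}) choose (d m - card {i, j} - r)) *
        edge_prob N d \<alpha> m (r + card ({i, j} \<inter> ?O), d m - (r + card ({i, j} \<inter> ?O))))"
        by (rule sum_hyperedges_containing[where g = "\<lambda>r. edge_prob N d \<alpha> m (r, d m - r)"])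
          (use ij c d_ge[OF m] in \<open>auto simp: opposite_def\<close>)
      finally show "(\<Sum>e\<in>{e \<in> hyperedges N (d m). {i, j} \<subseteq> e}. presence_prob N d \<alpha> \<sigma> (m, e) * H.pair (m, e) i j) = \<dots>" .
    qed
    also have "\<dots> = (if \<sigma> $ i = \<sigma> $ j then ?a else ?b)"
      unfolding c c1 c2 c3 by simp
    finally show ?thesis .
  qed
  then show ?thesis by blast
qed

text \<open>
  Off the diagonal \<open>V = (a + b) / 2 + (a - b) / 2 * \<sigma>\<^sub>i \<sigma>\<^sub>j\<close>, and these two parts vanish on \<open>x\<close>. The diagonal of
  \<open>V\<close> is 0 instead of \<open>a\<close>, which leaves \<open>- a\<close> times the squared norm.
\<close>

lemma V_form_orthogonal:
  assumes x: "(\<Sum>i<N. x i) = 0" "(\<Sum>i<N. \<sigma> $ i * x i) = 0"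
  shows "\<bar>\<Sum>i<N. \<Sum>j<N. H.V i j * (x i * x j)\<bar> \<le> degree_const * ln N / N * (\<Sum>i<N. (x i)\<^sup>2)"
proof -
  obtain a0 b where ab0: "\<And>i j. i < N \<Longrightarrow> j < N \<Longrightarrow> i \<noteq> j \<Longrightarrow> H.V i j = (if \<sigma> $ i = \<sigma> $ j then a0 else b)"
    using V_block by blast
  \<comment> \<open>If no two vertices share a sign, the value for equal signs is arbitrary, and 0 is within the bounds.\<close>
  define a where "a = (if \<exists>i<N. \<exists>j<N. i \<noteq> j \<and> \<sigma> $ i = \<sigma> $ j then a0 else 0)"
  have ab: "H.V i j = (if \<sigma> $ i = \<sigma> $ j then a else b)" if "i < N" "j < N" "i \<noteq> j" for i j
    using ab0[OF that] that by (auto simp: a_def)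
  have a: "0 \<le> a" "a \<le> degree_const * ln N / N"
  proof -
    have "0 \<le> a \<and> a \<le> degree_const * ln N / N"
    proof (cases "\<exists>i<N. \<exists>j<N. i \<noteq> j \<and> \<sigma> $ i = \<sigma> $ j")
      case True
      then obtain i j where "i < N" "j < N" "i \<noteq> j" "\<sigma> $ i = \<sigma> $ j" by blast
      then show ?thesis using ab[of i j] H.V_nonneg[of i j] H.V_le[of i j] by auto
    next
      case False
      then have "a = 0" by (simp only: a_def if_False)
      then show ?thesis using H.C H.lnN by simp
    qed
    then show "0 \<le> a" "a \<le> degree_const * ln N / N" by auto
  qed
  have pt: "H.V i j * (x i * x j) = (a + b) / 2 * (x i * x j) + (a - b) / 2 * ((\<sigma> $ i * x i) * (\<sigma> $ j * x j)) -
      (if j = i then a * (x i)\<^sup>2 else 0)" if ij: "i < N" "j < N" for i j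
  proof (cases "i = j")
    case True
    then have "H.V i j = 0" by (simp add: H.V_def H.pair_def)
    moreover have "(\<sigma> $ i * x i) * (\<sigma> $ j * x j) = (\<sigma> $ i * \<sigma> $ i) * (x i * x i)"
      using True by simp
    ultimately show ?thesis
      unfolding sgn_sq[OF ij(1)] using True by (simp only:) (simp add: power2_eq_square field_simps)
  next
    case False
    have prod: "(\<sigma> $ i * x i) * (\<sigma> $ j * x j) = (\<sigma> $ i * \<sigma> $ j) * (x i * x j)" by simp
    have sgn: "\<sigma> $ i * \<sigma> $ j = (if \<sigma> $ i = \<sigma> $ j then 1 else -1)"
      using sgn_mult_opposite[OF ij] ij by (auto simp: opposite_def)
    show ?thesis
      unfolding prod sgn ab[OF ij False] using False by (cases "\<sigma> $ i = \<sigma> $ j") (simp_all add: field_simps)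
  qed
  have "(\<Sum>i<N. \<Sum>j<N. H.V i j * (x i * x j)) = (\<Sum>i<N. \<Sum>j<N. (a + b) / 2 * (x i * x j) +
      (a - b) / 2 * ((\<sigma> $ i * x i) * (\<sigma> $ j * x j)) - (if j = i then a * (x i)\<^sup>2 else 0))"
    by (intro sum.cong refl pt) auto
  also have "\<dots> = (a + b) / 2 * ((\<Sum>i<N. x i) * (\<Sum>j<N. x j)) +
      (a - b) / 2 * ((\<Sum>i<N. \<sigma> $ i * x i) * (\<Sum>j<N. \<sigma> $ j * x j)) - a * (\<Sum>i<N. (x i)\<^sup>2)"
  proof -
    have "(\<Sum>i<N. \<Sum>j<N. k * (f i * f j)) = k * ((\<Sum>i<N. f i) * (\<Sum>j<N. f j))" for k :: real and f :: "nat \<Rightarrow> real"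
      unfolding sum_product by (simp only: sum_distrib_left)
    moreover have "(\<Sum>i<N. \<Sum>j<N. if j = i then a * (x i)\<^sup>2 else 0) = a * (\<Sum>i<N. (x i)\<^sup>2)"
      by (simp add: sum_distrib_left)
    ultimately show ?thesis by (simp only: sum.distrib sum_subtractf)
  qed
  also have "\<dots> = - (a * (\<Sum>i<N. (x i)\<^sup>2))" using x by simp
  finally have eq: "(\<Sum>i<N. \<Sum>j<N. H.V i j * (x i * x j)) = - (a * (\<Sum>i<N. (x i)\<^sup>2))" .
  have x2: "0 \<le> (\<Sum>i<N. (x i)\<^sup>2)" by (simp add: sum_nonneg)
  have "\<bar>- (a * (\<Sum>i<N. (x i)\<^sup>2))\<bar> = a * (\<Sum>i<N. (x i)\<^sup>2)" using a(1) x2 by simp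
  then show ?thesis unfolding eq using mult_right_mono[OF a(2) x2] by simp
qed

lemma recovers_of_good_event:
  assumes s: "s \<in> {-1, 1}" and gap: "\<And>i. i < N \<Longrightarrow> \<epsilon> * ln N \<le> (\<Sum>j<N. s * H.W A i j * (\<sigma> $ i * \<sigma> $ j))"
    and form: "\<And>x. (\<Sum>i<N. \<Sum>j<N. s * (H.W A i j - H.V i j) * (x i * x j)) \<le> \<epsilon> / 4 * ln N * (\<Sum>i<N. (x i)\<^sup>2)"
    and \<epsilon>: "\<epsilon> > 0" and large: "degree_const / N \<le> \<epsilon> / 4"
  shows "(\<sigma>, A) \<in> sdp_recovers c N M d s"
proof -
  have lnN: "ln (real N) > 0" using N2 by simp
  have W: "similarity_matrix N M d A $$ (i, j) = H.W A i j" if "i < N" "j < N" for i j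
    by (rule similarity_matrix_eq_W[OF \<sigma> N2 that])
  have "sdp_outputs c N (similarity_matrix N M d A) s \<noteq> {} \<and> sdp_outputs c N (similarity_matrix N M d A) s \<subseteq> {\<sigma>, - \<sigma>}"
  proof (rule sdp_outputs_of_spectral_gap[OF N2 \<sigma>])
    show "similarity_matrix N M d A $$ (i, j) = similarity_matrix N M d A $$ (j, i)" if "i < N" "j < N" for i j
      using that H.W_sym by (simp add: W)
    show "similarity_matrix N M d A $$ (i, i) = 0" if "i < N" for i
      using that by (simp add: similarity_matrix_def)
    fix x :: "nat \<Rightarrow> real"
    assume x: "(\<Sum>i<N. x i) = 0" "(\<Sum>i<N. \<sigma> $ i * x i) = 0" "\<exists>i<N. x i \<noteq> 0"
    have x2: "0 < (\<Sum>i<N. (x i)\<^sup>2)"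
      using x(3) by (auto intro!: sum_pos2)
    have "signed_laplacian_form N (\<lambda>i j. s * similarity_matrix N M d A $$ (i, j)) (\<lambda>i. \<sigma> $ i) x =
        (\<Sum>i<N. (\<Sum>j<N. s * H.W A i j * (\<sigma> $ i * \<sigma> $ j)) * (x i)\<^sup>2) - (\<Sum>i<N. \<Sum>j<N. s * H.W A i j * (x i * x j))"
      unfolding signed_laplacian_form_def by (simp add: W mult.assoc)
    moreover have "(\<Sum>i<N. \<Sum>j<N. s * H.W A i j * (x i * x j)) =
        (\<Sum>i<N. \<Sum>j<N. s * (H.W A i j - H.V i j) * (x i * x j)) + s * (\<Sum>i<N. \<Sum>j<N. H.V i j * (x i * x j))"
      unfolding sum_distrib_left sum.distrib[symmetric] by (intro sum.cong refl) (simp add: algebra_simps)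
    moreover have "s * (\<Sum>i<N. \<Sum>j<N. H.V i j * (x i * x j)) \<le> degree_const * ln N / N * (\<Sum>i<N. (x i)\<^sup>2)"
      using V_form_orthogonal[OF x(1,2)] s by auto
    moreover have "degree_const * ln N / N * (\<Sum>i<N. (x i)\<^sup>2) \<le> \<epsilon> / 4 * ln N * (\<Sum>i<N. (x i)\<^sup>2)"
      using mult_right_mono[OF large, of "ln N * (\<Sum>i<N. (x i)\<^sup>2)"] lnN x2 by (simp add: mult.assoc)
    moreover have "\<epsilon> * ln N * (\<Sum>i<N. (x i)\<^sup>2) \<le> (\<Sum>i<N. (\<Sum>j<N. s * H.W A i j * (\<sigma> $ i * \<sigma> $ j)) * (x i)\<^sup>2)"
      unfolding sum_distrib_left by (intro sum_mono mult_right_mono gap) auto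
    moreover have "0 < \<epsilon> * ln N * (\<Sum>i<N. (x i)\<^sup>2)" using \<epsilon> lnN x2 by simp
    ultimately show "0 < signed_laplacian_form N (\<lambda>i j. s * similarity_matrix N M d A $$ (i, j)) (\<lambda>i. \<sigma> $ i) x"
      using form[of x] by linarith
  qed
  then show ?thesis by (simp add: sdp_recovers_def)
qed

lemma prob_not_recovers:
  assumes s: "s \<in> {-1, 1}" and l: "s * \<bar>l\<bar> = l" and \<epsilon>: "\<epsilon> > 0" and large: "degree_const / N \<le> \<epsilon> / 4"
    and b: "measure_pmf.prob H.G {A. \<not> (\<forall>x. (\<Sum>i<N. \<Sum>j<N. s * (H.W A i j - H.V i j) * (x i * x j)) \<le> \<epsilon> / 4 * ln N * (\<Sum>i<N. (x i)\<^sup>2))} \<le> b"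
  shows "measure_pmf.prob H.G {A. (\<sigma>, A) \<notin> sdp_recovers c N M d s} \<le> b + N * exp (\<bar>l\<bar> * (\<epsilon> * ln N) - laplace_exponent (N div 2) l)"
proof -
  let ?bad1 = "\<lambda>A. \<not> (\<forall>x. (\<Sum>i<N. \<Sum>j<N. s * (H.W A i j - H.V i j) * (x i * x j)) \<le> \<epsilon> / 4 * ln N * (\<Sum>i<N. (x i)\<^sup>2))"
  let ?bad2 = "\<lambda>A. \<exists>i\<in>{..<N}. (\<Sum>j<N. s * H.W A i j * (\<sigma> $ i * \<sigma> $ j)) \<le> \<epsilon> * ln N"
  have "measure_pmf.prob H.G {A. (\<sigma>, A) \<notin> sdp_recovers c N M d s} \<le> measure_pmf.prob H.G {A. ?bad1 A \<or> ?bad2 A}"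
  proof (rule prob_Collect_mono)
    fix A assume nr: "(\<sigma>, A) \<notin> sdp_recovers c N M d s"
    show "?bad1 A \<or> ?bad2 A"
    proof (rule ccontr)
      assume good: "\<not> (?bad1 A \<or> ?bad2 A)"
      have "(\<sigma>, A) \<in> sdp_recovers c N M d s"
      proof (rule recovers_of_good_event[OF s _ _ \<epsilon> large])
        show "\<epsilon> * ln N \<le> (\<Sum>j<N. s * H.W A i j * (\<sigma> $ i * \<sigma> $ j))" if "i < N" for i
          using good that by (meson lessThan_iff less_imp_le not_le)
        show "(\<Sum>i<N. \<Sum>j<N. s * (H.W A i j - H.V i j) * (x i * x j)) \<le> \<epsilon> / 4 * ln N * (\<Sum>i<N. (x i)\<^sup>2)" for x
          using good by blast
      qed
      then show False using nr by simp
    qed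
  qed
  also have "\<dots> \<le> b + (\<Sum>i<N. exp (\<bar>l\<bar> * (\<epsilon> * ln N) - laplace_exponent (N div 2) l))"
  proof (intro prob_disj_le b prob_Bex_le)
    fix i assume "i \<in> {..<N}"
    then show "measure_pmf.prob H.G {A. (\<Sum>j<N. s * H.W A i j * (\<sigma> $ i * \<sigma> $ j)) \<le> \<epsilon> * ln N} \<le>
        exp (\<bar>l\<bar> * (\<epsilon> * ln N) - laplace_exponent (N div 2) l)"
      using H.prob_signed_degree_le[OF l, of i "\<lambda>i. \<sigma> $ i" "\<epsilon> * ln N"] by (simp only: laplace_exponent_signed_degree lessThan_iff)
  qed simp
  finally show ?thesis by simp
qed

end

section \<open>Exact recovery\<close>

lemma finite_communities: "finite (communities N)"
proof -
  have "communities N \<subseteq> vec N ` (PiE {..<N} (\<lambda>_. {-1, 1}))"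
  proof
    fix \<sigma> assume \<sigma>: "\<sigma> \<in> communities N"
    have "\<sigma> = vec N (restrict (\<lambda>i. \<sigma> $ i) {..<N})"
      using communitiesD(1)[OF \<sigma>] by (intro eq_vecI) auto
    moreover have "restrict (\<lambda>i. \<sigma> $ i) {..<N} \<in> PiE {..<N} (\<lambda>_. {-1, 1})"
      using communitiesD(2)[OF \<sigma>] by auto
    ultimately show "\<sigma> \<in> vec N ` (PiE {..<N} (\<lambda>_. {-1, 1}))" by blast
  qed
  then show ?thesis by (rule finite_subset) (intro finite_imageI finite_PiE, auto)
qed

lemma communities_nonempty: "communities (2 * n) \<noteq> {}"
proof -
  define \<sigma> :: "real vec" where "\<sigma> = vec (2 * n) (\<lambda>i. if i < n then 1 else -1)"
  have "{i. i < 2 * n \<and> \<sigma> $ i = 1} = {..<n}" "{i. i < 2 * n \<and> \<sigma> $ i = -1} = {n..<2 * n}"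
    by (auto simp: \<sigma>_def split: if_splits)
  then have "\<sigma> \<in> communities (2 * n)" by (auto simp: communities_def \<sigma>_def)
  then show ?thesis by blast
qed

text \<open>
  A bound that is uniform in the community vector survives averaging over it.
\<close>

lemma prob_hsbm_le:
  assumes "\<And>\<sigma>. \<sigma> \<in> communities (2 * n) \<Longrightarrow> measure_pmf.prob (Pi_pmf (edge_set (2 * n) M d) False
      (\<lambda>e. bernoulli_pmf (presence_prob (2 * n) d \<alpha> \<sigma> e))) {A. (\<sigma>, A) \<notin> R} \<le> q" and "0 \<le> q"
  shows "measure_pmf.prob (hsbm (2 * n) M d \<alpha>) R \<ge> 1 - q"
proof -
  let ?P = "\<lambda>\<sigma>. Pi_pmf (edge_set (2 * n) M d) False (\<lambda>e. bernoulli_pmf (presence_prob (2 * n) d \<alpha> \<sigma> e))"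
  have hsbm: "hsbm (2 * n) M d \<alpha> = bind_pmf (pmf_of_set (communities (2 * n))) (\<lambda>\<sigma>. map_pmf (\<lambda>A. (\<sigma>, A)) (?P \<sigma>))"
    by (simp add: hsbm_def edge_set_def presence_prob_def case_prod_unfold)
  have set: "set_pmf (pmf_of_set (communities (2 * n))) = communities (2 * n)"
    using finite_communities communities_nonempty by (rule set_pmf_of_set[rotated])
  have "emeasure (hsbm (2 * n) M d \<alpha>) (- R) =
      (\<integral>\<^sup>+\<sigma>. emeasure (map_pmf (\<lambda>A. (\<sigma>, A)) (?P \<sigma>)) (- R) \<partial>pmf_of_set (communities (2 * n)))"
    unfolding hsbm by (rule emeasure_bind_pmf)
  also have "\<dots> \<le> (\<integral>\<^sup>+\<sigma>. ennreal q \<partial>pmf_of_set (communities (2 * n)))"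
  proof (intro nn_integral_mono_AE AE_pmfI)
    fix \<sigma> assume "\<sigma> \<in> set_pmf (pmf_of_set (communities (2 * n)))"
    then have "measure_pmf.prob (?P \<sigma>) {A. (\<sigma>, A) \<notin> R} \<le> q" using assms set by simp
    moreover have "measure_pmf.prob (map_pmf (\<lambda>A. (\<sigma>, A)) (?P \<sigma>)) (- R) = measure_pmf.prob (?P \<sigma>) {A. (\<sigma>, A) \<notin> R}"
      unfolding measure_map_pmf by (rule arg_cong[where f = "measure_pmf.prob _"]) auto
    ultimately show "emeasure (map_pmf (\<lambda>A. (\<sigma>, A)) (?P \<sigma>)) (- R) \<le> ennreal q"
      by (simp only: measure_pmf.emeasure_eq_measure ennreal_leI)
  qed
  also have "\<dots> = ennreal q" by simp
  finally have "measure_pmf.prob (hsbm (2 * n) M d \<alpha>) (- R) \<le> q"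
    using assms(2) by (simp add: measure_pmf.emeasure_eq_measure)
  then show ?thesis using measure_pmf.prob_compl[of R "hsbm (2 * n) M d \<alpha>"] by (simp add: Compl_eq_Diff_UNIV)
qed

theorem theorem1:
  fixes M :: nat and d :: "nat \<Rightarrow> nat" and \<alpha> :: "nat \<Rightarrow> nat \<times> nat \<Rightarrow> real" and c :: real
  assumes "M \<ge> 1"
    and "\<And>m. m \<in> {1..M} \<Longrightarrow> d m \<ge> 2"
    and "\<And>m r. m \<in> {1..M} \<Longrightarrow> r \<le> d m \<Longrightarrow> \<alpha> m (r, d m - r) = \<alpha> m (d m - r, r)"
    and "\<And>m r. m \<in> {1..M} \<Longrightarrow> r \<le> d m \<Longrightarrow> \<alpha> m (r, d m - r) > 0"
    and "c \<in> {-1, 1}"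
    and "recovery_rate M d \<alpha> > 1"
  shows "(\<lambda>n. measure_pmf.prob (hsbm (2 * n) M d \<alpha>)
            (sdp_recovers c (2 * n) M d (sgn_at c (xi M d \<alpha>)))) \<longlonglongrightarrow> 1"
proof -
  interpret symmetric_rates M d \<alpha>
    using assms(2-4) by unfold_locales
  define s where "s = sgn_at c (xi M d \<alpha>)"
  have s: "s \<in> {-1, 1}" using assms(5) by (auto simp: s_def sgn_at_def)
  obtain l where l: "rate_function M d \<alpha> l > 1" "s * \<bar>l\<bar> = l"
    using exists_rate_gt_one[of M d \<alpha> c] assms(4,6) unfolding s_def by blast
  \<comment> \<open>The excess of the rate over 1 is split into three: one part is lost to the limit of the Laplace exponent,
    one to the margin \<open>\<epsilon>\<close>, and one remains after the union bound over the \<open>N\<close> vertices.\<close>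
  define \<kappa> where "\<kappa> = (rate_function M d \<alpha> l - 1) / 3"
  define \<epsilon> where "\<epsilon> = \<kappa> / (\<bar>l\<bar> + 1)"
  have \<kappa>: "\<kappa> > 0" "rate_function M d \<alpha> l = 1 + 3 * \<kappa>" using l by (auto simp: \<kappa>_def field_simps)
  have \<epsilon>: "\<epsilon> > 0" "\<bar>l\<bar> * \<epsilon> \<le> \<kappa>" using \<kappa> by (auto simp: \<epsilon>_def field_simps)
  have C0: "degree_const \<ge> 0" using \<alpha>max_nonneg by (simp add: degree_const_def)
  have \<epsilon>4: "\<epsilon> / 4 > 0" using \<epsilon> by simp
  obtain b where b: "b \<longlonglongrightarrow> 0"
    "\<forall>N (E :: (nat \<times> nat set) set) v p s. random_hypergraph N E v p dmax degree_const \<longrightarrow> s \<in> {-1, 1} \<longrightarrow>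
      measure_pmf.prob (Pi_pmf E False (\<lambda>e. bernoulli_pmf (p e)))
      {A. \<not> (\<forall>x. (\<Sum>i<N. \<Sum>j<N. s * (random_hypergraph.W E v A i j - random_hypergraph.V E v p i j) * (x i * x j))
         \<le> \<epsilon> / 4 * ln N * (\<Sum>i<N. (x i)\<^sup>2))} \<le> b N"
    using centered_quadratic_form_small[OF \<epsilon>4 C0] by blast
  define q where "q n = b (2 * n) + exp (- \<kappa> * ln (real (2 * n)))" for n :: nat
  have q: "q \<longlonglongrightarrow> 0"
  proof -
    have "(\<lambda>n. b (2 * n)) \<longlonglongrightarrow> 0"
      by (rule filterlim_compose[OF b(1)]) (rule filterlim_subseq, simp add: strict_mono_def)
    moreover have "(\<lambda>n. exp (- \<kappa> * ln (real (2 * n)))) \<longlonglongrightarrow> 0" using \<kappa>(1) by real_asymp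
    ultimately show ?thesis unfolding q_def using tendsto_add by fastforce
  qed
  have "\<forall>\<^sub>F n in sequentially. 1 + 2 * \<kappa> < laplace_exponent n l / ln (2 * n)"
    using laplace_exponent_asymptotic by (rule order_tendstoD) (use \<kappa> in simp)
  moreover have "\<forall>\<^sub>F n in sequentially. degree_const / real (2 * n) < \<epsilon> / 4"
  proof -
    have "(\<lambda>n. C / real (2 * n)) \<longlonglongrightarrow> 0" for C :: real by real_asymp
    then show ?thesis by (rule order_tendstoD) (use \<epsilon> in simp)
  qed
  ultimately have lower: "\<forall>\<^sub>F n in sequentially. 1 - q n \<le> measure_pmf.prob (hsbm (2 * n) M d \<alpha>) (sdp_recovers c (2 * n) M d s)"
    using eventually_ge_at_top[of 1]
  proof eventually_elim
    case (elim n)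
    define N where "N = 2 * n"
    have N: "N \<ge> 2" "N div 2 = n" "real N = 2 * real n" using elim by (auto simp: N_def)
    have lnN: "0 < ln (real N)" using N by simp
    have mg: "(1 + 2 * \<kappa>) * ln N \<le> laplace_exponent n l"
      using elim(1) lnN by (simp add: N(3) pos_less_divide_eq less_imp_le)
    have small: "N * exp (\<bar>l\<bar> * (\<epsilon> * ln N) - laplace_exponent n l) \<le> exp (- \<kappa> * ln N)"
    proof -
      have "\<bar>l\<bar> * \<epsilon> * ln N \<le> \<kappa> * ln N" using \<epsilon>(2) lnN by (intro mult_right_mono) auto
      then have "\<bar>l\<bar> * (\<epsilon> * ln N) - laplace_exponent n l \<le> - \<kappa> * ln N - ln N"
        using mg by (simp add: algebra_simps)
      then have "N * exp (\<bar>l\<bar> * (\<epsilon> * ln N) - laplace_exponent n l) \<le> N * exp (- \<kappa> * ln N - ln N)"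
        by (intro mult_left_mono) auto
      also have "\<dots> = exp (- \<kappa> * ln N)" using N by (simp add: exp_diff)
      finally show ?thesis .
    qed
    have bad: "measure_pmf.prob (Pi_pmf (edge_set N M d) False (\<lambda>e. bernoulli_pmf (presence_prob N d \<alpha> \<sigma> e)))
        {A. (\<sigma>, A) \<notin> sdp_recovers c N M d s} \<le> q n" if \<sigma>: "\<sigma> \<in> communities N" for \<sigma>
    proof -
      interpret fixed_communities M d \<alpha> N \<sigma> using \<sigma> N by unfold_locales
      have "measure_pmf.prob H.G {A. (\<sigma>, A) \<notin> sdp_recovers c N M d s} \<le>
          b N + N * exp (\<bar>l\<bar> * (\<epsilon> * ln N) - laplace_exponent (N div 2) l)"
      proof (rule prob_not_recovers[OF s l(2) \<epsilon>(1)])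
        show "degree_const / N \<le> \<epsilon> / 4" using elim(2) by (simp add: N_def)
        show "measure_pmf.prob H.G {A. \<not> (\<forall>x. (\<Sum>i<N. \<Sum>j<N. s * (H.W A i j - H.V i j) * (x i * x j)) \<le> \<epsilon> / 4 * ln N * (\<Sum>i<N. (x i)\<^sup>2))} \<le> b N"
          unfolding H.G_def by (rule b(2)[rule_format, OF H.random_hypergraph_axioms s])
      qed
      also have "\<dots> \<le> q n" using small N by (simp add: q_def N_def)
      finally show ?thesis by (simp add: H.G_def)
    qed
    obtain \<sigma> where "\<sigma> \<in> communities N" using communities_nonempty N_def by blast
    then have "0 \<le> q n" using bad measure_nonneg order_trans by blast
    then show ?case using prob_hsbm_le[of n M d \<alpha> "sdp_recovers c (2 * n) M d s" "q n"] bad by (simp add: N_def)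
  qed
  have lim: "(\<lambda>n. 1 - q n) \<longlonglongrightarrow> 1" using tendsto_diff[OF tendsto_const q, of 1] by simp
  show ?thesis
    unfolding s_def[symmetric]
    by (rule tendsto_sandwich[OF lower _ lim tendsto_const]) simp
qed

end
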